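(* Let $\mathbb{K}$ be an algebraically closed field and $r\ge 1$. Let $\sigma$ be an effective regular action of the algebraic $r$-torus $\mathbb{T}_r$ on the free associative algebra $F_2=\mathbb{K}\langle z_1,z_2\rangle$ such that the action on the commutative polynomial algebra $\mathbb{K}[x_1,x_2]$ given by the abelianization of $\sigma$ is linearizable. Then $\sigma$ itself is linearizable.
   Context: $\mathbb{T}_r=(\mathbb{K}^\times)^r$, with characters $\chi(t)=t_1^{\alpha_1}\cdots t_r^{\alpha_r}$, $\alpha\in\mathbb{Z}^r$. A regular action of $\mathbb{T}_r$ on a $\mathbb{K}$-algebra $F$ is a $\mathbb{K}$-algebra homomorphism $\sigma:F\to F\otimes\mathbb{K}[t_1^{\pm1},\ldots,t_r^{\pm1}]$ whose specializations $\sigma(t)$, $t\in\mathbb{T}_r$, satisfy $\sigma(1)=\mathrm{id}$ and $\sigma(s)\circ\sigma(t)=\sigma(st)$. It is effective if $\sigma(t)\neq\mathrm{id}$ for all $t\ne1$. The abelianization of $\sigma$ is the action induced on $F_2/I\cong\mathbb{K}[x_1,x_2]$, where $I$ is the two-sided ideal generated by all commutators $fg-gf$. An action on $\mathbb{K}\langle z_1,\ldots,z_n\rangle$ (resp. $\mathbb{K}[x_1,\ldots,x_n]$) is linear if every $\sigma(t)$ maps each generator to a $\mathbb{K}$-linear combination of the generators; it is linearizable if there is an algebra automorphism $\beta$ such that $t\mapsto \beta^{-1}\circ\sigma(t)\circ\beta$ is linear. *)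

theory Defs
  imports
    "HOL-Library.Poly_Mapping"
    "HOL-Computational_Algebra.Polynomial"
    "HOL-Analysis.Finite_Cartesian_Product"
begin

section \<open>Free associative algebras and polynomial algebras\<close>

text \<open>
  For a monoid \<open>'m\<close>, written additively, the type \<open>'m \<Rightarrow>\<^sub>0 'k\<close> with its library
  multiplication is the monoid algebra of \<open>'m\<close> over \<open>'k\<close>. The free associative algebra on
  generators indexed by \<open>'n\<close> is the algebra of the free monoid of words (addition is
  concatenation, zero is the empty word), and the commutative polynomial algebra is the algebra of
  the free commutative monoid \<open>'n \<Rightarrow>\<^sub>0 nat\<close> of exponent vectors.
\<close>

datatype 'n words = Word (letters: "'n list")

instantiation words :: (type) monoid_add
begin

definition zero_words :: "'a words" where "0 = Word []"

definition plus_words :: "'a words \<Rightarrow> 'a words \<Rightarrow> 'a words" where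
  "v + w = Word (letters v @ letters w)"

instance by standard (simp_all add: zero_words_def plus_words_def)

end

type_synonym ('n, 'k) free_algebra = "'n words \<Rightarrow>\<^sub>0 'k"
type_synonym ('n, 'k) polynomial_algebra = "('n \<Rightarrow>\<^sub>0 nat) \<Rightarrow>\<^sub>0 'k"

definition free_gen :: "'n \<Rightarrow> ('n, 'k::field) free_algebra" where
  "free_gen i = Poly_Mapping.single (Word [i]) 1"

definition poly_gen :: "'n \<Rightarrow> ('n, 'k::field) polynomial_algebra" where
  "poly_gen i = Poly_Mapping.single (Poly_Mapping.single i 1) 1"

definition alg_scale :: "'k::field \<Rightarrow> ('m \<Rightarrow>\<^sub>0 'k) \<Rightarrow> ('m \<Rightarrow>\<^sub>0 'k)" where
  "alg_scale c f = Poly_Mapping.map ((*) c) f"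

definition algebra_hom ::
    "('k::field \<Rightarrow> 'a::ring_1 \<Rightarrow> 'a) \<Rightarrow> ('k \<Rightarrow> 'b::ring_1 \<Rightarrow> 'b) \<Rightarrow> ('a \<Rightarrow> 'b) \<Rightarrow> bool" where
  "algebra_hom s1 s2 \<phi> \<longleftrightarrow>
     Vector_Spaces.linear s1 s2 \<phi> \<and> \<phi> 1 = 1 \<and> (\<forall>f g. \<phi> (f * g) = \<phi> f * \<phi> g)"

definition algebra_automorphism :: "(('m::monoid_add \<Rightarrow>\<^sub>0 'k::field) \<Rightarrow> ('m \<Rightarrow>\<^sub>0 'k)) \<Rightarrow> bool" where
  "algebra_automorphism \<beta> \<longleftrightarrow> algebra_hom alg_scale alg_scale \<beta> \<and> bij \<beta>"


section \<open>Regular torus actions\<close>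

definition torus :: "('k::field ^ 'r) set" where
  "torus = {t. \<forall>i. t $ i \<noteq> 0}"

definition character :: "int ^ 'r \<Rightarrow> 'k::field ^ 'r \<Rightarrow> 'k" where
  "character \<alpha> t = (\<Prod>i\<in>UNIV. (t $ i) powi (\<alpha> $ i))"

text \<open>
  The tensor product of a \<open>'k\<close>-algebra \<open>F\<close> with the Laurent polynomial algebra in the variables
  \<open>t\<^sub>i\<close>, \<open>i :: 'r\<close>, is represented as the algebra of Laurent polynomials with coefficients in \<open>F\<close>;
  the element \<open>\<Sum>\<^sub>\<alpha> f\<^sub>\<alpha> \<otimes> t\<^sup>\<alpha>\<close> is the finitely supported family of the \<open>f\<^sub>\<alpha>\<close>.
\<close>

type_synonym ('r, 'f) laurent = "(int ^ 'r) \<Rightarrow>\<^sub>0 'f"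

definition laurent_scale ::
    "'k::field \<Rightarrow> ('r::finite, 'm \<Rightarrow>\<^sub>0 'k) laurent \<Rightarrow> ('r, 'm \<Rightarrow>\<^sub>0 'k) laurent" where
  "laurent_scale c g = Poly_Mapping.map (alg_scale c) g"

definition evaluate_at ::
    "'k::field ^ 'r::finite \<Rightarrow> ('r, 'm \<Rightarrow>\<^sub>0 'k) laurent \<Rightarrow> ('m \<Rightarrow>\<^sub>0 'k)" where
  "evaluate_at t g =
     (\<Sum>\<alpha>\<in>Poly_Mapping.keys g. alg_scale (character \<alpha> t) (Poly_Mapping.lookup g \<alpha>))"

type_synonym ('r, 'm, 'k) coaction = "('m \<Rightarrow>\<^sub>0 'k) \<Rightarrow> ('r, 'm \<Rightarrow>\<^sub>0 'k) laurent"

definition specialization ::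
    "('r::finite, 'm, 'k::field) coaction \<Rightarrow> 'k ^ 'r \<Rightarrow> ('m \<Rightarrow>\<^sub>0 'k) \<Rightarrow> ('m \<Rightarrow>\<^sub>0 'k)" where
  "specialization \<sigma> t = evaluate_at t \<circ> \<sigma>"

definition regular_action :: "('r::finite, 'm::monoid_add, 'k::field) coaction \<Rightarrow> bool" where
  "regular_action \<sigma> \<longleftrightarrow>
     algebra_hom alg_scale laurent_scale \<sigma> \<and>
     specialization \<sigma> 1 = id \<and>
     (\<forall>s\<in>torus. \<forall>t\<in>torus. specialization \<sigma> s \<circ> specialization \<sigma> t = specialization \<sigma> (s * t))"

definition effective :: "('r::finite, 'm, 'k::field) coaction \<Rightarrow> bool" where
  "effective \<sigma> \<longleftrightarrow> (\<forall>t\<in>torus. t \<noteq> 1 \<longrightarrow> specialization \<sigma> t \<noteq> id)"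

text \<open>The parameter \<open>gen\<close> is the family of generators, \<^const>\<open>free_gen\<close> or \<^const>\<open>poly_gen\<close>.\<close>

definition linear_action ::
    "('n \<Rightarrow> ('m \<Rightarrow>\<^sub>0 'k::field)) \<Rightarrow> ('k ^ 'r \<Rightarrow> ('m \<Rightarrow>\<^sub>0 'k) \<Rightarrow> ('m \<Rightarrow>\<^sub>0 'k)) \<Rightarrow> bool" where
  "linear_action gen \<tau> \<longleftrightarrow> (\<forall>t\<in>torus. \<forall>i. \<tau> t (gen i) \<in> module.span alg_scale (range gen))"

definition linearizable ::
    "('n \<Rightarrow> ('m \<Rightarrow>\<^sub>0 'k::field)) \<Rightarrow> ('r::finite, 'm::monoid_add, 'k) coaction \<Rightarrow> bool" where
  "linearizable gen \<sigma> \<longleftrightarrow>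
     (\<exists>\<beta>. algebra_automorphism \<beta> \<and>
          linear_action gen (\<lambda>t. inv \<beta> \<circ> specialization \<sigma> t \<circ> \<beta>))"


section \<open>Abelianization\<close>

definition two_sided_ideal :: "'a::ring_1 set \<Rightarrow> bool" where
  "two_sided_ideal J \<longleftrightarrow>
     0 \<in> J \<and> (\<forall>a\<in>J. \<forall>b\<in>J. a + b \<in> J) \<and> (\<forall>a\<in>J. \<forall>r. r * a \<in> J \<and> a * r \<in> J)"

definition commutator_ideal :: "'a::ring_1 set" where
  "commutator_ideal = \<Inter>{J. two_sided_ideal J \<and> (\<forall>f g. f * g - g * f \<in> J)}"

definition exponents :: "'n words \<Rightarrow> ('n \<Rightarrow>\<^sub>0 nat)" where
  "exponents w = (\<Sum>i\<leftarrow>letters w. Poly_Mapping.single i 1)"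

text \<open>
  The canonical epimorphism from the free algebra onto the polynomial algebra, sending \<open>free_gen i\<close> to
  \<open>poly_gen i\<close>. Lemmas \<open>abelianize_hom\<close>, \<open>abelianize_free_gen\<close>, \<open>surj_abelianize\<close> and \<open>abelianize_eq_0_iff\<close>
  below show that it is a surjective algebra homomorphism with kernel \<^const>\<open>commutator_ideal\<close>,
  hence identifies the quotient by that ideal with the polynomial algebra.
\<close>

definition abelianize :: "('n, 'k::field) free_algebra \<Rightarrow> ('n, 'k) polynomial_algebra" where
  "abelianize f =
     (\<Sum>w\<in>Poly_Mapping.keys f. Poly_Mapping.single (exponents w) (Poly_Mapping.lookup f w))"

text \<open>
  The induced action on the quotient: lift along \<^const>\<open>abelianize\<close>, apply \<open>\<sigma>\<close>, and project the
  coefficients. For algebra homomorphisms \<open>\<sigma>\<close> the choice of the lift made by \<^const>\<open>inv\<close> is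
  immaterial, see \<open>abelianization_abelianize\<close>.
\<close>

definition abelianization ::
    "('r::finite, 'n words, 'k::field) coaction \<Rightarrow> ('r, 'n \<Rightarrow>\<^sub>0 nat, 'k) coaction" where
  "abelianization \<sigma> = Poly_Mapping.map abelianize \<circ> \<sigma> \<circ> inv abelianize"


section \<open>Basic facts\<close>

lemma lookup_map_0: "f 0 = 0 \<Longrightarrow> Poly_Mapping.lookup (Poly_Mapping.map f p) k = f (Poly_Mapping.lookup p k)"
  by (simp add: Poly_Mapping.map.rep_eq when_def)

lemma lookup_scale: "Poly_Mapping.lookup (alg_scale c f) k = c * Poly_Mapping.lookup f k"
  by (simp add: alg_scale_def lookup_map_0)

lemma scale_0_right [simp]: "alg_scale c 0 = 0"
  by (rule poly_mapping_eqI) (simp add: lookup_scale)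

lemma lookup_laurent_scale:
  "Poly_Mapping.lookup (laurent_scale c g) \<alpha> = alg_scale c (Poly_Mapping.lookup g \<alpha>)"
  by (simp add: laurent_scale_def lookup_map_0)

lemma vector_space_scale: "vector_space alg_scale"
  by unfold_locales (auto intro!: poly_mapping_eqI simp: lookup_scale lookup_add algebra_simps)

lemma vector_space_laurent_scale: "vector_space laurent_scale"
  by unfold_locales
    (auto intro!: poly_mapping_eqI simp: lookup_laurent_scale lookup_scale lookup_add algebra_simps)

lemma scale_sum: "alg_scale c (sum f A) = (\<Sum>a\<in>A. alg_scale c (f a))"
  using module.scale_sum_right[OF vector_space_scale[folded module_iff_vector_space]] .

lemma poly_mapping_sum_single:
  "(\<Sum>k\<in>Poly_Mapping.keys f. Poly_Mapping.single k (Poly_Mapping.lookup f k)) = f"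
  by (rule poly_mapping_eqI)
    (auto simp: lookup_sum lookup_single when_def sum.delta in_keys_iff)

lemma poly_mapping_additive_induct [case_names single add]:
  assumes single: "\<And>k c. P (Poly_Mapping.single k c)"
    and add: "\<And>p q. P p \<Longrightarrow> P q \<Longrightarrow> P (p + q)"
  shows "P (p :: 'a \<Rightarrow>\<^sub>0 'b::comm_monoid_add)"
proof -
  have "P 0" using single[of undefined 0] by simp
  then have "P (\<Sum>k\<in>A. Poly_Mapping.single k (Poly_Mapping.lookup p k))" for A
    by (induction A rule: infinite_finite_induct) (simp_all add: single add)
  then show ?thesis by (metis poly_mapping_sum_single)
qed

lemma additive_sum:
  fixes P :: "'a::ab_group_add \<Rightarrow> 'b::ab_group_add"
  assumes "\<And>f g. P (f + g) = P f + P g"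
  shows "P (sum h A) = (\<Sum>a\<in>A. P (h a))"
proof -
  interpret additive P by unfold_locales (rule assms)
  show ?thesis by (rule sum)
qed

lemma additive_mult:
  fixes P :: "('m::monoid_add \<Rightarrow>\<^sub>0 'a::ring_1) \<Rightarrow> 'b::ring_1"
  assumes add: "\<And>f g. P (f + g) = P f + P g"
    and single: "\<And>k l a b. P (Poly_Mapping.single k a * Poly_Mapping.single l b) =
      P (Poly_Mapping.single k a) * P (Poly_Mapping.single l b)"
  shows "P (f * g) = P f * P g"
proof -
  have "P ((\<Sum>k\<in>Poly_Mapping.keys f. Poly_Mapping.single k (Poly_Mapping.lookup f k)) *
           (\<Sum>l\<in>Poly_Mapping.keys g. Poly_Mapping.single l (Poly_Mapping.lookup g l))) =
        P (\<Sum>k\<in>Poly_Mapping.keys f. Poly_Mapping.single k (Poly_Mapping.lookup f k)) *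
        P (\<Sum>l\<in>Poly_Mapping.keys g. Poly_Mapping.single l (Poly_Mapping.lookup g l))"
    unfolding sum_product additive_sum[of P, OF add] single ..
  then show ?thesis by (simp only: poly_mapping_sum_single)
qed


subsection \<open>The abelianization map\<close>

lemma exponents_0 [simp]: "exponents 0 = 0"
  by (simp add: exponents_def zero_words_def)

lemma exponents_add [simp]: "exponents (v + w) = exponents v + exponents w"
  by (simp add: exponents_def plus_words_def)

lemma surj_exponents: "\<exists>w. exponents w = e"
proof (induction e rule: poly_mapping_additive_induct)
  case (single i n)
  have "exponents (Word (replicate n i)) = Poly_Mapping.single i n"
    by (induction n) (auto simp: exponents_def single_add[symmetric])
  then show ?case ..
next
  case (add e1 e2)
  then show ?case by (metis exponents_add)
qed

lemma abelianize_add: "abelianize (f + g) = abelianize f + abelianize g"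
  unfolding abelianize_def by (rule setsum_keys_plus_distrib) (simp_all add: single_add)

lemma abelianize_0 [simp]: "abelianize 0 = 0"
  by (simp add: abelianize_def)

lemma abelianize_diff: "abelianize (f - g) = abelianize f - abelianize g"
  using abelianize_add[of "f - g" g] by simp

lemma abelianize_single [simp]:
  "abelianize (Poly_Mapping.single w c) = Poly_Mapping.single (exponents w) c"
  by (cases "c = 0") (simp_all add: abelianize_def)

lemma abelianize_mult: "abelianize (f * g) = abelianize f * abelianize g"
  by (rule additive_mult) (simp_all add: abelianize_add mult_single)

lemma abelianize_1 [simp]: "abelianize 1 = 1"
  by (metis abelianize_single exponents_0 single_one)

lemma single_scale: "Poly_Mapping.single k (c * a) = alg_scale c (Poly_Mapping.single k a)"
  by (rule poly_mapping_eqI) (simp add: lookup_scale lookup_single when_def)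

lemma abelianize_scale: "abelianize (alg_scale c f) = alg_scale c (abelianize f)"
proof -
  have "abelianize (alg_scale c f) = abelianize (alg_scale c
      (\<Sum>w\<in>Poly_Mapping.keys f. Poly_Mapping.single w (Poly_Mapping.lookup f w)))"
    by (simp only: poly_mapping_sum_single)
  also have "\<dots> = (\<Sum>w\<in>Poly_Mapping.keys f.
      alg_scale c (Poly_Mapping.single (exponents w) (Poly_Mapping.lookup f w)))"
    by (simp add: scale_sum additive_sum[of abelianize, OF abelianize_add] single_scale[symmetric])
  also have "\<dots> = alg_scale c (abelianize f)"
    by (simp add: abelianize_def scale_sum)
  finally show ?thesis .
qed

lemma algebra_homI:
  assumes "vector_space s1" "vector_space s2"
    "\<And>f g. \<phi> (f + g) = \<phi> f + \<phi> g" "\<And>c f. \<phi> (s1 c f) = s2 c (\<phi> f)"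
    "\<phi> 1 = 1" "\<And>f g. \<phi> (f * g) = \<phi> f * \<phi> g"
  shows "algebra_hom s1 s2 \<phi>"
  using assms
  by (auto simp: algebra_hom_def Vector_Spaces.linear_def module_hom_def module_hom_axioms_def
      module_iff_vector_space)

lemma algebra_homD:
  assumes "algebra_hom s1 s2 \<phi>"
  shows "\<phi> (f + g) = \<phi> f + \<phi> g" "\<phi> (s1 c f) = s2 c (\<phi> f)" "\<phi> 1 = 1" "\<phi> (f * g) = \<phi> f * \<phi> g"
    "\<phi> 0 = 0" "\<phi> (f - g) = \<phi> f - \<phi> g"
proof -
  interpret Vector_Spaces.linear s1 s2 \<phi> using assms by (simp add: algebra_hom_def)
  show "\<phi> (f + g) = \<phi> f + \<phi> g" "\<phi> (s1 c f) = s2 c (\<phi> f)" "\<phi> 0 = 0" "\<phi> (f - g) = \<phi> f - \<phi> g"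
    by (simp_all add: add scale diff)
qed (use assms in \<open>simp_all add: algebra_hom_def\<close>)

lemma abelianize_hom: "algebra_hom alg_scale alg_scale abelianize"
  by (rule algebra_homI)
    (simp_all add: vector_space_scale abelianize_add abelianize_scale abelianize_mult)

lemma abelianize_free_gen: "abelianize (free_gen i) = poly_gen i"
  by (simp add: free_gen_def poly_gen_def exponents_def)

lemma surj_abelianize: "surj abelianize"
proof -
  have "\<exists>f. abelianize f = p" for p :: "('n, 'k::field) polynomial_algebra"
  proof (induction p rule: poly_mapping_additive_induct)
    case (single e c)
    obtain w where "exponents w = e" using surj_exponents by blast
    then have "abelianize (Poly_Mapping.single w c) = Poly_Mapping.single e c" by simp
    then show ?case ..
  next
    case (add p q)
    then show ?case by (metis abelianize_add)
  qed
  then show ?thesis by (metis surjI)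
qed

lemma two_sided_ideal_commutator_ideal: "two_sided_ideal commutator_ideal"
  by (auto simp: two_sided_ideal_def commutator_ideal_def)

lemma commutator_in_commutator_ideal: "f * g - g * f \<in> commutator_ideal"
  by (auto simp: commutator_ideal_def)

lemma commutator_ideal_subset:
  "two_sided_ideal J \<Longrightarrow> (\<And>f g. f * g - g * f \<in> J) \<Longrightarrow> commutator_ideal \<subseteq> J"
  by (auto simp: commutator_ideal_def)

lemma zero_in_commutator_ideal [simp]: "0 \<in> commutator_ideal"
  using two_sided_ideal_commutator_ideal unfolding two_sided_ideal_def by blast

lemma commutator_ideal_closed:
  assumes "a \<in> commutator_ideal"
  shows "b \<in> commutator_ideal \<Longrightarrow> a + b \<in> commutator_ideal"
    "r * a \<in> commutator_ideal" "a * r \<in> commutator_ideal"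
  using assms two_sided_ideal_commutator_ideal unfolding two_sided_ideal_def by blast+

lemma commutator_ideal_sum:
  "(\<And>a. a \<in> A \<Longrightarrow> f a \<in> commutator_ideal) \<Longrightarrow> sum f A \<in> commutator_ideal"
  using two_sided_ideal_commutator_ideal
  by (induction A rule: infinite_finite_induct) (auto simp: two_sided_ideal_def)

lemma kernel_two_sided_ideal:
  fixes P :: "'a::ring_1 \<Rightarrow> 'b::ring_1"
  assumes "P 0 = 0" "\<And>f g. P (f + g) = P f + P g" "\<And>f g. P (f * g) = P f * P g"
  shows "two_sided_ideal {f. P f = 0}"
  using assms by (auto simp: two_sided_ideal_def)

lemma lookup_exponents: "Poly_Mapping.lookup (exponents w) i = count_list (letters w) i"
proof -
  have "Poly_Mapping.lookup (\<Sum>i\<leftarrow>l. Poly_Mapping.single i (1::nat)) i = count_list l i" for l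
    by (induction l) (auto simp: lookup_add lookup_single when_def)
  then show ?thesis by (simp add: exponents_def)
qed

lemma exponents_eq_congruent:
  fixes c :: "'k::field"
  assumes "exponents v = exponents w"
  shows "Poly_Mapping.single v c - Poly_Mapping.single w c \<in> commutator_ideal"
proof -
  have "Poly_Mapping.single (Word us) c - Poly_Mapping.single (Word vs) c \<in> commutator_ideal"
    if "exponents (Word us) = exponents (Word vs)" for us vs :: "'a list"
    using that
  proof (induction us arbitrary: vs)
    case Nil
    have "count_list vs i = 0" for i
      using lookup_exponents[of "Word vs" i] lookup_exponents[of "Word []" i] Nil by simp
    then have "vs = []" by (metis count_list_0_iff list.set_intros(1) neq_Nil_conv)
    then show ?case by simp
  next
    case (Cons a us)
    have "count_list vs a = count_list (a # us) a"
      using lookup_exponents[of "Word vs" a] lookup_exponents[of "Word (a # us)" a] Cons.prems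
      by simp
    then have "a \<in> set vs" by (metis count_list_0_iff list.set_intros(1))
    then obtain p q where vs: "vs = p @ a # q" by (meson split_list)
    have "exponents (Word us) = exponents (Word (p @ q))"
      using Cons.prems by (simp add: vs exponents_def ac_simps)
    from Cons.IH[OF this]
    have "Poly_Mapping.single (Word [a]) 1 *
        (Poly_Mapping.single (Word us) c - Poly_Mapping.single (Word (p @ q)) c) \<in> commutator_ideal"
      by (rule commutator_ideal_closed(2))
    then have 1: "Poly_Mapping.single (Word (a # us)) c - Poly_Mapping.single (Word (a # p @ q)) c
        \<in> commutator_ideal"
      by (simp add: right_diff_distrib mult_single plus_words_def)
    have "(Poly_Mapping.single (Word [a]) 1 * Poly_Mapping.single (Word p) 1 -
        Poly_Mapping.single (Word p) 1 * Poly_Mapping.single (Word [a]) 1) *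
        Poly_Mapping.single (Word q) c \<in> commutator_ideal"
      by (intro commutator_ideal_closed(3) commutator_in_commutator_ideal)
    then have 2: "Poly_Mapping.single (Word (a # p @ q)) c - Poly_Mapping.single (Word vs) c
        \<in> commutator_ideal"
      by (simp add: left_diff_distrib mult_single plus_words_def vs)
    show ?case using commutator_ideal_closed(1)[OF 1 2] by simp
  qed
  from this[of "letters v" "letters w"] assms show ?thesis by simp
qed

lemma abelianize_eq_0_iff: "abelianize f = 0 \<longleftrightarrow> f \<in> commutator_ideal"
proof
  assume "f \<in> commutator_ideal"
  moreover have "commutator_ideal \<subseteq> {f. abelianize f = 0}"
    by (intro commutator_ideal_subset kernel_two_sided_ideal)
      (simp_all add: abelianize_add abelianize_diff abelianize_mult mult.commute)
  ultimately show "abelianize f = 0" by auto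
next
  assume f: "abelianize f = 0"
  define s where "s = inv (exponents :: 'a words \<Rightarrow> _)"
  have s: "exponents (s e) = e" for e
    unfolding s_def using surj_exponents by (metis surjI surj_f_inv_f)
  define S :: "('a, 'b) polynomial_algebra \<Rightarrow> ('a, 'b) free_algebra" where
    "S p = (\<Sum>e\<in>Poly_Mapping.keys p. Poly_Mapping.single (s e) (Poly_Mapping.lookup p e))" for p
  have S_add: "S (p + q) = S p + S q" for p q
    unfolding S_def by (rule setsum_keys_plus_distrib) (simp_all add: single_add)
  have S_single: "S (Poly_Mapping.single e c) = Poly_Mapping.single (s e) c" for e c
    by (cases "c = 0") (simp_all add: S_def)
  have "S (abelianize f) = (\<Sum>w\<in>Poly_Mapping.keys f.
      Poly_Mapping.single (s (exponents w)) (Poly_Mapping.lookup f w))"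
    by (simp add: abelianize_def additive_sum[of S, OF S_add] S_single)
  then have "f = f - (\<Sum>w\<in>Poly_Mapping.keys f.
      Poly_Mapping.single (s (exponents w)) (Poly_Mapping.lookup f w))"
    using f by (simp add: S_def)
  also have "\<dots> = (\<Sum>w\<in>Poly_Mapping.keys f. Poly_Mapping.single w (Poly_Mapping.lookup f w)) -
     (\<Sum>w\<in>Poly_Mapping.keys f.
      Poly_Mapping.single (s (exponents w)) (Poly_Mapping.lookup f w))"
    by (simp only: poly_mapping_sum_single)
  also have "\<dots> = (\<Sum>w\<in>Poly_Mapping.keys f. Poly_Mapping.single w (Poly_Mapping.lookup f w) -
      Poly_Mapping.single (s (exponents w)) (Poly_Mapping.lookup f w))"
    by (simp only: sum_subtractf)
  also have "\<dots> \<in> commutator_ideal"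
    by (intro commutator_ideal_sum exponents_eq_congruent) (simp add: s)
  finally show "f \<in> commutator_ideal" .
qed


subsection \<open>The induced action\<close>

lemma map_abelianize_add:
  "Poly_Mapping.map abelianize (f + g) = Poly_Mapping.map abelianize f + Poly_Mapping.map abelianize g"
  by (rule poly_mapping_eqI) (simp add: lookup_map_0 lookup_add abelianize_add)

lemma map_abelianize_single:
  "Poly_Mapping.map abelianize (Poly_Mapping.single \<alpha> f) = Poly_Mapping.single \<alpha> (abelianize f)"
  by (rule poly_mapping_eqI) (simp add: lookup_map_0 lookup_single when_def)

lemma map_abelianize_hom:
  "algebra_hom laurent_scale laurent_scale
     (Poly_Mapping.map abelianize :: ('r::finite, ('n, 'k::field) free_algebra) laurent \<Rightarrow> _)"
proof (rule algebra_homI)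
  show "Poly_Mapping.map abelianize (1 :: ('r, ('n, 'k) free_algebra) laurent) = 1"
    by (metis map_abelianize_single abelianize_1 single_one)
  show "Poly_Mapping.map abelianize (f * g) = Poly_Mapping.map abelianize f * Poly_Mapping.map abelianize g"
    for f g :: "('r, ('n, 'k) free_algebra) laurent"
    by (rule additive_mult)
      (simp_all add: map_abelianize_add mult_single map_abelianize_single abelianize_mult)
  show "Poly_Mapping.map abelianize (laurent_scale c f) = laurent_scale c (Poly_Mapping.map abelianize f)"
    for c and f :: "('r, ('n, 'k) free_algebra) laurent"
    by (rule poly_mapping_eqI) (simp add: lookup_map_0 lookup_laurent_scale abelianize_scale)
qed (simp_all add: vector_space_laurent_scale map_abelianize_add)

lemma abelianization_abelianize:
  assumes \<sigma>: "algebra_hom alg_scale laurent_scale \<sigma>"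
  shows "abelianization \<sigma> (abelianize f) = Poly_Mapping.map abelianize (\<sigma> f)"
proof -
  let ?P = "\<lambda>f. Poly_Mapping.map abelianize (\<sigma> f)"
  note [simp] = algebra_homD[OF \<sigma>] algebra_homD[OF map_abelianize_hom]
  have "commutator_ideal \<subseteq> {f. ?P f = 0}"
    by (intro commutator_ideal_subset kernel_two_sided_ideal) (simp_all add: mult.commute)
  moreover have "inv abelianize (abelianize f) - f \<in> commutator_ideal"
    unfolding abelianize_eq_0_iff[symmetric] abelianize_diff
    by (simp add: surj_f_inv_f[OF surj_abelianize])
  ultimately have "?P (inv abelianize (abelianize f) - f) = 0" by blast
  then show ?thesis by (simp add: abelianization_def)
qed

lemma evaluate_at_map_abelianize:
  "evaluate_at t (Poly_Mapping.map abelianize g) = abelianize (evaluate_at t g)"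
proof -
  have "evaluate_at t (Poly_Mapping.map abelianize g) = (\<Sum>\<alpha>\<in>Poly_Mapping.keys g.
      alg_scale (character \<alpha> t) (Poly_Mapping.lookup (Poly_Mapping.map abelianize g) \<alpha>))"
    unfolding evaluate_at_def
    by (rule sum.mono_neutral_left) (auto simp: in_keys_iff lookup_map_0)
  then show ?thesis
    by (simp add: evaluate_at_def additive_sum[of abelianize, OF abelianize_add]
        abelianize_scale lookup_map_0)
qed

lemma specialization_abelianization:
  assumes "algebra_hom alg_scale laurent_scale \<sigma>"
  shows "specialization (abelianization \<sigma>) t (abelianize f) = abelianize (specialization \<sigma> t f)"
  by (simp add: specialization_def abelianization_abelianize[OF assms] evaluate_at_map_abelianize)

lemma regular_action_abelianization:
  fixes \<sigma> :: "('r::finite, 'n words, 'k::field) coaction"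
  assumes "regular_action \<sigma>"
  shows "regular_action (abelianization \<sigma>)"
proof -
  have \<sigma>: "algebra_hom alg_scale laurent_scale \<sigma>" using assms by (simp add: regular_action_def)
  note [simp] = algebra_homD[OF \<sigma>] algebra_homD[OF map_abelianize_hom]
    abelianization_abelianize[OF \<sigma>] specialization_abelianization[OF \<sigma>]
  have ex: "\<exists>f. p = abelianize f" for p :: "('n, 'k) polynomial_algebra"
    using surj_abelianize by (metis surjD)
  have "algebra_hom alg_scale laurent_scale (abelianization \<sigma>)"
  proof (rule algebra_homI)
    fix p q :: "('n, 'k) polynomial_algebra" and c
    obtain f g where [simp]: "p = abelianize f" "q = abelianize g" using ex by metis
    show "abelianization \<sigma> (p + q) = abelianization \<sigma> p + abelianization \<sigma> q"
      using abelianization_abelianize[OF \<sigma>, of "f + g"] by (simp add: abelianize_add)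
    show "abelianization \<sigma> (p * q) = abelianization \<sigma> p * abelianization \<sigma> q"
      using abelianization_abelianize[OF \<sigma>, of "f * g"] by (simp add: abelianize_mult)
    show "abelianization \<sigma> (alg_scale c p) = laurent_scale c (abelianization \<sigma> p)"
      using abelianization_abelianize[OF \<sigma>, of "alg_scale c f"] by (simp add: abelianize_scale)
    show "abelianization \<sigma> 1 = 1"
      using abelianization_abelianize[OF \<sigma>, of 1] by simp
  qed (rule vector_space_scale vector_space_laurent_scale)+
  moreover have "specialization (abelianization \<sigma>) 1 = id"
  proof
    fix p :: "('n, 'k) polynomial_algebra"
    obtain f where "p = abelianize f" using ex by metis
    then show "specialization (abelianization \<sigma>) 1 p = id p"
      using assms by (simp add: regular_action_def)
  qed
  moreover have "specialization (abelianization \<sigma>) s \<circ> specialization (abelianization \<sigma>) t =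
      specialization (abelianization \<sigma>) (s * t)" if st: "s \<in> torus" "t \<in> torus" for s t :: "'k ^ 'r"
  proof
    fix p :: "('n, 'k) polynomial_algebra"
    obtain f where "p = abelianize f" using ex by metis
    moreover have "specialization \<sigma> s (specialization \<sigma> t f) = specialization \<sigma> (s * t) f"
      using assms st unfolding regular_action_def by (metis comp_apply)
    ultimately show "(specialization (abelianization \<sigma>) s \<circ> specialization (abelianization \<sigma>) t) p =
      specialization (abelianization \<sigma>) (s * t) p"
      by simp
  qed
  ultimately show ?thesis by (simp add: regular_action_def)
qed

end

theory Submission
  imports Defs
begin

text \<open>
  For two generators, abelianization is a bijection between the automorphisms of the free algebra and
  those of the polynomial algebra. If \<open>\<beta>\<close> linearizes the abelianized action and \<open>B\<close> lifts \<open>\<beta>\<close>,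
  then every \<open>B\<^sup>-\<^sup>1 \<circ> \<sigma>(t) \<circ> B\<close> has the same abelianization as some linear automorphism, and hence
  is linear.

  Injectivity: an automorphism that induces the identity has an invertible matrix of Fox derivatives,
  and evaluating it at a point with a central first coordinate leaves only the trivial possibility.

  Surjectivity: elementary automorphisms lift, so it is enough to reduce \<open>\<beta>\<close> by them. The coordinate
  \<open>Q = \<beta> x\<^sub>j\<close> is fixed by a nontrivial one-parameter family of endomorphisms, namely the conjugate of
  a translation. Passing to leading parts for a suitable weight, the initial form of \<open>Q\<close> along its Newton edge
  is fixed by such a family as well, which forces it to be \<open>c (x\<^sub>k - r x\<^sub>l\<^sup>n)\<^sup>d\<close>; then
  \<open>x\<^sub>k \<mapsto> x\<^sub>k + r x\<^sub>l\<^sup>n\<close> lowers the degrees of \<open>Q\<close>.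
\<close>

text \<open>The reduction of coordinates has to work in every characteristic, where a derivation
  annihilating \<open>Q\<close> says too little because it also kills p-th powers. Its place is
  taken by families x_k -> f_k(s), polynomial in s and equal to the identity at s = 0. No group law
  is imposed on them. Two facts suffice: factors of invariants are invariant, and a suitable weight
  of s makes the leading part of a nontrivial family nontrivial again. Derivatives appear only to
  exclude binomials x_k^a - r x_l^b with coprime a, b >= 2, where the characteristic divides at most
  one of the exponents. Algebraic closedness enters when the binary form on a Newton edge is split
  into linear factors.

  In the free algebra no determinant is at hand. The point (t, 0) is chosen because the words that
  do not vanish there are the powers of z_i, and these never occur in an element of the commutator
  ideal. The first coordinate is a new central variable rather than a scalar, so that the matrix of
  Fox derivatives has a degree in t that can be played off against word length.\<close>

abbreviation lookup where "lookup \<equiv> Poly_Mapping.lookup"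
abbreviation keys where "keys \<equiv> Poly_Mapping.keys"
abbreviation single where "single \<equiv> Poly_Mapping.single"

lemma two_cases:
  assumes "i \<noteq> (j::2)"
  shows "k = i \<or> k = j"
proof -
  have "{i, j} = UNIV"
    using assms by (intro card_subset_eq) auto
  then show ?thesis by auto
qed

lemma UNIV_two: "i \<noteq> (j::2) \<Longrightarrow> UNIV = {i, j}"
  using two_cases by blast

section \<open>Homomorphisms\<close>

text \<open>Scalars are left out because the targets embed them in different ways
  (\<open>single 0\<close>, \<open>poly_const\<close>, constants of a Laurent ring). Agreement on
  scalars is a separate hypothesis of \<open>free_hom_eqI\<close> and
  \<open>poly_hom_eqI\<close>.\<close>

definition ring_homo :: "('a::ring_1 \<Rightarrow> 'b::ring_1) \<Rightarrow> bool" where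
  "ring_homo \<phi> \<longleftrightarrow> \<phi> 1 = 1 \<and> (\<forall>f g. \<phi> (f + g) = \<phi> f + \<phi> g) \<and> (\<forall>f g. \<phi> (f * g) = \<phi> f * \<phi> g)"

lemma ring_homoI:
  assumes "\<phi> 1 = 1" "\<And>f g. \<phi> (f + g) = \<phi> f + \<phi> g" "\<And>f g. \<phi> (f * g) = \<phi> f * \<phi> g"
  shows "ring_homo \<phi>"
  using assms by (simp add: ring_homo_def)

lemma ring_homoD:
  assumes "ring_homo \<phi>"
  shows "\<phi> (f + g) = \<phi> f + \<phi> g" "\<phi> 1 = 1" "\<phi> (f * g) = \<phi> f * \<phi> g" "\<phi> 0 = 0"
    "\<phi> (f - g) = \<phi> f - \<phi> g" "\<phi> (- f) = - \<phi> f" "\<phi> (f ^ n) = \<phi> f ^ n" "\<phi> (sum h A) = (\<Sum>a\<in>A. \<phi> (h a))"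
proof -
  interpret additive \<phi> using assms by unfold_locales (simp add: ring_homo_def)
  show "\<phi> (f + g) = \<phi> f + \<phi> g" "\<phi> 1 = 1" and m: "\<phi> (f * g) = \<phi> f * \<phi> g" for f g
    using assms by (simp_all add: ring_homo_def)
  show "\<phi> 0 = 0" "\<phi> (f - g) = \<phi> f - \<phi> g" "\<phi> (- f) = - \<phi> f" "\<phi> (sum h A) = (\<Sum>a\<in>A. \<phi> (h a))"
    by (rule zero diff minus sum)+
  show "\<phi> (f ^ n) = \<phi> f ^ n"
    by (induction n) (use assms in \<open>simp_all add: ring_homo_def\<close>)
qed

lemma ring_homo_comp: "ring_homo \<phi> \<Longrightarrow> ring_homo \<psi> \<Longrightarrow> ring_homo (\<lambda>x. \<phi> (\<psi> x))"
  by (simp add: ring_homo_def)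

lemma scale_eq_mult: "alg_scale c f = single 0 c * (f :: 'm::monoid_add \<Rightarrow>\<^sub>0 'k::field)"
proof (induction f rule: poly_mapping_additive_induct)
  case (single k a)
  then show ?case by (simp add: single_scale[symmetric] mult_single)
next
  case (add p q)
  interpret vector_space alg_scale by (rule vector_space_scale)
  show ?case using add by (simp add: scale_right_distrib distrib_left)
qed

lemma const_commutes: "single 0 c * f = f * (single 0 c :: 'm::monoid_add \<Rightarrow>\<^sub>0 'k::field)"
  by (induction f rule: poly_mapping_additive_induct) (simp_all add: mult_single distrib_left distrib_right mult.commute)

lemma const_mult: "single 0 (a * b) = single 0 a * (single 0 b :: 'm::monoid_add \<Rightarrow>\<^sub>0 'k::field)"
  by (simp add: mult_single)

lemma algebra_hom_iff:
  "algebra_hom alg_scale alg_scale \<phi> \<longleftrightarrow> ring_homo \<phi> \<and> (\<forall>c. \<phi> (single 0 c) = single 0 c)"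
  (is "?L \<longleftrightarrow> ?R")
proof
  assume L: ?L
  note [simp] = algebra_homD[OF L]
  have "\<phi> (single 0 c) = single 0 c" for c
    using algebra_homD(2)[OF L, of c 1] by (simp add: scale_eq_mult)
  then show ?R by (simp add: ring_homo_def)
next
  assume R: ?R
  note [simp] = ring_homoD[OF R[THEN conjunct1]]
  show ?L using R
    by (intro algebra_homI vector_space_scale) (simp_all add: scale_eq_mult)
qed

lemmas algebra_hom_ring_homo = algebra_hom_iff[THEN iffD1, THEN conjunct1]

lemma algebra_hom_const: "algebra_hom alg_scale alg_scale \<phi> \<Longrightarrow> \<phi> (single 0 c) = single 0 c"
  by (simp add: algebra_hom_iff)

lemma algebra_hom_comp:
  "algebra_hom alg_scale alg_scale \<phi> \<Longrightarrow> algebra_hom alg_scale alg_scale \<psi> \<Longrightarrow>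
   algebra_hom alg_scale alg_scale (\<lambda>x. \<phi> (\<psi> x))"
  by (simp add: algebra_hom_iff ring_homo_comp)

lemma algebra_automorphism_inv:
  assumes "algebra_automorphism \<beta>"
  shows "algebra_automorphism (inv \<beta>)"
proof -
  have \<beta>: "algebra_hom alg_scale alg_scale \<beta>" "bij \<beta>" using assms by (simp_all add: algebra_automorphism_def)
  note [simp] = algebra_homD[OF \<beta>(1)] bij_is_surj[OF \<beta>(2), THEN surj_f_inv_f]
  have eqI: "x = y" if "\<beta> x = \<beta> y" for x y using \<beta>(2) that by (meson bij_is_inj inj_eq)
  have "algebra_hom alg_scale alg_scale (inv \<beta>)"
    by (intro algebra_homI vector_space_scale; rule eqI) simp_all
  then show ?thesis using \<beta>(2) by (simp add: algebra_automorphism_def bij_imp_bij_inv)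
qed

lemma algebra_automorphism_comp:
  "algebra_automorphism \<phi> \<Longrightarrow> algebra_automorphism \<psi> \<Longrightarrow> algebra_automorphism (\<lambda>x. \<phi> (\<psi> x))"
  using bij_comp[of \<psi> \<phi>] by (simp add: algebra_automorphism_def algebra_hom_comp o_def)

lemma algebra_automorphismD:
  assumes "algebra_automorphism \<beta>"
  shows "algebra_hom alg_scale alg_scale \<beta>" "\<beta> (inv \<beta> x) = x" "inv \<beta> (\<beta> x) = x"
  using assms by (simp_all add: algebra_automorphism_def bij_is_surj surj_f_inv_f bij_is_inj)

subsection \<open>The free algebra\<close>

lemma free_gen_mult_Word: "single (Word (i # l)) 1 = free_gen i * (single (Word l) 1 :: ('n,'k::field) free_algebra)"
  by (simp add: free_gen_def mult_single plus_words_def)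

lemma single_Word_snoc: "single (Word (l @ [i])) 1 = (single (Word l) 1 :: ('n,'k::field) free_algebra) * free_gen i"
  by (simp add: free_gen_def mult_single plus_words_def)

lemma single_eq_const_mult: "single k c = single 0 c * (single k 1 :: 'm::monoid_add \<Rightarrow>\<^sub>0 'k::field)"
  by (simp add: mult_single)

lemma single_Nil: "single (Word []) 1 = (1 :: ('n,'k::field) free_algebra)"
  by (simp flip: single_one zero_words_def)

lemma free_hom_eqI:
  fixes \<phi> \<psi> :: "('n, 'k::field) free_algebra \<Rightarrow> 'r::ring_1"
  assumes "ring_homo \<phi>" "ring_homo \<psi>" "\<And>c. \<phi> (single 0 c) = \<psi> (single 0 c)"
    "\<And>i. \<phi> (free_gen i) = \<psi> (free_gen i)"
  shows "\<phi> f = \<psi> f"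
proof (induction f rule: poly_mapping_additive_induct)
  case (single w c)
  have "\<phi> (single (Word l) 1) = \<psi> (single (Word l) 1)" for l
    by (induction l)
      (simp_all add: single_Nil free_gen_mult_Word assms(4) ring_homoD[OF assms(1)] ring_homoD[OF assms(2)])
  from this[of "letters w"] show ?case
    using assms(3)[of c]
    by (subst (1 2) single_eq_const_mult) (simp add: ring_homoD[OF assms(1)] ring_homoD[OF assms(2)])
qed (simp add: ring_homoD[OF assms(1)] ring_homoD[OF assms(2)])

definition free_subst :: "('n \<Rightarrow> ('m::monoid_add \<Rightarrow>\<^sub>0 'k::field)) \<Rightarrow> ('n, 'k) free_algebra \<Rightarrow> ('m \<Rightarrow>\<^sub>0 'k)" where
  "free_subst p f = (\<Sum>w\<in>keys f. alg_scale (lookup f w) (prod_list (map p (letters w))))"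

lemma free_subst_add: "free_subst p (f + g) = free_subst p f + free_subst p g"
  unfolding free_subst_def
  by (rule setsum_keys_plus_distrib) (simp_all add: scale_eq_mult single_add distrib_right)

lemma free_subst_single: "free_subst p (single w c) = single 0 c * prod_list (map p (letters w))"
  by (cases "c = 0") (simp_all add: free_subst_def scale_eq_mult)

lemma free_subst_const [simp]: "free_subst p (single 0 c) = single 0 c"
  by (simp add: free_subst_single zero_words_def)

lemma ring_homo_free_subst:
  fixes p :: "'n \<Rightarrow> ('m::monoid_add \<Rightarrow>\<^sub>0 'k::field)"
  shows "ring_homo (free_subst p)"
proof (rule ring_homoI)
  show "free_subst p 1 = 1" by (metis free_subst_const single_one)
  show "free_subst p (f * g) = free_subst p f * free_subst p g" for f g
  proof (rule additive_mult, rule free_subst_add)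
    fix v w :: "'n words" and a b :: 'k
    let ?q = "\<lambda>w. prod_list (map p (letters w))"
    have "free_subst p (single v a * single w b) = single 0 a * (single 0 b * ?q v) * ?q w"
      by (simp only: mult_single free_subst_single plus_words_def words.sel map_append prod_list.append)
        (simp only: const_mult mult.assoc)
    also have "single 0 b * ?q v = ?q v * single 0 b" by (rule const_commutes)
    finally show "free_subst p (single v a * single w b) = free_subst p (single v a) * free_subst p (single w b)"
      by (simp add: free_subst_single mult.assoc)
  qed
qed (rule free_subst_add)

lemma algebra_hom_free_subst: "algebra_hom alg_scale alg_scale (free_subst p)"
  by (simp add: algebra_hom_iff ring_homo_free_subst)

lemma free_subst_gen [simp]: "free_subst p (free_gen i) = p i"
  by (simp add: free_gen_def free_subst_single)

lemma free_automorphismI: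
  assumes "\<And>i. free_subst p (q i) = free_gen i" "\<And>i. free_subst q (p i) = free_gen i"
  shows "algebra_automorphism (free_subst p)"
proof -
  have "free_subst p (free_subst q f) = f" "free_subst q (free_subst p f) = f" for f
    by (rule free_hom_eqI[of "\<lambda>f. free_subst _ (free_subst _ f)" "\<lambda>f. f"];
        simp add: assms ring_homo_comp ring_homo_free_subst ring_homo_def[of "\<lambda>x. x"])+
  then have "bij (free_subst p)" by (intro o_bij[of "free_subst q"]) auto
  then show ?thesis by (simp add: algebra_automorphism_def algebra_hom_free_subst)
qed

subsection \<open>The polynomial algebra\<close>

lemma single_single: "single (single i n) 1 = (poly_gen i :: ('n, 'k::field) polynomial_algebra) ^ n"
proof (induction n)
  case (Suc n)
  have "single (single i (Suc n)) 1 = poly_gen i * single (single i n) (1::'k)"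
    by (simp add: poly_gen_def mult_single flip: single_add)
  then show ?case using Suc by simp
qed simp

lemma poly_hom_eqI:
  fixes \<phi> \<psi> :: "('n, 'k::field) polynomial_algebra \<Rightarrow> 'r::ring_1"
  assumes "ring_homo \<phi>" "ring_homo \<psi>" "\<And>c. \<phi> (single 0 c) = \<psi> (single 0 c)"
    "\<And>i. \<phi> (poly_gen i) = \<psi> (poly_gen i)"
  shows "\<phi> f = \<psi> f"
proof (induction f rule: poly_mapping_additive_induct)
  case (single m c)
  have "\<phi> (single m 1) = \<psi> (single m 1)"
  proof (induction m rule: poly_mapping_additive_induct)
    case (single k c)
    then show ?case
      by (simp add: single_single assms(4) ring_homoD[OF assms(1)] ring_homoD[OF assms(2)])
  next
    case (add p q)
    have "single (p + q) 1 = single p 1 * (single q 1 :: ('n, 'k) polynomial_algebra)"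
      by (simp add: mult_single)
    then show ?case using add by (simp add: ring_homoD[OF assms(1)] ring_homoD[OF assms(2)])
  qed
  then show ?case
    using assms(3)[of c]
    by (subst (1 2) single_eq_const_mult) (simp add: ring_homoD[OF assms(1)] ring_homoD[OF assms(2)])
qed (simp add: ring_homoD[OF assms(1)] ring_homoD[OF assms(2)])

text \<open>The coefficient map is a parameter: with \<open>single 0\<close> this is substitution
  into a polynomial algebra (\<open>psubst\<close>), with \<open>poly_const\<close> the substituted
  elements depend polynomially on a further variable s.\<close>

definition poly_subst ::
    "('k::field \<Rightarrow> 'r::comm_ring_1) \<Rightarrow> ('n::finite \<Rightarrow> 'r) \<Rightarrow> ('n, 'k) polynomial_algebra \<Rightarrow> 'r" where
  "poly_subst c p z = (\<Sum>m\<in>keys z. c (lookup z m) * (\<Prod>i\<in>UNIV. p i ^ lookup m i))"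

lemma ring_homo_const: "ring_homo (single 0 :: 'k::field \<Rightarrow> ('m::monoid_add \<Rightarrow>\<^sub>0 'k))"
  by (simp add: ring_homo_def single_add mult_single)

context
  fixes c :: "'k::field \<Rightarrow> 'r::comm_ring_1"
  assumes c: "ring_homo c"
begin

lemma poly_subst_add: "poly_subst c p (f + g) = poly_subst c p f + poly_subst c p g"
  unfolding poly_subst_def
  by (rule setsum_keys_plus_distrib) (simp_all add: ring_homoD[OF c] distrib_right)

lemma poly_subst_single: "poly_subst c p (single m a) = c a * (\<Prod>i\<in>UNIV. p i ^ lookup m i)"
  by (cases "a = 0") (simp_all add: poly_subst_def ring_homoD[OF c])

lemma poly_subst_const: "poly_subst c p (single 0 a) = c a"
  by (simp add: poly_subst_single)

lemma ring_homo_poly_subst: "ring_homo (poly_subst c p)"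
proof (rule ring_homoI)
  show "poly_subst c p 1 = 1" by (metis poly_subst_const single_one ring_homoD(2)[OF c])
  show "poly_subst c p (f * g) = poly_subst c p f * poly_subst c p g" for f g
    by (rule additive_mult, rule poly_subst_add)
      (simp add: mult_single poly_subst_single lookup_add power_add prod.distrib ring_homoD[OF c] ac_simps)
qed (rule poly_subst_add)

lemma poly_subst_gen: "poly_subst c p (poly_gen i) = p i"
proof -
  have "(\<Prod>k\<in>UNIV. p k ^ lookup (single i (1::nat)) k) = (\<Prod>k\<in>UNIV. if k = i then p k else 1)"
    by (rule prod.cong) (auto simp: lookup_single when_def)
  then show ?thesis by (simp add: poly_gen_def poly_subst_single ring_homoD[OF c] prod.delta)
qed

lemma poly_subst_hom:
  assumes h: "algebra_hom alg_scale alg_scale h"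
  shows "poly_subst c p (h z) = poly_subst c (\<lambda>i. poly_subst c p (h (poly_gen i))) z"
  by (rule poly_hom_eqI)
    (simp_all add: ring_homo_comp algebra_hom_ring_homo[OF h] ring_homo_poly_subst poly_subst_const
      poly_subst_gen algebra_hom_const[OF h])

end

abbreviation psubst :: "('n::finite \<Rightarrow> ('m::comm_monoid_add \<Rightarrow>\<^sub>0 'k::field)) \<Rightarrow> ('n, 'k) polynomial_algebra \<Rightarrow> ('m \<Rightarrow>\<^sub>0 'k)" where
  "psubst \<equiv> poly_subst (single 0)"

lemma algebra_hom_psubst: "algebra_hom alg_scale alg_scale (psubst p)"
  by (simp add: algebra_hom_iff ring_homo_const ring_homo_poly_subst poly_subst_const)

lemmas psubst_gen = poly_subst_gen[OF ring_homo_const]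

lemma psubst_poly_gen [simp]: "psubst poly_gen z = z"
  by (rule poly_hom_eqI[of _ "\<lambda>z. z"])
    (simp_all add: ring_homo_const ring_homo_poly_subst poly_subst_const poly_subst_gen ring_homo_def[of "\<lambda>x. x"])

lemma algebra_hom_eq_psubst:
  assumes h: "algebra_hom alg_scale alg_scale h"
  shows "h z = psubst (\<lambda>i. h (poly_gen i)) z"
  by (rule poly_hom_eqI)
    (simp_all add: ring_homo_const ring_homo_poly_subst poly_subst_const poly_subst_gen
      algebra_hom_ring_homo[OF h] algebra_hom_const[OF h])

lemma poly_automorphismI:
  assumes "\<And>i. psubst p (q i) = poly_gen i" "\<And>i. psubst q (p i) = poly_gen i"
  shows "algebra_automorphism (psubst p)"
proof -
  have "psubst p (psubst q f) = f" "psubst q (psubst p f) = f" for f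
    by (rule poly_hom_eqI[of "\<lambda>f. psubst _ (psubst _ f)" "\<lambda>f. f"];
        simp add: assms ring_homo_comp ring_homo_const ring_homo_poly_subst poly_subst_const
          poly_subst_gen ring_homo_def[of "\<lambda>x. x"])+
  then have "bij (psubst p)" by (intro o_bij[of "psubst q"]) auto
  then show ?thesis by (simp add: algebra_automorphism_def algebra_hom_psubst)
qed

section \<open>Injectivity of abelianization on automorphisms\<close>

subsection \<open>Degree in the free algebra\<close>

definition fdeg :: "('n, 'k::field) free_algebra \<Rightarrow> nat" where
  "fdeg f = Max (insert 0 ((\<lambda>w. length (letters w)) ` keys f))"

lemma length_le_fdeg: "w \<in> keys f \<Longrightarrow> length (letters w) \<le> fdeg f"
  by (simp add: fdeg_def)

lemma fdeg_attained: "f \<noteq> 0 \<Longrightarrow> \<exists>w\<in>keys f. length (letters w) = fdeg f"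
proof -
  assume "f \<noteq> 0"
  then obtain v where v: "v \<in> keys f" using keys_eq_empty by blast
  have "fdeg f \<in> insert 0 ((\<lambda>w. length (letters w)) ` keys f)"
    unfolding fdeg_def by (rule Max_in) auto
  moreover have "fdeg f = 0 \<Longrightarrow> length (letters v) = fdeg f" using length_le_fdeg[OF v] by simp
  ultimately show ?thesis using v by auto
qed

lemma fdeg_leI: "(\<And>w. w \<in> keys f \<Longrightarrow> length (letters w) \<le> n) \<Longrightarrow> fdeg f \<le> n"
  by (simp add: fdeg_def)

text \<open>A word of length p + q splits in only one way into a prefix of length p and a suffix of
  length q. Hence longest words multiply without cancellation, which gives the absence of zero
  divisors and additivity of the degree.\<close>

lemma lookup_mult_longest:
  fixes f g :: "('n, 'k::field) free_algebra"
  assumes f: "\<And>u. u \<in> keys f \<Longrightarrow> length (letters u) \<le> length (letters v)"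
    and g: "\<And>u. u \<in> keys g \<Longrightarrow> length (letters u) \<le> length (letters w)"
  shows "lookup (f * g) (v + w) = lookup f v * lookup g w"
proof -
  have eq: "lookup (single (u + u') (lookup f u * lookup g u')) (v + w) =
      (if u' = w then if u = v then lookup f v * lookup g w else 0 else 0)"
    if "u \<in> keys f" "u' \<in> keys g" for u u'
  proof -
    have "u = v \<and> u' = w" if eq: "u + u' = v + w"
    proof -
      have *: "letters u @ letters u' = letters v @ letters w" using eq by (simp add: plus_words_def)
      then have "length (letters u) + length (letters u') = length (letters v) + length (letters w)"
        by (metis length_append)
      then have "length (letters u) = length (letters v)"
        using f[OF \<open>u \<in> keys f\<close>] g[OF \<open>u' \<in> keys g\<close>] by linarith
      then show ?thesis using * by (simp add: words.expand)
    qed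
    then show ?thesis by (auto simp: lookup_single when_def)
  qed
  have "f * g = (\<Sum>u\<in>keys f. \<Sum>u'\<in>keys g. single (u + u') (lookup f u * lookup g u'))"
    by (subst (1 2) poly_mapping_sum_single[symmetric]) (simp add: sum_product mult_single)
  then have "lookup (f * g) (v + w) =
      (\<Sum>u\<in>keys f. \<Sum>u'\<in>keys g. if u' = w then if u = v then lookup f v * lookup g w else 0 else 0)"
    by (simp add: lookup_sum eq)
  also have "\<dots> = lookup f v * lookup g w"
    by (cases "lookup g w = 0") (auto simp: sum.delta in_keys_iff)
  finally show ?thesis .
qed

lemma
  fixes f g :: "('n, 'k::field) free_algebra"
  assumes "f \<noteq> 0" "g \<noteq> 0"
  shows free_mult_nonzero: "f * g \<noteq> 0" and fdeg_mult: "fdeg (f * g) = fdeg f + fdeg g"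
proof -
  obtain v w where v: "v \<in> keys f" "length (letters v) = fdeg f"
    and w: "w \<in> keys g" "length (letters w) = fdeg g"
    using fdeg_attained assms by metis
  have "lookup (f * g) (v + w) = lookup f v * lookup g w"
    by (rule lookup_mult_longest) (simp_all add: v w length_le_fdeg)
  then have *: "v + w \<in> keys (f * g)" using v w by (simp add: in_keys_iff)
  then show "f * g \<noteq> 0" by auto
  have "fdeg (f * g) \<le> fdeg f + fdeg g"
  proof (rule fdeg_leI)
    fix u assume "u \<in> keys (f * g)"
    then obtain a b where "a \<in> keys f" "b \<in> keys g" "u = a + b" using keys_mult by blast
    then show "length (letters u) \<le> fdeg f + fdeg g"
      using length_le_fdeg[of a f] length_le_fdeg[of b g] by (simp add: plus_words_def)
  qed
  moreover have "fdeg f + fdeg g \<le> fdeg (f * g)"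
    using length_le_fdeg[OF *] v w by (simp add: plus_words_def)
  ultimately show "fdeg (f * g) = fdeg f + fdeg g" by simp
qed

lemma free_mult_eq_0_iff: "f * g = (0 :: ('n, 'k::field) free_algebra) \<longleftrightarrow> f = 0 \<or> g = 0"
  using free_mult_nonzero by force

lemma lookup_mult_free_gen:
  "lookup (r * free_gen i) (Word (l @ [k])) = (if k = i then lookup r (Word l) else 0)"
  for r :: "('n, 'k::field) free_algebra"
proof (induction r rule: poly_mapping_additive_induct)
  case (single w c)
  then show ?case by (cases w) (auto simp: free_gen_def mult_single plus_words_def lookup_single when_def)
qed (simp add: distrib_right lookup_add)

text \<open>The words of the two summands end in different letters, so nothing cancels: the
  generators are left linearly independent.\<close>

lemma left_combination_eq_0:
  fixes r s :: "('n, 'k::field) free_algebra"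
  assumes "i \<noteq> j" "r * free_gen i + s * free_gen j = 0"
  shows "r = 0" "s = 0"
proof -
  have "lookup (r * free_gen i + s * free_gen j) (Word (l @ [k])) = 0" for l k
    using assms(2) by simp
  then have *: "(if k = i then lookup r (Word l) else 0) + (if k = j then lookup s (Word l) else 0) = 0" for k l
    by (simp add: lookup_add lookup_mult_free_gen)
  have "lookup r w = 0" "lookup s w = 0" for w
    using *[of i "letters w"] *[of j "letters w"] assms(1) by auto
  then show "r = 0" "s = 0" by (auto intro: poly_mapping_eqI)
qed

subsection \<open>Adjoining a central variable\<close>

lemma lookup_mult_nat:
  fixes p q :: "nat \<Rightarrow>\<^sub>0 'a::ring_1"
  shows "lookup (p * q) n = (\<Sum>i\<le>n. lookup p i * lookup q (n - i))"
proof (induction p rule: poly_mapping_additive_induct)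
  case (single k a)
  show ?case
  proof (induction q rule: poly_mapping_additive_induct)
    case (single l b)
    have "(\<Sum>i\<le>n. lookup (single k a) i * lookup (single l b) (n - i)) =
        (\<Sum>i\<le>n. if i = k then a * (b when l = n - k) else 0)"
      by (rule sum.cong) (auto simp: lookup_single when_def)
    also have "\<dots> = lookup (single (k + l) (a * b)) n"
      by (auto simp: sum.delta lookup_single when_def)
    finally show ?case by (simp add: mult_single)
  qed (simp add: distrib_left lookup_add sum.distrib)
qed (simp add: distrib_right lookup_add sum.distrib)

lemma lookup_mult_leading:
  fixes p q :: "nat \<Rightarrow>\<^sub>0 'a::ring_1"
  assumes "\<And>n. n > k \<Longrightarrow> lookup p n = 0" "\<And>n. n > l \<Longrightarrow> lookup q n = 0"
  shows "lookup (p * q) (k + l) = lookup p k * lookup q l"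
proof -
  have "(\<Sum>i\<le>k + l. lookup p i * lookup q (k + l - i)) = (\<Sum>i\<in>{k}. lookup p i * lookup q (k + l - i))"
  proof (rule sum.mono_neutral_right)
    show "\<forall>i\<in>{..k + l} - {k}. lookup p i * lookup q (k + l - i) = 0"
    proof
      fix i assume "i \<in> {..k + l} - {k}"
      then have "i > k \<or> k + l - i > l" by auto
      then show "lookup p i * lookup q (k + l - i) = 0" using assms by auto
    qed
  qed auto
  then show ?thesis by (simp add: lookup_mult_nat)
qed

text \<open>The bounds are written \<open>Suc k\<close> and \<open>Suc l\<close> so that the
  coefficients one below the top have the indices \<open>k\<close> and \<open>l\<close>, without
  truncated subtraction.\<close>

lemma lookup_mult_subleading:
  fixes p q :: "nat \<Rightarrow>\<^sub>0 'a::ring_1"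
  assumes "\<And>n. n > Suc k \<Longrightarrow> lookup p n = 0" "\<And>n. n > Suc l \<Longrightarrow> lookup q n = 0"
  shows "lookup (p * q) (Suc (k + l)) =
    lookup p k * lookup q (Suc l) + lookup p (Suc k) * lookup q l"
proof -
  have "(\<Sum>i\<le>Suc (k + l). lookup p i * lookup q (Suc (k + l) - i)) =
      (\<Sum>i\<in>{k, Suc k}. lookup p i * lookup q (Suc (k + l) - i))"
  proof (rule sum.mono_neutral_right)
    show "\<forall>i\<in>{..Suc (k + l)} - {k, Suc k}. lookup p i * lookup q (Suc (k + l) - i) = 0"
    proof
      fix i assume "i \<in> {..Suc (k + l)} - {k, Suc k}"
      then have "i > Suc k \<or> Suc (k + l) - i > Suc l" by auto
      then show "lookup p i * lookup q (Suc (k + l) - i) = 0" using assms by auto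
    qed
  qed auto
  then show ?thesis by (simp add: lookup_mult_nat Suc_diff_le)
qed

text \<open>The variable t of R[t] for noncommutative R, with R[t] realized as the monoid algebra of
  the natural numbers; t is central by \<open>indet_commutes\<close>.\<close>

definition indet :: "nat \<Rightarrow>\<^sub>0 'a::ring_1" where "indet = single 1 1"

lemma lookup_mult_indet: "lookup (p * indet) n = (if n = 0 then 0 else lookup p (n - 1))"
proof (induction p rule: poly_mapping_additive_induct)
  case (single k a)
  then show ?case by (auto simp: indet_def mult_single lookup_single when_def)
qed (simp add: distrib_right lookup_add)

lemma indet_commutes: "indet * p = p * indet"
  by (induction p rule: poly_mapping_additive_induct)
    (simp_all add: indet_def mult_single distrib_left distrib_right)

lemma lookup_mult_const: "lookup (p * single 0 a) n = lookup p n * a"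
  for p :: "nat \<Rightarrow>\<^sub>0 'a::ring_1"
  by (induction p rule: poly_mapping_additive_induct)
    (auto simp: mult_single lookup_single when_def distrib_right lookup_add)

lemma lookup_const_mult: "lookup (single 0 a * p) n = a * lookup p n"
  for p :: "nat \<Rightarrow>\<^sub>0 'a::ring_1"
  by (induction p rule: poly_mapping_additive_induct)
    (auto simp: mult_single lookup_single when_def distrib_left lookup_add)

lemma lookup_combination:
  fixes a b :: "nat \<Rightarrow>\<^sub>0 'a::ring_1"
  shows "lookup (a * (single 0 x - indet) + b * single 0 y) n =
    lookup a n * x - (if n = 0 then 0 else lookup a (n - 1)) + lookup b n * y"
  by (simp add: right_diff_distrib lookup_add lookup_minus lookup_mult_const lookup_mult_indet)

lemma ring_homo_map:
  fixes \<phi> :: "'a::ring_1 \<Rightarrow> 'b::ring_1"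
  assumes "ring_homo \<phi>"
  shows "ring_homo (Poly_Mapping.map \<phi> :: (nat \<Rightarrow>\<^sub>0 'a) \<Rightarrow> _)"
proof -
  have l: "lookup (Poly_Mapping.map \<phi> p) n = \<phi> (lookup p n)" for p :: "nat \<Rightarrow>\<^sub>0 'a" and n
    by (simp add: lookup_map_0 ring_homoD[OF assms])
  show ?thesis
    by (intro ring_homoI poly_mapping_eqI)
      (simp_all add: l lookup_add lookup_mult_nat ring_homoD[OF assms] lookup_one when_def)
qed

lemma map_single: "\<phi> 0 = 0 \<Longrightarrow> Poly_Mapping.map \<phi> (single n a) = single n (\<phi> a)"
  by (rule poly_mapping_eqI) (simp add: lookup_map_0 lookup_single when_def)

text \<open>The coefficient of t^n reads r_n x_i + s_n x_j = r_(n-1). Its right-hand side vanishes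
  by induction, and left independence of the generators does the rest.\<close>

lemma central_combination_eq_0:
  fixes r s :: "nat \<Rightarrow>\<^sub>0 ('n, 'k::field) free_algebra"
  assumes "i \<noteq> j" "r * (single 0 (free_gen i) - indet) + s * single 0 (free_gen j) = 0"
  shows "r = 0" "s = 0"
proof -
  have eq: "lookup r n * free_gen i - (if n = 0 then 0 else lookup r (n - 1)) + lookup s n * free_gen j = 0" for n
    using arg_cong[OF assms(2), of "\<lambda>p. lookup p n"] by (simp add: lookup_combination)
  have "lookup r n = 0 \<and> lookup s n = 0" for n
  proof (induction n)
    case 0
    show ?case using eq[of 0] left_combination_eq_0[OF assms(1), of "lookup r 0" "lookup s 0"] by simp
  next
    case (Suc n)
    then show ?case
      using eq[of "Suc n"] left_combination_eq_0[OF assms(1), of "lookup r (Suc n)" "lookup s (Suc n)"] by simp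
  qed
  then show "r = 0" "s = 0" by (auto intro: poly_mapping_eqI)
qed

section \<open>Fox expansions at the point (t, 0) with bounds on word length\<close>

definition coeffs_shorter :: "nat \<Rightarrow> (nat \<Rightarrow>\<^sub>0 ('n, 'k::field) free_algebra) \<Rightarrow> bool" where
  "coeffs_shorter n a \<longleftrightarrow> (\<forall>m. \<forall>w\<in>keys (lookup a m). length (letters w) < n)"

lemma coeffs_shorter_0 [simp]: "coeffs_shorter n 0"
  by (simp add: coeffs_shorter_def)

lemma coeffs_shorter_add:
  "coeffs_shorter n a \<Longrightarrow> coeffs_shorter n b \<Longrightarrow> coeffs_shorter n (a + b)"
proof (unfold coeffs_shorter_def lookup_add, intro allI ballI)
  fix m w
  assume ab: "\<forall>m. \<forall>w\<in>keys (lookup a m). length (letters w) < n" "\<forall>m. \<forall>w\<in>keys (lookup b m). length (letters w) < n"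
    and "w \<in> keys (lookup a m + lookup b m)"
  then have "w \<in> keys (lookup a m) \<union> keys (lookup b m)"
    using Poly_Mapping.keys_add[of "lookup a m" "lookup b m"] by (rule_tac subsetD)
  then show "length (letters w) < n" using ab by auto
qed

lemma coeffs_shorter_mono: "coeffs_shorter n a \<Longrightarrow> n \<le> m \<Longrightarrow> coeffs_shorter m a"
  unfolding coeffs_shorter_def by (meson less_le_trans)

lemma coeffs_shorter_scalar:
  "coeffs_shorter n a \<Longrightarrow> coeffs_shorter n (single 0 (single 0 c) * a)"
  unfolding coeffs_shorter_def lookup_const_mult scale_eq_mult[symmetric]
  by (auto simp: in_keys_iff lookup_scale)

lemma coeffs_shorter_indet: "coeffs_shorter n a \<Longrightarrow> coeffs_shorter n (indet * a)"
  unfolding coeffs_shorter_def indet_commutes lookup_mult_indet by auto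

lemma coeffs_shorter_const:
  "(\<And>w. w \<in> keys f \<Longrightarrow> length (letters w) < n) \<Longrightarrow> coeffs_shorter n (single 0 f)"
  by (auto simp: coeffs_shorter_def lookup_single when_def)

text \<open>For \<open>f\<close> vanishing at the point (t, 0), \<open>a\<close> and
  \<open>b\<close> are its left Fox derivatives there. The strict bound records that a derivative
  has smaller degree than the element itself.\<close>

definition combination_below ::
    "2 \<Rightarrow> 2 \<Rightarrow> nat \<Rightarrow> (2, 'k::field) free_algebra \<Rightarrow> bool" where
  "combination_below i j n f \<longleftrightarrow> (\<exists>a b. coeffs_shorter n a \<and> coeffs_shorter n b \<and>
     single 0 f = a * (single 0 (free_gen i) - indet) + b * single 0 (free_gen j))"

lemma combination_below_add:
  assumes "combination_below i j n f" "combination_below i j n g"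
  shows "combination_below i j n (f + g)"
proof -
  obtain a b a' b' where
    "coeffs_shorter n a" "coeffs_shorter n b" "coeffs_shorter n a'" "coeffs_shorter n b'"
    "single 0 f = a * (single 0 (free_gen i) - indet) + b * single 0 (free_gen j)"
    "single 0 g = a' * (single 0 (free_gen i) - indet) + b' * single 0 (free_gen j)"
    using assms unfolding combination_below_def by blast
  then show ?thesis unfolding combination_below_def
    by (intro exI[of _ "a + a'"] exI[of _ "b + b'"]) (simp add: coeffs_shorter_add single_add distrib_right)
qed

lemma combination_below_scalar:
  assumes "combination_below i j n f"
  shows "combination_below i j n (single 0 c * f)"
proof -
  obtain a b where
    "coeffs_shorter n a" "coeffs_shorter n b"
    "single 0 f = a * (single 0 (free_gen i) - indet) + b * single 0 (free_gen j)"
    using assms unfolding combination_below_def by blast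
  moreover have "single 0 (single 0 c * f) = single 0 (single 0 c) * single (0::nat) f"
    by (simp add: mult_single)
  ultimately show ?thesis unfolding combination_below_def
    by (intro exI[of _ "single 0 (single 0 c) * a"] exI[of _ "single 0 (single 0 c) * b"])
      (simp add: coeffs_shorter_scalar distrib_left mult.assoc)
qed

text \<open>Peel off the last letter. A final x_j gives a = 0 and b the prefix. A final x_i is
  replaced by means of l x_i = l (x_i - t) + t l, and the prefix l, which still contains j, is
  expanded by induction.\<close>

lemma combination_below_word:
  assumes ij: "i \<noteq> j" and "j \<in> set l"
  shows "combination_below i j (length l) (single (Word l) 1 :: (2, 'k::field) free_algebra)"
  using assms(2)
proof (induction l rule: rev_induct)
  case (snoc k l)
  let ?l = "single (Word l) 1 :: (2, 'k) free_algebra"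
  have short: "coeffs_shorter (length (l @ [k])) (single 0 ?l)"
    by (rule coeffs_shorter_const) simp
  show ?case
  proof (cases "k = j")
    case True
    then show ?thesis unfolding combination_below_def
      by (intro exI[of _ 0] exI[of _ "single 0 ?l"])
        (simp add: short[simplified] single_Word_snoc mult_single)
  next
    case False
    then have k: "k = i" and "j \<in> set l" using two_cases[OF ij] snoc.prems by auto
    with snoc.IH obtain a b where ab: "coeffs_shorter (length l) a" "coeffs_shorter (length l) b"
      "single 0 ?l = a * (single 0 (free_gen i) - indet) + b * single 0 (free_gen j)"
      unfolding combination_below_def by blast
    have "single 0 (single (Word (l @ [k])) 1) = single (0::nat) ?l * single 0 (free_gen i)"
      by (simp add: single_Word_snoc mult_single k)
    also have "\<dots> = single 0 ?l * (single 0 (free_gen i) - indet) + indet * single 0 ?l"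
      by (simp only: indet_commutes right_diff_distrib) simp
    also have "\<dots> = (single 0 ?l + indet * a) * (single 0 (free_gen i) - indet) + (indet * b) * single 0 (free_gen j)"
      by (simp only: ab(3) distrib_left distrib_right mult.assoc add.assoc)
    finally have "single 0 (single (Word (l @ [k])) 1) =
      (single 0 ?l + indet * a) * (single 0 (free_gen i) - indet) + (indet * b) * single 0 (free_gen j)" .
    moreover have "coeffs_shorter (length (l @ [k])) (single 0 ?l + indet * a)"
      "coeffs_shorter (length (l @ [k])) (indet * b)"
      using short ab by (auto intro!: coeffs_shorter_add coeffs_shorter_indet intro: coeffs_shorter_mono)
    ultimately show ?thesis unfolding combination_below_def by blast
  qed
qed simp

lemma combination_below_mono: "combination_below i j n f \<Longrightarrow> n \<le> m \<Longrightarrow> combination_below i j m f"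
  unfolding combination_below_def using coeffs_shorter_mono by blast

lemma combination_belowI:
  assumes ij: "i \<noteq> j" and f: "\<And>w. w \<in> keys f \<Longrightarrow> j \<in> set (letters w)"
  shows "combination_below i j (fdeg f) f"
proof -
  have "combination_below i j (fdeg f) (\<Sum>w\<in>A. single w (lookup f w))" if "finite A" "A \<subseteq> keys f" for A
    using that
  proof (induction A rule: finite_induct)
    case empty
    show ?case unfolding combination_below_def by (intro exI[of _ 0]) simp
  next
    case (insert w A)
    have "combination_below i j (fdeg f) (single (Word (letters w)) 1)"
      using insert.prems f length_le_fdeg[of w f]
      by (intro combination_below_mono[OF combination_below_word[OF ij]]) auto
    then have "combination_below i j (fdeg f) (single w (lookup f w))"
      using combination_below_scalar by (subst single_eq_const_mult) auto
    with insert show ?case by (auto intro: combination_below_add)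
  qed
  from this[of "keys f"] show ?thesis by (simp add: poly_mapping_sum_single)
qed

lemma exponents_replicate_inj:
  assumes "exponents v = exponents (Word (replicate n i))"
  shows "v = Word (replicate n i)"
proof -
  have c: "count_list (letters v) k = count_list (replicate n i) k" for k
    using lookup_exponents[of v k] lookup_exponents[of "Word (replicate n i)" k] assms by simp
  have "set (letters v) \<subseteq> {i}"
  proof
    fix k assume "k \<in> set (letters v)"
    then have "count_list (letters v) k \<noteq> 0" by (simp add: count_list_0_iff)
    then have "k \<in> set (replicate n i)" using c by (metis count_list_0_iff)
    then show "k \<in> {i}" by auto
  qed
  then have "letters v = replicate (length (letters v)) i"
    by (intro replicate_eqI) auto
  moreover have "count_list (replicate m i) i = m" for m by (induction m) auto
  ultimately have "letters v = replicate n i" using c[of i] by metis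
  then show ?thesis by (cases v) simp
qed

text \<open>A power of x_i is the only word with its exponent vector, so its coefficient survives
  abelianization unchanged. Elements of the kernel therefore vanish at (t, 0) and have a Fox
  expansion.\<close>

lemma letter_of_commutator_ideal:
  fixes f :: "(2, 'k::field) free_algebra"
  assumes ij: "i \<noteq> j" and f: "abelianize f = 0" "w \<in> keys f"
  shows "j \<in> set (letters w)"
proof (rule ccontr)
  assume "j \<notin> set (letters w)"
  then have "letters w = replicate (length (letters w)) i"
    using two_cases[OF ij] by (intro replicate_eqI) metis+
  then obtain n where w: "w = Word (replicate n i)" by (cases w) auto
  have "lookup (abelianize f) (exponents w) = (\<Sum>v\<in>keys f. lookup f v when exponents v = exponents w)"
    by (simp add: abelianize_def lookup_sum lookup_single)
  also have "\<dots> = (\<Sum>v\<in>keys f. if v = w then lookup f w else 0)"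
    by (rule sum.cong) (auto simp: when_def w dest: exponents_replicate_inj)
  also have "\<dots> = lookup f w" using f(2) by simp
  finally show False using f by (simp add: in_keys_iff)
qed

subsection \<open>Automorphisms in the kernel\<close>

lemma fdeg_add_shorter:
  assumes "f \<noteq> 0" "\<And>w. w \<in> keys g \<Longrightarrow> length (letters w) < fdeg f"
  shows "f + g \<noteq> 0" "fdeg f \<le> fdeg (f + g)"
proof -
  obtain w where w: "w \<in> keys f" "length (letters w) = fdeg f" using fdeg_attained[OF assms(1)] by blast
  then have "w \<notin> keys g" using assms(2) by force
  then have *: "w \<in> keys (f + g)" using w(1) by (simp add: in_keys_iff lookup_add)
  then show "f + g \<noteq> 0" by auto
  show "fdeg f \<le> fdeg (f + g)" using length_le_fdeg[OF *] w(2) by simp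
qed

lemma fdeg_uminus: "fdeg (- f) = fdeg f"
proof -
  have "keys (- f) = keys f" by (auto simp: in_keys_iff)
  then show ?thesis by (simp add: fdeg_def)
qed

text \<open>The degree in t of the 2 x 2 matrix with these entries; the value 0 also covers the zero
  matrix.\<close>

lemma max_coeff_index:
  fixes p q r s :: "nat \<Rightarrow>\<^sub>0 'a::zero"
  obtains k where
    "\<And>n. n > k \<Longrightarrow> lookup p n = 0 \<and> lookup q n = 0 \<and> lookup r n = 0 \<and> lookup s n = 0"
    "k = 0 \<or> lookup p k \<noteq> 0 \<or> lookup q k \<noteq> 0 \<or> lookup r k \<noteq> 0 \<or> lookup s k \<noteq> 0"
proof
  define K where "K = insert 0 (keys p \<union> keys q \<union> keys r \<union> keys s)"
  have K: "finite K" "K \<noteq> {}" by (auto simp: K_def)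
  show "lookup p n = 0 \<and> lookup q n = 0 \<and> lookup r n = 0 \<and> lookup s n = 0" if "n > Max K" for n
  proof -
    have "n \<notin> K" using that K Max_ge[of K n] by auto
    then show ?thesis by (simp add: K_def in_keys_iff)
  qed
  show "Max K = 0 \<or> lookup p (Max K) \<noteq> 0 \<or> lookup q (Max K) \<noteq> 0 \<or> lookup r (Max K) \<noteq> 0 \<or> lookup s (Max K) \<noteq> 0"
    using Max_in[OF K] by (auto simp: K_def in_keys_iff)
qed

text \<open>Each image is its generator plus an element of the commutator ideal, so \<theta> x_i - t
  and \<theta> x_j both vanish at (t, 0). The two expansions are the rows of the Fox matrix; the
  positive degree of \<theta> x_j and the bound on \<open>d\<close> are what the final degree
  comparison uses.\<close>

lemma kernel_expansion:
  fixes \<theta> :: "(2, 'k::field) free_algebra \<Rightarrow> (2, 'k) free_algebra"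
  assumes ab: "\<And>f. abelianize (\<theta> f) = abelianize f" and ij: "i \<noteq> j"
  obtains a b c d where
    "single 0 (\<theta> (free_gen i)) - indet = a * (single 0 (free_gen i) - indet) + b * single 0 (free_gen j)"
    "single 0 (\<theta> (free_gen j)) = c * (single 0 (free_gen i) - indet) + d * single 0 (free_gen j)"
    "coeffs_shorter (fdeg (\<theta> (free_gen j))) d"
    "fdeg (\<theta> (free_gen j)) > 0"
proof -
  let ?u = "\<theta> (free_gen i) - free_gen i" and ?v = "\<theta> (free_gen j) - free_gen j"
  have k: "j \<in> set (letters w)" if "w \<in> keys (\<theta> (free_gen j))" for w
  proof -
    have "w \<in> keys ?v \<union> keys (free_gen j :: (2, 'k) free_algebra)"
      using that Poly_Mapping.keys_add[of ?v "free_gen j"] by auto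
    then show ?thesis
      using letter_of_commutator_ideal[OF ij, of ?v w] by (auto simp: free_gen_def abelianize_diff ab)
  qed
  have "\<theta> (free_gen j) \<noteq> 0"
  proof
    assume "\<theta> (free_gen j) = 0"
    then have "abelianize (free_gen j :: (2, 'k) free_algebra) = 0" by (metis ab abelianize_0)
    then show False using letter_of_commutator_ideal[of j i "free_gen j :: (2, 'k) free_algebra" "Word [j]"] ij
      by (simp add: free_gen_def)
  qed
  then obtain w where "w \<in> keys (\<theta> (free_gen j))" "length (letters w) = fdeg (\<theta> (free_gen j))"
    using fdeg_attained by blast
  then have pos: "fdeg (\<theta> (free_gen j)) > 0" using k[of w] by (cases "letters w") auto
  have "combination_below i j (fdeg (\<theta> (free_gen j))) (\<theta> (free_gen j))"
    by (rule combination_belowI[OF ij k])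
  moreover have "combination_below i j (fdeg ?u) ?u"
    by (intro combination_belowI[OF ij] letter_of_commutator_ideal[OF ij, of ?u]) (simp_all add: abelianize_diff ab)
  ultimately obtain c d a b where cd: "coeffs_shorter (fdeg (\<theta> (free_gen j))) d"
    "single 0 (\<theta> (free_gen j)) = c * (single 0 (free_gen i) - indet) + d * single 0 (free_gen j)"
    and u: "single 0 ?u = a * (single 0 (free_gen i) - indet) + b * single 0 (free_gen j)"
    unfolding combination_below_def by metis
  have "single 0 (\<theta> (free_gen i)) - indet = single 0 ?u + (single 0 (free_gen i) - indet)"
    by (simp flip: single_add)
  then have "single 0 (\<theta> (free_gen i)) - indet =
      (a + 1) * (single 0 (free_gen i) - indet) + b * single 0 (free_gen j)"
    unfolding u by (simp add: distrib_right)
  with cd show ?thesis using that pos by blast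
qed

text \<open>
  The matrix of left Fox derivatives of the pair \<open>\<phi> x\<^sub>i, \<phi> x\<^sub>j\<close> at the point \<open>(t, 0)\<close>, with \<open>t\<close> the
  central variable, is invertible. If its degree \<open>k\<close> in \<open>t\<close> were positive, comparing the two highest
  coefficients in its product with the inverse matrix would give an equation violating the degree
  bound in the free algebra.
\<close>

lemma kernel_automorphism_gens:
  fixes \<phi> :: "(2, 'k::field) free_algebra \<Rightarrow> (2, 'k) free_algebra"
  assumes \<phi>: "algebra_automorphism \<phi>" and ab: "\<And>f. abelianize (\<phi> f) = abelianize f" and ij: "i \<noteq> j"
  shows "\<exists>b d. \<phi> (free_gen i) = free_gen i + b * free_gen j \<and> \<phi> (free_gen j) = d * free_gen j"
proof -
  define \<psi> where "\<psi> = inv \<phi>"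
  note inv = algebra_automorphismD(2,3)[OF \<phi>, folded \<psi>_def]
  have \<phi>h: "ring_homo \<phi>" and \<psi>h: "ring_homo \<psi>"
    using algebra_automorphismD(1)[OF \<phi>] algebra_automorphismD(1)[OF algebra_automorphism_inv[OF \<phi>]]
    by (simp_all add: algebra_hom_iff \<psi>_def)
  have ab': "abelianize (\<psi> f) = abelianize f" for f by (metis ab inv(1))
  let ?\<Phi> = "Poly_Mapping.map \<phi> :: (nat \<Rightarrow>\<^sub>0 (2, 'k) free_algebra) \<Rightarrow> _"
  let ?\<Psi> = "Poly_Mapping.map \<psi> :: (nat \<Rightarrow>\<^sub>0 (2, 'k) free_algebra) \<Rightarrow> _"
  note \<Phi> = ring_homo_map[OF \<phi>h] and \<Psi> = ring_homo_map[OF \<psi>h]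
  have \<Phi>s [simp]: "?\<Phi> (single n f) = single n (\<phi> f)" and \<Psi>s [simp]: "?\<Psi> (single n f) = single n (\<psi> f)" for n f
    by (simp_all add: map_single ring_homoD[OF \<phi>h] ring_homoD[OF \<psi>h])
  have \<Phi>i [simp]: "?\<Phi> indet = indet" "?\<Psi> indet = indet"
    by (simp_all add: indet_def ring_homoD[OF \<phi>h] ring_homoD[OF \<psi>h] del: One_nat_def)
  have \<Phi>\<Psi>: "?\<Phi> (?\<Psi> p) = p" for p
    by (rule poly_mapping_eqI) (simp add: lookup_map_0 ring_homoD[OF \<phi>h] ring_homoD[OF \<psi>h] inv)
  define x y P Q where "x = (free_gen i :: (2, 'k) free_algebra)" and "y = (free_gen j :: (2, 'k) free_algebra)"
    and "P = \<phi> x" and "Q = \<phi> y"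
  let ?C = "single (0::nat) :: (2, 'k) free_algebra \<Rightarrow> _" and ?t = "indet :: nat \<Rightarrow>\<^sub>0 (2, 'k) free_algebra"
  obtain a b c d where E1: "?C P - ?t = a * (?C x - ?t) + b * ?C y"
    and E2: "?C Q = c * (?C x - ?t) + d * ?C y"
    and short: "coeffs_shorter (fdeg Q) d" and Qpos: "fdeg Q > 0"
    using kernel_expansion[of \<phi>, OF ab ij] unfolding x_def y_def P_def Q_def by metis
  obtain \<alpha> \<beta> \<gamma> \<delta> where F: "?C (\<psi> x) - ?t = \<alpha> * (?C x - ?t) + \<beta> * ?C y"
    and F2: "?C (\<psi> y) = \<gamma> * (?C x - ?t) + \<delta> * ?C y"
    using kernel_expansion[of \<psi>, OF ab' ij] unfolding x_def y_def by metis
  \<comment> \<open>Applying \<phi> to the expansions for its inverse expresses x - t and y through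
    P - t and Q, so these entries form the inverse of the matrix (a, b; c, d).\<close>
  define a' b' c' d' where "a' = ?\<Phi> \<alpha>" and "b' = ?\<Phi> \<beta>" and "c' = ?\<Phi> \<gamma>" and "d' = ?\<Phi> \<delta>"
  have E3: "?C x - ?t = a' * (?C P - ?t) + b' * ?C Q"
    using arg_cong[OF F, of ?\<Phi>] by (simp add: ring_homoD[OF \<Phi>] inv P_def Q_def a'_def b'_def)
  have E4: "?C y = c' * (?C P - ?t) + d' * ?C Q"
    using arg_cong[OF F2, of ?\<Phi>] by (simp add: ring_homoD[OF \<Phi>] inv P_def Q_def c'_def d'_def)
  have U1: "r = 0 \<and> s = 0" if "r * (?C x - ?t) + s * ?C y = 0" for r s
    using central_combination_eq_0[OF ij] that unfolding x_def y_def by blast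
  \<comment> \<open>The map induced by \<psi> carries P - t and Q back to x - t and y, so
    independence is inherited from \<open>U1\<close>.\<close>
  have U2: "r = 0 \<and> s = 0" if "r * (?C P - ?t) + s * ?C Q = 0" for r s
  proof -
    have "?\<Psi> (r * (?C P - ?t) + s * ?C Q) = 0" using that by (simp add: ring_homoD[OF \<Psi>])
    then have "?\<Psi> r * (?C x - ?t) + ?\<Psi> s * ?C y = 0"
      by (simp add: ring_homoD[OF \<Psi>] P_def Q_def inv)
    then have "?\<Psi> r = 0" "?\<Psi> s = 0" using U1 by blast+
    then show ?thesis by (metis \<Phi>\<Psi> ring_homoD(4)[OF \<Phi>])
  qed
  \<comment> \<open>Inserting one expansion into the other yields left relations whose coefficients
    must vanish. These are entries of M' M = 1 and M M' = 1.\<close>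
  have "(a' * a + b' * c - 1) * (?C x - ?t) + (a' * b + b' * d) * ?C y =
      a' * (a * (?C x - ?t) + b * ?C y) + b' * (c * (?C x - ?t) + d * ?C y) - (?C x - ?t)"
    by (simp only: distrib_left distrib_right left_diff_distrib mult.assoc mult_1_left) simp
  also have "\<dots> = 0" unfolding E1[symmetric] E2[symmetric] E3[symmetric] by simp
  finally have M'M: "a' * b + b' * d = 0" using U1 by blast
  have "(a * a' + b * c' - 1) * (?C P - ?t) + (a * b' + b * d') * ?C Q =
      a * (a' * (?C P - ?t) + b' * ?C Q) + b * (c' * (?C P - ?t) + d' * ?C Q) - (?C P - ?t)"
    by (simp only: distrib_left distrib_right left_diff_distrib mult.assoc mult_1_left) simp
  also have "\<dots> = 0" unfolding E3[symmetric] E4[symmetric] E1[symmetric] by simp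
  finally have MM1: "a * b' + b * d' = 0" using U2 by blast
  have "(c * a' + d * c') * (?C P - ?t) + (c * b' + d * d' - 1) * ?C Q =
      c * (a' * (?C P - ?t) + b' * ?C Q) + d * (c' * (?C P - ?t) + d' * ?C Q) - ?C Q"
    by (simp only: distrib_left distrib_right left_diff_distrib mult.assoc mult_1_left) simp
  also have "\<dots> = 0" unfolding E3[symmetric] E4[symmetric] E2[symmetric] by simp
  finally have MM2: "c * b' + d * d' = 1" using U2 by (metis right_minus_eq)

  obtain k where k: "\<And>n. n > k \<Longrightarrow> lookup a n = 0 \<and> lookup b n = 0 \<and> lookup c n = 0 \<and> lookup d n = 0"
    and k_max: "k = 0 \<or> lookup a k \<noteq> 0 \<or> lookup b k \<noteq> 0 \<or> lookup c k \<noteq> 0 \<or> lookup d k \<noteq> 0"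
    using max_coeff_index[of a b c d] by blast
  obtain k' where k': "\<And>n. n > k' \<Longrightarrow> lookup a' n = 0 \<and> lookup b' n = 0 \<and> lookup c' n = 0 \<and> lookup d' n = 0"
    and k'_max: "k' = 0 \<or> lookup a' k' \<noteq> 0 \<or> lookup b' k' \<noteq> 0 \<or> lookup c' k' \<noteq> 0 \<or> lookup d' k' \<noteq> 0"
    using max_coeff_index[of a' b' c' d'] by blast
  have L: "lookup (?C f - ?t) (Suc n) = (if n = 0 then - 1 else 0)" for f n
    by (simp add: lookup_minus indet_def lookup_single when_def)
  have L0: "lookup (?C f - ?t) 0 = f" for f
    by (simp add: lookup_minus indet_def lookup_single when_def)
  have C: "lookup (?C f) n = (if n = 0 then f else 0)" for f n
    by (simp add: lookup_single when_def)
  note E1' = E1[THEN arg_cong, of "\<lambda>p. lookup p _", unfolded lookup_combination]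
  note E2' = E2[THEN arg_cong, of "\<lambda>p. lookup p _", unfolded lookup_combination]
  note E3' = E3[THEN arg_cong, of "\<lambda>p. lookup p _", unfolded lookup_combination]
  note E4' = E4[THEN arg_cong, of "\<lambda>p. lookup p _", unfolded lookup_combination]

  have "k = 0"
  proof (rule ccontr)
    assume "k \<noteq> 0"
    \<comment> \<open>In degree k + 1 >= 2 the left sides of \<open>E1\<close> and \<open>E2\<close>
      have no term, while a t and c t contribute the top coefficients of a and c. Hence the first
      column of M has degree below k.\<close>
    have ac: "lookup a k = 0" "lookup c k = 0"
      using E1'[of "Suc k"] E2'[of "Suc k"] k[of "Suc k"] \<open>k \<noteq> 0\<close> by (simp_all add: L C)
    have c': "lookup c' k' = 0"
      using E4'[of "Suc k'"] k'[of "Suc k'"] by (simp add: C)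
    have "lookup b k * lookup d' k' = 0"
      using arg_cong[OF MM1, of "\<lambda>p. lookup p (k + k')"] k k' ac
      by (simp add: lookup_add lookup_mult_leading)
    moreover have "lookup d k * lookup d' k' = 0"
      using arg_cong[OF MM2, of "\<lambda>p. lookup p (k + k')"] k k' ac \<open>k \<noteq> 0\<close>
      by (simp add: lookup_add lookup_mult_leading lookup_one)
    ultimately have d': "lookup d' k' = 0"
      using k_max \<open>k \<noteq> 0\<close> ac by (auto simp: free_mult_eq_0_iff)
    have "k' \<noteq> 0"
    proof
      assume "k' = 0"
      then have "y = 0" using E4'[of 0] c' d' by (simp add: C)
      then have "lookup y (Word [j]) = 0" by simp
      then show False by (simp add: y_def free_gen_def)
    qed
    have "lookup a' k' = 0"
      using E3'[of "Suc k'"] k'[of "Suc k'"] \<open>k' \<noteq> 0\<close> by (simp add: L)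
    then have b': "lookup b' k' \<noteq> 0" and a': "lookup a' k' = 0" using k'_max \<open>k' \<noteq> 0\<close> c' d' by auto
    have "lookup b' k' * lookup d k = 0"
      using arg_cong[OF M'M, of "\<lambda>p. lookup p (k' + k)"] k k' a'
      by (simp add: lookup_add lookup_mult_leading)
    then have d: "lookup d k = 0" using b' by (simp add: free_mult_eq_0_iff)
    then have b: "lookup b k \<noteq> 0" using k_max \<open>k \<noteq> 0\<close> ac by auto
    obtain l l' where l: "k = Suc l" "k' = Suc l'" using \<open>k \<noteq> 0\<close> \<open>k' \<noteq> 0\<close> not0_implies_Suc by blast
    \<comment> \<open>The top coefficients of M' M give no more, so the next ones are compared; the
      coefficient of a' that occurs is then read off from \<open>E3\<close>. For l' = 0 the term - t
      on the left of \<open>E3\<close> contributes an extra 1.\<close>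
    have "lookup a' l' * lookup b k + lookup b' k' * lookup d l = 0"
      using arg_cong[OF M'M, of "\<lambda>p. lookup p (Suc (l' + l))"] k k' a' d
      by (simp add: lookup_add lookup_mult_subleading l)
    moreover have "lookup a' l' = lookup b' k' * Q + (if l' = 0 then 1 else 0)"
      using E3'[of k'] a' L[of x l'] by (simp add: l algebra_simps split: if_splits)
    ultimately have eq: "lookup b' k' * (Q * lookup b k + lookup d l) = (if l' = 0 then - lookup b k else 0)"
      by (simp add: algebra_simps eq_neg_iff_add_eq_0 split: if_splits)
    have "Q \<noteq> 0" using Qpos by (auto simp: fdeg_def)
    have nz: "Q * lookup b k \<noteq> 0" and deg: "fdeg (Q * lookup b k) = fdeg Q + fdeg (lookup b k)"
      using \<open>Q \<noteq> 0\<close> b by (simp_all add: free_mult_eq_0_iff fdeg_mult)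
    \<comment> \<open>The coefficient of d has shorter words than Q and cannot cancel the longest
      words of Q b_k. So the left side of \<open>eq\<close> is nonzero and of larger degree than
      b_k, while the right side is 0 or - b_k.\<close>
    have "length (letters w) < fdeg (Q * lookup b k)" if "w \<in> keys (lookup d l)" for w
      using short that unfolding deg coeffs_shorter_def by (meson trans_less_add1)
    then have sum: "Q * lookup b k + lookup d l \<noteq> 0"
      "fdeg (Q * lookup b k) \<le> fdeg (Q * lookup b k + lookup d l)"
      using fdeg_add_shorter[OF nz, of "lookup d l"] by blast+
    have "fdeg (lookup b k) < fdeg (lookup b' k' * (Q * lookup b k + lookup d l))"
      using sum b' deg Qpos by (simp add: fdeg_mult)
    moreover have "lookup b' k' * (Q * lookup b k + lookup d l) \<noteq> 0"
      using sum b' by (simp add: free_mult_eq_0_iff)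
    ultimately show False unfolding eq by (simp add: fdeg_uminus split: if_splits)
  qed
  \<comment> \<open>With a matrix constant in t, the coefficients of t^1 in \<open>E1\<close> and
    \<open>E2\<close> determine the first column, and those of t^0 are the claim.\<close>
  then have "lookup a 0 = 1" "lookup c 0 = 0"
    using E1'[of "Suc 0"] E2'[of "Suc 0"] k[of "Suc 0"] by (simp_all add: L C)
  then have "P = x + lookup b 0 * y" "Q = lookup d 0 * y"
    using E1'[of 0] E2'[of 0] by (simp_all add: L0 C)
  then show ?thesis unfolding P_def Q_def x_def y_def by blast
qed

text \<open>Exchanging the roles of the generators in \<open>kernel_automorphism_gens\<close> shows
  that \<phi> x_i is both x_i + b x_j and d x_i. Left independence forces b = 0.\<close>

theorem kernel_automorphism_trivial:
  fixes \<phi> :: "(2, 'k::field) free_algebra \<Rightarrow> (2, 'k) free_algebra"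
  assumes \<phi>: "algebra_automorphism \<phi>" and ab: "\<And>f. abelianize (\<phi> f) = abelianize f"
  shows "\<phi> f = f"
proof -
  have "\<phi> (free_gen i) = free_gen i" for i
  proof -
    obtain j :: 2 where ij: "i \<noteq> j" by (metis zero_neq_one)
    obtain b d where "\<phi> (free_gen i) = free_gen i + b * free_gen j" "\<phi> (free_gen i) = d * free_gen i"
      using kernel_automorphism_gens[OF \<phi> ab ij] kernel_automorphism_gens[OF \<phi> ab ij[symmetric]] by blast
    then have "(1 - d) * free_gen i + b * free_gen j = 0" by (simp add: left_diff_distrib)
    from left_combination_eq_0(2)[OF ij this] show ?thesis
      using \<open>\<phi> (free_gen i) = free_gen i + b * free_gen j\<close> by simp
  qed
  moreover have "ring_homo \<phi>" "\<phi> (single 0 c) = single 0 c" for c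
    using algebra_automorphismD(1)[OF \<phi>] by (simp_all add: algebra_hom_iff)
  ultimately show ?thesis
    by (rule_tac free_hom_eqI[of \<phi> "\<lambda>f. f"]) (simp_all add: ring_homo_def[of "\<lambda>f. f"])
qed

section \<open>Initial forms of coordinates\<close>

subsection \<open>Components of a given weight\<close>

definition component :: "('m \<Rightarrow> real) \<Rightarrow> real \<Rightarrow> ('m \<Rightarrow>\<^sub>0 'k::field) \<Rightarrow> ('m \<Rightarrow>\<^sub>0 'k)" where
  "component \<omega> r z = (\<Sum>m\<in>keys z. if \<omega> m = r then single m (lookup z m) else 0)"

lemma lookup_component: "lookup (component \<omega> r z) m = (if \<omega> m = r then lookup z m else 0)"
proof -
  have "lookup (component \<omega> r z) m = (\<Sum>k\<in>keys z. if k = m then if \<omega> m = r then lookup z m else 0 else 0)"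
    unfolding component_def lookup_sum
    by (rule sum.cong) (auto simp: lookup_single when_def)
  then show ?thesis by (auto simp: in_keys_iff)
qed

lemma keys_component: "keys (component \<omega> r z) = {m \<in> keys z. \<omega> m = r}"
  by (auto simp: in_keys_iff lookup_component split: if_splits)

lemma component_0 [simp]: "component \<omega> r 0 = 0"
  by (simp add: component_def)

lemma component_add: "component \<omega> r (f + g) = component \<omega> r f + component \<omega> r g"
  by (rule poly_mapping_eqI) (simp add: lookup_component lookup_add)

lemma component_sum: "component \<omega> r (sum h A) = (\<Sum>a\<in>A. component \<omega> r (h a))"
  by (induction A rule: infinite_finite_induct) (simp_all add: component_add)

lemma component_single: "component \<omega> r (single m c) = (if \<omega> m = r then single m c else 0)"
  by (rule poly_mapping_eqI) (auto simp: lookup_component lookup_single when_def)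

text \<open>Polynomials in \<open>s\<close> over a monoid algebra, where \<open>s\<close> has weight \<open>- \<sigma>\<close>.\<close>

locale weight =
  fixes \<omega> :: "'m::comm_monoid_add \<Rightarrow> real" and \<sigma> :: real
  assumes weight_add: "\<omega> (m + n) = \<omega> m + \<omega> n"
begin

lemma weight_0: "\<omega> 0 = 0"
  using weight_add[of 0 0] by simp

text \<open>Two weights bounded by r and s add up to r + s only if both bounds are attained.\<close>

lemma component_mult:
  fixes f g :: "'m \<Rightarrow>\<^sub>0 'k::field"
  assumes f: "\<And>m. m \<in> keys f \<Longrightarrow> \<omega> m \<le> r" and g: "\<And>m. m \<in> keys g \<Longrightarrow> \<omega> m \<le> s"
  shows "component \<omega> (r + s) (f * g) = component \<omega> r f * component \<omega> s g"
proof -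
  have "f * g = (\<Sum>m\<in>keys f. \<Sum>n\<in>keys g. single (m + n) (lookup f m * lookup g n))"
    by (subst (1 2) poly_mapping_sum_single[symmetric]) (simp add: sum_product mult_single)
  then have "component \<omega> (r + s) (f * g) =
      (\<Sum>m\<in>keys f. \<Sum>n\<in>keys g. component \<omega> (r + s) (single (m + n) (lookup f m * lookup g n)))"
    by (simp add: component_sum)
  also have "\<dots> = (\<Sum>m\<in>keys f. \<Sum>n\<in>keys g. (if \<omega> m = r then single m (lookup f m) else 0) *
      (if \<omega> n = s then single n (lookup g n) else 0))"
  proof (intro sum.cong refl)
    fix m n assume "m \<in> keys f" "n \<in> keys g"
    then have "\<omega> m \<le> r" "\<omega> n \<le> s" using f g by auto
    then show "component \<omega> (r + s) (single (m + n) (lookup f m * lookup g n)) =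
      (if \<omega> m = r then single m (lookup f m) else 0) * (if \<omega> n = s then single n (lookup g n) else 0)"
      by (auto simp: component_single weight_add mult_single)
  qed
  also have "\<dots> = component \<omega> r f * component \<omega> s g"
    by (simp add: component_def sum_product)
  finally show ?thesis .
qed

definition weight_le :: "real \<Rightarrow> ('m \<Rightarrow>\<^sub>0 'k::field) poly \<Rightarrow> bool" where
  "weight_le r F \<longleftrightarrow> (\<forall>l. \<forall>m\<in>keys (coeff F l). \<omega> m - \<sigma> * real l \<le> r)"

text \<open>Here r is a prescribed bound, not the weight attained by F. This makes
  \<open>top_part r\<close> additive, at the price that it may vanish.\<close>

definition top_part :: "real \<Rightarrow> ('m \<Rightarrow>\<^sub>0 'k::field) poly \<Rightarrow> ('m \<Rightarrow>\<^sub>0 'k) poly" where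
  "top_part r F = (\<Sum>l\<le>degree F. monom (component \<omega> (r + \<sigma> * real l) (coeff F l)) l)"

lemma coeff_top_part: "coeff (top_part r F) l = component \<omega> (r + \<sigma> * real l) (coeff F l)"
proof -
  have "coeff (top_part r F) l =
      (\<Sum>k\<le>degree F. if k = l then component \<omega> (r + \<sigma> * real l) (coeff F l) else 0)"
    unfolding top_part_def coeff_sum by (rule sum.cong) auto
  then show ?thesis by (auto simp: coeff_eq_0)
qed

lemma weight_le_add: "weight_le r F \<Longrightarrow> weight_le r G \<Longrightarrow> weight_le r (F + G)"
  unfolding weight_le_def coeff_add
  by (metis (no_types, lifting) Poly_Mapping.keys_add UnE subsetD)

lemma weight_le_0 [simp]: "weight_le r 0"
  by (simp add: weight_le_def)

lemma weight_le_sum: "(\<And>a. a \<in> A \<Longrightarrow> weight_le r (h a)) \<Longrightarrow> weight_le r (sum h A)"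
  by (induction A rule: infinite_finite_induct) (simp_all add: weight_le_add)

lemma weight_le_mono: "weight_le r F \<Longrightarrow> r \<le> s \<Longrightarrow> weight_le s F"
  unfolding weight_le_def by force

lemma top_part_add: "top_part r (F + G) = top_part r F + top_part r G"
  by (rule poly_eqI) (simp add: coeff_top_part component_add)

lemma top_part_0 [simp]: "top_part r 0 = 0"
  by (simp add: top_part_def)

lemma top_part_sum: "top_part r (sum h A) = (\<Sum>a\<in>A. top_part r (h a))"
  by (induction A rule: infinite_finite_induct) (simp_all add: top_part_add)

lemma top_part_less:
  assumes "weight_le r F" "r < s"
  shows "top_part s F = 0"
proof (rule poly_eqI, rule poly_mapping_eqI)
  fix l m
  have "lookup (coeff F l) m \<noteq> 0 \<Longrightarrow> \<omega> m - \<sigma> * real l \<le> r"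
    using assms(1) by (auto simp: weight_le_def in_keys_iff)
  then show "lookup (coeff (top_part s F) l) m = lookup (coeff 0 l) m"
    using assms(2) by (cases "lookup (coeff F l) m = 0") (auto simp: coeff_top_part lookup_component)
qed

lemma
  assumes F: "weight_le r F" and G: "weight_le s G"
  shows weight_le_mult: "weight_le (r + s) (F * G)"
    and top_part_mult: "top_part (r + s) (F * G) = top_part r F * top_part s G"
proof -
  have b: "\<omega> m \<le> r + \<sigma> * real l" if "m \<in> keys (coeff F l)" for m l
    using F that by (force simp: weight_le_def)
  have b': "\<omega> m \<le> s + \<sigma> * real l" if "m \<in> keys (coeff G l)" for m l
    using G that by (force simp: weight_le_def)
  have "\<omega> m - \<sigma> * real n \<le> r + s" if "m \<in> keys (coeff (F * G) n)" for m n
  proof -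
    have "keys (\<Sum>i\<le>n. coeff F i * coeff G (n - i)) \<subseteq> (\<Union>i\<in>{..n}. keys (coeff F i * coeff G (n - i)))"
      by (rule keys_sum)
    with that obtain i where i: "i \<le> n" "m \<in> keys (coeff F i * coeff G (n - i))"
      by (auto simp: coeff_mult)
    then obtain a c where "a \<in> keys (coeff F i)" "c \<in> keys (coeff G (n - i))" "m = a + c"
      using keys_mult by blast
    with b[of a i] b'[of c "n - i"] i(1) show ?thesis
      by (simp add: weight_add of_nat_diff algebra_simps)
  qed
  then show "weight_le (r + s) (F * G)" by (simp add: weight_le_def)
  show "top_part (r + s) (F * G) = top_part r F * top_part s G"
  proof (rule poly_eqI)
    fix n
    have "component \<omega> (r + s + \<sigma> * real n) (coeff F i * coeff G (n - i)) =
        component \<omega> (r + \<sigma> * real i) (coeff F i) * component \<omega> (s + \<sigma> * real (n - i)) (coeff G (n - i))"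
      if "i \<le> n" for i
    proof -
      have "component \<omega> ((r + \<sigma> * real i) + (s + \<sigma> * real (n - i))) (coeff F i * coeff G (n - i)) =
          component \<omega> (r + \<sigma> * real i) (coeff F i) * component \<omega> (s + \<sigma> * real (n - i)) (coeff G (n - i))"
        by (rule component_mult) (erule b b')+
      moreover have "(r + \<sigma> * real i) + (s + \<sigma> * real (n - i)) = r + s + \<sigma> * real n"
        using that by (simp add: of_nat_diff algebra_simps)
      ultimately show ?thesis by simp
    qed
    then show "coeff (top_part (r + s) (F * G)) n = coeff (top_part r F * top_part s G) n"
      by (simp add: coeff_top_part coeff_mult component_sum)
  qed
qed

lemma
  shows weight_le_const: "weight_le 0 [:single 0 c:]"
    and top_part_const: "top_part 0 [:single 0 c:] = [:single 0 c:]"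
proof -
  have *: "coeff [:single 0 c :: 'm \<Rightarrow>\<^sub>0 'a:] l = (if l = 0 then single 0 c else 0)" for l
    by (cases l) auto
  show "weight_le 0 [:single 0 c:]" by (simp add: weight_le_def * weight_0)
  show "top_part 0 [:single 0 c:] = [:single 0 c:]"
    by (rule poly_eqI) (simp add: coeff_top_part * component_single weight_0)
qed

lemma weight_1:
  shows "weight_le 0 (1 :: ('m \<Rightarrow>\<^sub>0 'k::field) poly)" "top_part 0 (1 :: ('m \<Rightarrow>\<^sub>0 'k) poly) = 1"
  using weight_le_const[of "1::'k"] top_part_const[of "1::'k"] by (simp_all add: one_pCons single_one)

lemma weight_power:
  assumes "weight_le r F"
  shows "weight_le (r * real n) (F ^ n)" "top_part (r * real n) (F ^ n) = top_part r F ^ n"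
proof (induction n)
  case (Suc n)
  have "r * real (Suc n) = r + r * real n" by (simp add: algebra_simps)
  then show "weight_le (r * real (Suc n)) (F ^ Suc n)"
    "top_part (r * real (Suc n)) (F ^ Suc n) = top_part r F ^ Suc n"
    using weight_le_mult[OF assms Suc(1)] top_part_mult[OF assms Suc(1)] Suc(2) by simp_all
qed (simp_all add: weight_1)

lemma weight_prod:
  assumes "\<And>i. i \<in> I \<Longrightarrow> weight_le (r i) (F i)"
  shows "weight_le (sum r I) (prod F I) \<and> top_part (sum r I) (prod F I) = (\<Prod>i\<in>I. top_part (r i) (F i))"
  using assms
  by (induction I rule: infinite_finite_induct) (simp_all add: weight_1 weight_le_mult top_part_mult)

end

section \<open>Weights of exponent vectors and their behaviour under substitution\<close>

definition lin_weight :: "('n::finite \<Rightarrow> real) \<Rightarrow> ('n \<Rightarrow>\<^sub>0 nat) \<Rightarrow> real" where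
  "lin_weight v m = (\<Sum>i\<in>UNIV. v i * real (lookup m i))"

lemma lin_weight_add: "lin_weight v (m + n) = lin_weight v m + lin_weight v n"
  by (simp add: lin_weight_def lookup_add sum.distrib distrib_left)

lemma lin_weight_single: "lin_weight v (single i n) = v i * real n"
proof -
  have "lin_weight v (single i n) = (\<Sum>k\<in>UNIV. if k = i then v i * real n else 0)"
    unfolding lin_weight_def by (rule sum.cong) (auto simp: lookup_single when_def)
  then show ?thesis by simp
qed

abbreviation poly_const :: "'k::field \<Rightarrow> ('m::comm_monoid_add \<Rightarrow>\<^sub>0 'k) poly" where
  "poly_const \<equiv> \<lambda>c. [:single 0 c:]"

lemma ring_homo_pCons: "ring_homo (\<lambda>a. [:a :: 'a::comm_ring_1:])"
  by (simp add: ring_homo_def one_pCons)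

lemma ring_homo_poly_const: "ring_homo poly_const"
  using ring_homo_comp[OF ring_homo_pCons ring_homo_const] .

lemma ring_homo_coeff_0: "ring_homo (\<lambda>F :: 'a::comm_ring_1 poly. coeff F 0)"
  by (simp add: ring_homo_def coeff_mult)

text \<open>If x_i is replaced by something of weight at most v_i, a monomial of weight w yields
  terms of weight at most w, so only the monomials of weight W reach weight W, through the leading
  parts of the p_i. Thus taking leading parts commutes with substitution.\<close>

lemma (in weight)
  fixes p :: "'n::finite \<Rightarrow> ('m \<Rightarrow>\<^sub>0 'k::field) poly"
  assumes p: "\<And>i. weight_le (v i) (p i)" and z: "\<And>m. m \<in> keys z \<Longrightarrow> lin_weight v m \<le> W"
  shows weight_le_poly_subst: "weight_le W (poly_subst poly_const p z)"
    and top_part_poly_subst: "top_part W (poly_subst poly_const p z) =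
      poly_subst poly_const (\<lambda>i. top_part (v i) (p i)) (component (lin_weight v) W z)"
proof -
  let ?t = "\<lambda>p m. poly_const (lookup z m) * (\<Prod>i\<in>UNIV. p i ^ lookup m i)"
  have t: "weight_le (lin_weight v m) (?t p m)"
    "top_part (lin_weight v m) (?t p m) = ?t (\<lambda>i. top_part (v i) (p i)) m" for m
  proof -
    have "weight_le (\<Sum>i\<in>UNIV. v i * real (lookup m i)) (\<Prod>i\<in>UNIV. p i ^ lookup m i) \<and>
      top_part (\<Sum>i\<in>UNIV. v i * real (lookup m i)) (\<Prod>i\<in>UNIV. p i ^ lookup m i) =
      (\<Prod>i\<in>UNIV. top_part (v i * real (lookup m i)) (p i ^ lookup m i))"
      by (rule weight_prod) (rule weight_power(1)[OF p])
    then have *: "weight_le (lin_weight v m) (\<Prod>i\<in>UNIV. p i ^ lookup m i)"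
      "top_part (lin_weight v m) (\<Prod>i\<in>UNIV. p i ^ lookup m i) = (\<Prod>i\<in>UNIV. top_part (v i) (p i) ^ lookup m i)"
      by (simp_all add: lin_weight_def weight_power(2)[OF p])
    show "weight_le (lin_weight v m) (?t p m)"
      using weight_le_mult[OF weight_le_const *(1)] by simp
    show "top_part (lin_weight v m) (?t p m) = ?t (\<lambda>i. top_part (v i) (p i)) m"
      using top_part_mult[OF weight_le_const *(1)] *(2) by (simp add: top_part_const)
  qed
  show "weight_le W (poly_subst poly_const p z)"
    unfolding poly_subst_def by (intro weight_le_sum weight_le_mono[OF t(1)] z)
  have "top_part W (poly_subst poly_const p z) =
      (\<Sum>m\<in>keys z. if lin_weight v m = W then ?t (\<lambda>i. top_part (v i) (p i)) m else 0)"
    unfolding poly_subst_def top_part_sum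
  proof (rule sum.cong[OF refl])
    fix m assume "m \<in> keys z"
    then show "top_part W (?t p m) = (if lin_weight v m = W then ?t (\<lambda>i. top_part (v i) (p i)) m else 0)"
      using z[of m] t[of m] top_part_less[OF t(1), of m W] by auto
  qed
  also have "\<dots> = poly_subst poly_const (\<lambda>i. top_part (v i) (p i)) (component (lin_weight v) W z)"
    unfolding poly_subst_def keys_component
    by (subst sum.inter_filter) (auto simp: lookup_component intro!: sum.cong)
  finally show "top_part W (poly_subst poly_const p z) =
      poly_subst poly_const (\<lambda>i. top_part (v i) (p i)) (component (lin_weight v) W z)" .
qed

lemma poly_subst_pCons_gen:
  "poly_subst poly_const (\<lambda>k. [:poly_gen k:]) z = [:z :: ('n::finite, 'k::field) polynomial_algebra:]"
  by (rule poly_hom_eqI[of _ "\<lambda>z. [:z:]"])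
    (simp_all add: ring_homo_poly_const ring_homo_poly_subst poly_subst_const poly_subst_gen ring_homo_pCons)

lemma coeff_0_poly_subst:
  "coeff (poly_subst poly_const p z) 0 = psubst (\<lambda>k. coeff (p k) 0) z"
  for p :: "'n::finite \<Rightarrow> ('m::comm_monoid_add \<Rightarrow>\<^sub>0 'k::field) poly"
  by (rule poly_hom_eqI[of "\<lambda>z. coeff (poly_subst poly_const p z) 0"])
    (simp_all add: ring_homo_comp[OF ring_homo_coeff_0] ring_homo_const ring_homo_poly_const
      ring_homo_poly_subst poly_subst_const poly_subst_gen)

subsection \<open>Invariance of initial forms\<close>

text \<open>A polynomial curve of endomorphisms x_k -> f_k(s) that starts at the identity and does
  not stay there.\<close>

definition nontrivial_family :: "('n \<Rightarrow> ('n, 'k::field) polynomial_algebra poly) \<Rightarrow> bool" where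
  "nontrivial_family f \<longleftrightarrow> (\<forall>k. coeff (f k) 0 = poly_gen k) \<and> (\<exists>k. f k \<noteq> [:poly_gen k:])"

text \<open>Conjugating the translation \<open>x\<^sub>i \<mapsto> x\<^sub>i + s\<close> by \<open>\<beta>\<close> gives a family fixing \<open>\<beta> x\<^sub>j\<close>.\<close>

lemma coordinate_fixing_family:
  fixes \<beta> :: "(2, 'k::field) polynomial_algebra \<Rightarrow> (2, 'k) polynomial_algebra"
  assumes \<beta>: "algebra_automorphism \<beta>"
  obtains f where "nontrivial_family f" "poly_subst poly_const f (\<beta> (poly_gen j)) = [:\<beta> (poly_gen j):]"
proof -
  obtain i :: 2 where ij: "i \<noteq> j" by (metis zero_neq_one)
  define p where "p k = [:\<beta> (poly_gen k):] + (if k = i then [:0, 1:] else 0)" for k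
  define f where "f k = poly_subst poly_const p (inv \<beta> (poly_gen k))" for k
  have \<beta>': "algebra_hom alg_scale alg_scale \<beta>" "algebra_hom alg_scale alg_scale (inv \<beta>)"
    using \<beta> algebra_automorphism_inv[OF \<beta>] by (simp_all add: algebra_automorphism_def)
  have eq: "poly_subst poly_const f (\<beta> (poly_gen k)) = p k" for k
  proof -
    have "poly_subst poly_const p (inv \<beta> (\<beta> (poly_gen k))) = poly_subst poly_const f (\<beta> (poly_gen k))"
      unfolding f_def by (rule poly_subst_hom[OF ring_homo_poly_const \<beta>'(2)])
    then show ?thesis
      by (simp add: algebra_automorphismD(3)[OF \<beta>] poly_subst_gen[OF ring_homo_poly_const])
  qed
  have "coeff (f k) 0 = poly_gen k" for k
  proof -
    have "coeff (f k) 0 = psubst (\<lambda>k. \<beta> (poly_gen k)) (inv \<beta> (poly_gen k))"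
    proof -
      have "(\<lambda>k. coeff (p k) 0) = (\<lambda>k. \<beta> (poly_gen k))" by (auto simp: p_def)
      then show ?thesis unfolding f_def coeff_0_poly_subst by simp
    qed
    also have "\<dots> = \<beta> (inv \<beta> (poly_gen k))" by (rule algebra_hom_eq_psubst[OF \<beta>'(1), symmetric])
    finally show ?thesis by (simp add: algebra_automorphismD(2)[OF \<beta>])
  qed
  moreover have "\<exists>k. f k \<noteq> [:poly_gen k:]"
  proof (rule ccontr)
    assume "\<nexists>k. f k \<noteq> [:poly_gen k:]"
    then have "f = (\<lambda>k. [:poly_gen k:])" by auto
    then have "p i = [:\<beta> (poly_gen i):]" using eq[of i] by (simp add: poly_subst_pCons_gen)
    then show False by (simp add: p_def)
  qed
  moreover have "poly_subst poly_const f (\<beta> (poly_gen j)) = [:\<beta> (poly_gen j):]"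
    using eq[of j] ij by (simp add: p_def)
  ultimately show ?thesis using that unfolding nontrivial_family_def by blast
qed

text \<open>The slope \<open>\<sigma>\<close> is the least one for which the leading parts of the family are defined; some
  monomial attains it, so the leading parts are again a nontrivial family.\<close>

lemma initial_form_invariant:
  fixes Q :: "('n::finite, 'k::field) polynomial_algebra"
  assumes f: "nontrivial_family f" and Q: "poly_subst poly_const f Q = [:Q:]"
    and W: "\<And>m. m \<in> keys Q \<Longrightarrow> lin_weight v m \<le> W"
  obtains g where "nontrivial_family g"
    "poly_subst poly_const g (component (lin_weight v) W Q) = [:component (lin_weight v) W Q:]"
proof -
  \<comment> \<open>A term m s^l of f_k has weight lin_weight v m - \<sigma> l, which is at most v_k
    exactly when \<sigma> is at least this quotient. The terms with l = 0 are the generators and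
    have weight v_k for every \<sigma>.\<close>
  define S where "S = (\<lambda>(k, l, m). (lin_weight v m - v k) / real l) `
    (SIGMA k:UNIV. SIGMA l:{1..degree (f k)}. keys (coeff (f k) l))"
  have "finite S" unfolding S_def by (intro finite_imageI finite_SigmaI) auto
  have in_S: "(lin_weight v m - v k) / real l \<in> S" if "l \<ge> 1" "m \<in> keys (coeff (f k) l)" for k l m
  proof -
    have "l \<le> degree (f k)" using that by (intro le_degree) auto
    then show ?thesis using that unfolding S_def by force
  qed
  obtain k where k: "f k \<noteq> [:poly_gen k:]" using f by (auto simp: nontrivial_family_def)
  have "degree (f k) \<noteq> 0"
  proof
    assume "degree (f k) = 0"
    then have "f k = [:coeff (f k) 0:]" by (metis degree_eq_zeroE coeff_pCons_0)
    then show False using f k by (simp add: nontrivial_family_def)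
  qed
  then have "coeff (f k) (degree (f k)) \<noteq> 0" by auto
  then obtain m where "m \<in> keys (coeff (f k) (degree (f k)))" using keys_eq_empty by blast
  then have "S \<noteq> {}" using in_S[of "degree (f k)" m k] \<open>degree (f k) \<noteq> 0\<close> by auto
  define \<sigma> where "\<sigma> = Max S"
  interpret weight "lin_weight v" \<sigma> by unfold_locales (rule lin_weight_add)
  define g where "g k = top_part (v k) (f k)" for k
  have bound: "weight_le (v k) (f k)" for k
    unfolding weight_le_def
  proof (intro allI ballI)
    fix l m assume m: "m \<in> keys (coeff (f k) l)"
    show "lin_weight v m - \<sigma> * real l \<le> v k"
    proof (cases "l = 0")
      case True
      then have "m = single k 1" using m f by (simp add: nontrivial_family_def poly_gen_def)
      then show ?thesis using True by (simp add: lin_weight_single)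
    next
      case False
      then have "(lin_weight v m - v k) / real l \<le> \<sigma>"
        unfolding \<sigma>_def using in_S[of l m k] m \<open>finite S\<close> by simp
      then show ?thesis using False by (simp add: field_simps)
    qed
  qed
  have "coeff (g k) 0 = poly_gen k" for k
    using f by (simp add: g_def coeff_top_part nontrivial_family_def poly_gen_def component_single lin_weight_single)
  moreover have "\<exists>k. g k \<noteq> [:poly_gen k:]"
  proof -
    have "\<sigma> \<in> S" unfolding \<sigma>_def using \<open>finite S\<close> \<open>S \<noteq> {}\<close> by (rule Max_in)
    then obtain k l m where klm: "l \<ge> 1" "m \<in> keys (coeff (f k) l)" "\<sigma> = (lin_weight v m - v k) / real l"
      unfolding S_def by auto
    then have "lin_weight v m = v k + \<sigma> * real l" by (simp add: field_simps)
    then have "lookup (coeff (g k) l) m \<noteq> 0"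
      using klm(2) unfolding g_def coeff_top_part lookup_component by (simp add: in_keys_iff)
    then have "g k \<noteq> [:poly_gen k:]" using klm(1) by (cases l) auto
    then show ?thesis ..
  qed
  moreover have "poly_subst poly_const g (component (lin_weight v) W Q) = [:component (lin_weight v) W Q:]"
  proof -
    have "top_part W [:Q:] = [:component (lin_weight v) W Q:]"
    proof (rule poly_eqI)
      fix l show "coeff (top_part W [:Q:]) l = coeff [:component (lin_weight v) W Q:] l"
        by (cases l) (simp_all add: coeff_top_part)
    qed
    moreover have "top_part W (poly_subst poly_const f Q) =
        poly_subst poly_const g (component (lin_weight v) W Q)"
      unfolding g_def by (rule top_part_poly_subst[OF bound W])
    ultimately show ?thesis using Q by simp
  qed
  ultimately show ?thesis using that unfolding nontrivial_family_def by blast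
qed

lemma constant_if_degree_0:
  assumes "degree F = 0" "coeff F 0 = a"
  shows "F = [:a:]"
  using assms by (metis degree_eq_zeroE coeff_pCons_0)

text \<open>The coefficients form a domain, so degrees in s add up. The product has degree 0, hence
  both factors do, and the value at s = 0 identifies the constant.\<close>

lemma invariant_factor:
  fixes f :: "2 \<Rightarrow> (2, 'k::field) polynomial_algebra poly"
  assumes f: "nontrivial_family f" and inv: "poly_subst poly_const f (q * r) = [:q * r:]" and nz: "q * r \<noteq> 0"
  shows "poly_subst poly_const f q = [:q:]"
proof -
  let ?e = "poly_subst poly_const f"
  have m: "?e q * ?e r = [:q * r:]"
    using inv by (simp add: ring_homoD[OF ring_homo_poly_subst[OF ring_homo_poly_const]])
  then have "?e q * ?e r \<noteq> 0" using nz by simp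
  then have "degree (?e q) + degree (?e r) = 0"
    using m by (metis degree_mult_eq degree_pCons_0 mult_zero_left mult_zero_right)
  then have "?e q = [:coeff (?e q) 0:]" by (intro constant_if_degree_0) simp_all
  also have "coeff (?e q) 0 = q"
    using f by (simp add: coeff_0_poly_subst nontrivial_family_def)
  finally show ?thesis .
qed

lemma invariant_gens:
  assumes "nontrivial_family f" "\<And>k. poly_subst poly_const f (poly_gen k) = [:poly_gen k:]"
  shows False
  using assms by (simp add: nontrivial_family_def poly_subst_gen[OF ring_homo_poly_const])

subsection \<open>Derivations\<close>

text \<open>For \<open>lookup m i = 0\<close> the truncated exponent is not the right one, but then
  the coefficient is 0.\<close>

definition pd :: "'n \<Rightarrow> ('n, 'k::field) polynomial_algebra \<Rightarrow> ('n, 'k) polynomial_algebra" where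
  "pd i z = (\<Sum>m\<in>keys z. single (m - single i 1) (of_nat (lookup m i) * lookup z m))"

lemma pd_add: "pd i (f + g) = pd i f + pd i g"
  unfolding pd_def by (rule setsum_keys_plus_distrib) (simp_all add: distrib_left single_add)

lemma pd_0 [simp]: "pd i 0 = 0"
  by (simp add: pd_def)

lemma pd_single: "pd i (single m c) = single (m - single i 1) (of_nat (lookup m i) * c)"
  by (cases "c = 0") (simp_all add: pd_def)

lemma pd_sum: "pd i (sum h A) = (\<Sum>a\<in>A. pd i (h a))"
  by (induction A rule: infinite_finite_induct) (simp_all add: pd_add)

lemma pd_mult: "pd i (f * g) = pd i f * g + f * pd i g"
proof (induction f rule: poly_mapping_additive_induct)
  case (single m a)
  show ?case
  proof (induction g rule: poly_mapping_additive_induct)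
    case (single n b)
    have *: "(m - single i 1) + n = m + n - single i (1::nat)" if "lookup m i \<noteq> 0" for m n :: "'a \<Rightarrow>\<^sub>0 nat"
      using that by (intro poly_mapping_eqI) (auto simp: lookup_add lookup_minus lookup_single when_def)
    have 1: "single (m - single i 1 + n) (of_nat (lookup m i) * a * b) =
        single (m + n - single i 1) (of_nat (lookup m i) * a * b)"
      using *[of m n] by (cases "lookup m i = 0") (simp_all only: of_nat_0 mult_zero_left single_zero simp_thms)
    have 2: "single (m + (n - single i 1)) (of_nat (lookup n i) * a * b) =
        single (m + n - single i 1) (of_nat (lookup n i) * a * b)"
      using *[of n m]
      by (cases "lookup n i = 0") (simp_all only: of_nat_0 mult_zero_left single_zero simp_thms add.commute[of m])
    have "pd i (single m a * single n b) =
        single (m + n - single i 1) (of_nat (lookup m i) * a * b) +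
        single (m + n - single i 1) (of_nat (lookup n i) * a * b)"
      by (simp only: mult_single pd_single lookup_add of_nat_add distrib_right mult.assoc single_add)
    also have "\<dots> = pd i (single m a) * single n b + single m a * pd i (single n b)"
      unfolding 1[symmetric] 2[symmetric] by (simp only: mult_single pd_single ac_simps)
    finally show ?case .
  qed (simp add: pd_add distrib_left add_ac)
qed (simp add: pd_add distrib_right add_ac)

lemma pd_gen: "pd i (poly_gen k) = (if k = i then 1 else 0)"
  by (auto simp: poly_gen_def pd_single lookup_single when_def)

lemma poly_gen_nonzero: "poly_gen k \<noteq> (0 :: ('n, 'k::field) polynomial_algebra)"
  using pd_gen[of k k, where 'b = 'k] by auto

abbreviation mpd :: "'n \<Rightarrow> ('n, 'k::field) polynomial_algebra poly \<Rightarrow> ('n, 'k) polynomial_algebra poly" where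
  "mpd i \<equiv> map_poly (pd i)"

lemma mpd_diff: "mpd i (F - G) = mpd i F - mpd i G"
proof -
  have "mpd i F = mpd i (F - G + G)" by simp
  also have "\<dots> = mpd i (F - G) + mpd i G" by (rule poly_eqI) (simp add: coeff_map_poly flip: pd_add)
  finally show ?thesis by simp
qed

lemma mpd_mult: "mpd i (F * G) = mpd i F * G + F * mpd i G"
  by (rule poly_eqI) (simp add: coeff_map_poly coeff_mult pd_sum pd_mult sum.distrib)

lemma mpd_power: "mpd i (F ^ Suc n) = of_nat (Suc n) * F ^ n * mpd i F"
proof (induction n)
  case (Suc n)
  show ?case by (subst power_Suc, subst mpd_mult, subst Suc.IH) (simp add: algebra_simps)
qed simp

lemma mpd_pCons_0: "mpd i [:a:] = [:pd i a:]"
  by (rule poly_eqI) (simp add: coeff_map_poly coeff_pCons split: nat.split)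

lemma pd_const: "pd i (single 0 c) = 0"
  by (simp add: pd_single)

lemma mpd_scalar: "mpd i (poly_const c * F) = poly_const c * mpd i F"
  by (simp only: mpd_mult mpd_pCons_0 pd_const) simp

lemma degree_mpd_le: "degree (mpd i F) \<le> degree F"
  by (rule degree_le) (simp add: coeff_map_poly coeff_eq_0)

lemma of_nat_poly_const: "of_nat n = (poly_const (of_nat n) :: ('m::comm_monoid_add \<Rightarrow>\<^sub>0 'k::field) poly)"
proof (induction n)
  case (Suc n)
  then show ?case by (simp add: ring_homoD[OF ring_homo_poly_const] one_pCons single_add)
qed simp

lemma single_eq_0_iff: "single k c = 0 \<longleftrightarrow> c = 0"
  by (metis lookup_single_eq lookup_zero single_zero)

text \<open>A Jacobian argument in the style of Mason and Stothers. Differentiating the equation and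
  eliminating one unknown shows that g^(a-1) times the Jacobian of (f, g) has degree at most deg f
  in s. The Jacobian is 1 at s = 0, hence nonzero, so (a - 1) deg g <= deg f. The equation itself
  gives b deg f = a deg g. If deg g > 0, these force a = b = 2, against coprimality.\<close>

lemma invariant_binomial_aux:
  fixes f g :: "(2, 'k::field) polynomial_algebra poly"
  assumes kl: "k \<noteq> l" and f0: "coeff f 0 = poly_gen k" and g0: "coeff g 0 = poly_gen l"
    and eq: "f ^ b - poly_const c * g ^ a = [:u:]" and c: "c \<noteq> 0"
    and ab: "a \<ge> 2" "b \<ge> 2" "coprime a b" and char: "of_nat a \<noteq> (0 :: 'k)"
  shows "f = [:poly_gen k:] \<and> g = [:poly_gen l:]"
proof -
  define B where "B = of_nat b * f ^ (b - 1)"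
  define G where "G = poly_const c * (of_nat a * g ^ (a - 1))"
  define j where "j = mpd k f * mpd l g - mpd l f * mpd k g"
  have E: "B * mpd i f - G * mpd i g = [:pd i u:]" for i
  proof -
    have "mpd i (f ^ b) = B * mpd i f" "mpd i (g ^ a) = of_nat a * g ^ (a - 1) * mpd i g"
      using ab mpd_power[of i f "b - 1"] mpd_power[of i g "a - 1"] by (simp_all add: B_def)
    then have "mpd i (f ^ b - poly_const c * g ^ a) = B * mpd i f - G * mpd i g"
      by (simp only: mpd_diff mpd_scalar G_def mult.assoc)
    then show ?thesis unfolding eq mpd_pCons_0 by (rule sym)
  qed
  \<comment> \<open>Cramer's rule for the two equations \<open>E\<close>: the terms with
    \<open>B\<close> cancel.\<close>
  have "G * j = (B * mpd k f - G * mpd k g) * mpd l f - (B * mpd l f - G * mpd l g) * mpd k f"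
    by (simp add: j_def algebra_simps)
  then have Gj: "G * j = [:pd k u:] * mpd l f - [:pd l u:] * mpd k f" by (simp only: E)
  have le: "degree (G * j) \<le> degree f"
    unfolding Gj using degree_mpd_le[of l f] degree_mpd_le[of k f]
    by (intro degree_diff_le) (auto intro: order.trans[OF degree_smult_le])
  have "coeff j 0 = 1"
    using kl by (simp add: j_def coeff_mult coeff_map_poly f0 g0 pd_gen)
  then have "j \<noteq> 0" by auto
  have g_nz: "g \<noteq> 0" and f_nz: "f \<noteq> 0" using f0 g0 poly_gen_nonzero by (metis coeff_0)+
  have "G = poly_const (c * of_nat a) * g ^ (a - 1)"
    by (simp only: G_def ring_homoD(3)[OF ring_homo_poly_const] of_nat_poly_const mult.assoc)
  moreover have "(poly_const (c * of_nat a) :: (2, 'k) polynomial_algebra poly) \<noteq> 0"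
    using c char by (simp add: single_eq_0_iff del: single_of_nat)
  ultimately have "degree (G * j) = (a - 1) * degree g + degree j"
    using \<open>j \<noteq> 0\<close> g_nz by (simp add: degree_mult_eq degree_power_eq)
  then have 1: "(a - 1) * degree g \<le> degree f" using le by simp
  have 2: "b * degree f = a * degree g"
  proof -
    have d: "degree (f ^ b) = b * degree f" "degree (poly_const c * g ^ a) = a * degree g"
      using f_nz g_nz c by (simp_all add: degree_power_eq single_eq_0_iff)
    have "degree (f ^ b) = degree ([:u:] + poly_const c * g ^ a)" by (simp flip: eq)
    moreover have "degree ([:u:] + poly_const c * g ^ a) \<le> degree (poly_const c * g ^ a)"
      by (intro degree_add_le) auto
    moreover have "degree (poly_const c * g ^ a) = degree (f ^ b - [:u:])" by (simp flip: eq)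
    moreover have "degree (f ^ b - [:u:]) \<le> degree (f ^ b)"
      by (intro degree_diff_le) auto
    ultimately show ?thesis using d by linarith
  qed
  have "degree g = 0"
  proof (rule ccontr)
    assume g: "degree g \<noteq> 0"
    have "b * ((a - 1) * degree g) \<le> a * degree g" using mult_le_mono2[OF 1, of b] 2 by simp
    then have "b * (a - 1) \<le> a" using g by (metis mult.assoc mult_le_cancel2 not_gr0)
    moreover have "2 * (a - 1) \<le> b * (a - 1)" using ab by simp
    ultimately have "a = 2" using ab by linarith
    with \<open>b * (a - 1) \<le> a\<close> ab have "b = 2" by simp
    then show False using ab \<open>a = 2\<close> by simp
  qed
  moreover have "degree f = 0" using 2 ab \<open>degree g = 0\<close> by simp
  ultimately show ?thesis using f0 g0 constant_if_degree_0 by blast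
qed

text \<open>The characteristic cannot divide both of two coprime exponents. If it divides a,
  dividing the equation by - c exchanges the roles of (f, b) and (g, a).\<close>

lemma invariant_binomial:
  fixes f g :: "(2, 'k::field) polynomial_algebra poly"
  assumes kl: "k \<noteq> l" and f0: "coeff f 0 = poly_gen k" and g0: "coeff g 0 = poly_gen l"
    and eq: "f ^ b - poly_const c * g ^ a = [:u:]" and c: "c \<noteq> 0"
    and ab: "a \<ge> 2" "b \<ge> 2" "coprime a b"
  shows "f = [:poly_gen k:] \<and> g = [:poly_gen l:]"
proof (cases "of_nat a = (0 :: 'k)")
  case False
  then show ?thesis using invariant_binomial_aux assms by blast
next
  case True
  have "of_nat b \<noteq> (0 :: 'k)"
  proof
    assume "of_nat b = (0 :: 'k)"
    then have "CHAR('k) dvd gcd a b" using True by (simp add: of_nat_eq_0_iff_char_dvd)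
    then show False using ab CHAR_not_1' by simp
  qed
  have cc: "poly_const (inverse c) * poly_const c = (1 :: (2, 'k) polynomial_algebra poly)"
    using c by (simp add: mult_single single_one one_pCons)
  have "g ^ a - poly_const (inverse c) * f ^ b = - (poly_const (inverse c) * (f ^ b - poly_const c * g ^ a))"
    using cc by (simp only: right_diff_distrib mult.assoc[symmetric]) simp
  also have "\<dots> = [:- (single 0 (inverse c) * u):]" unfolding eq by simp
  finally have eq': "g ^ a - poly_const (inverse c) * f ^ b = [:- (single 0 (inverse c) * u):]" .
  have "coprime b a" using ab by (simp add: coprime_commute)
  from invariant_binomial_aux[OF kl[symmetric] g0 f0 eq' _ ab(2,1) this \<open>of_nat b \<noteq> 0\<close>] c
  show ?thesis by simp
qed

subsection \<open>Initial forms along the Newton edge\<close>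

definition degv :: "'n \<Rightarrow> ('n, 'k::field) polynomial_algebra \<Rightarrow> nat" where
  "degv k z = Max (insert 0 ((\<lambda>m. lookup m k) ` keys z))"

lemma lookup_le_degv: "m \<in> keys z \<Longrightarrow> lookup m k \<le> degv k z"
  by (simp add: degv_def)

lemma degv_le_iff: "degv k z \<le> n \<longleftrightarrow> (\<forall>m\<in>keys z. lookup m k \<le> n)"
  by (simp add: degv_def)

lemma degv_attained:
  assumes "degv k z \<noteq> 0"
  shows "\<exists>m\<in>keys z. lookup m k = degv k z"
proof -
  have "degv k z \<in> insert 0 ((\<lambda>m. lookup m k) ` keys z)"
    unfolding degv_def by (rule Max_in) auto
  then show ?thesis using assms by auto
qed

lemma exponent_two:
  assumes "i \<noteq> (j::2)"
  shows "m = single i (lookup m i) + single j (lookup m j :: nat)"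
proof (rule poly_mapping_eqI)
  fix k show "lookup m k = lookup (single i (lookup m i) + single j (lookup m j)) k"
    using two_cases[OF assms, of k] assms by (auto simp: lookup_add lookup_single when_def)
qed

lemma single_two:
  "single (single i s + single j t) c = single 0 c * poly_gen i ^ s * poly_gen j ^ t"
  by (simp add: single_single[symmetric] mult_single)

lemma lin_weight_two:
  assumes "i \<noteq> (j::2)"
  shows "lin_weight v m = v i * real (lookup m i) + v j * real (lookup m j)"
  using assms by (simp add: lin_weight_def UNIV_two[OF assms])

lemma poly_gen_factor:
  assumes "\<And>m. m \<in> keys h \<Longrightarrow> lookup m i \<noteq> 0"
  shows "\<exists>r. h = poly_gen i * r"
proof -
  have "\<exists>r. (\<Sum>m\<in>A. single m (lookup h m)) = poly_gen i * r" if "finite A" "A \<subseteq> keys h" for A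
    using that
  proof (induction A rule: finite_induct)
    case empty
    show ?case by (intro exI[of _ 0]) simp
  next
    case (insert m A)
    then obtain r where r: "(\<Sum>m\<in>A. single m (lookup h m)) = poly_gen i * r" by auto
    have "lookup m i \<noteq> 0" using assms insert.prems by auto
    then have "single i 1 + (m - single i 1) = m"
      by (intro poly_mapping_eqI) (auto simp: lookup_add lookup_minus lookup_single when_def)
    then have "single m (lookup h m) = poly_gen i * single (m - single i 1) (lookup h m)"
      by (simp add: poly_gen_def mult_single del: One_nat_def)
    then have "(\<Sum>m\<in>insert m A. single m (lookup h m)) = poly_gen i * (single (m - single i 1) (lookup h m) + r)"
      using insert.hyps r by (simp add: distrib_left)
    then show ?case ..
  qed
  from this[of "keys h"] show ?thesis by (simp add: poly_mapping_sum_single)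
qed

section \<open>Binary forms and their linear factors\<close>

definition binary_form :: "nat \<Rightarrow> 'k::field poly \<Rightarrow> ('n, 'k) polynomial_algebra \<Rightarrow> ('n, 'k) polynomial_algebra \<Rightarrow>
    ('n, 'k) polynomial_algebra" where
  "binary_form n q u w = (\<Sum>t\<le>n. single 0 (coeff q t) * u ^ t * w ^ (n - t))"

lemma binary_form_mult:
  assumes "degree q \<le> n"
  shows "binary_form (Suc n) ([:- r, 1:] * q) u w = (u - single 0 r * w) * binary_form n q u w"
proof -
  have c: "coeff ([:- r, 1:] * q) t = (if t = 0 then 0 else coeff q (t - 1)) - r * coeff q t" for t
    by (cases t) simp_all
  have split: "single 0 (x - r * y) = single 0 x - single 0 r * (single 0 y :: ('n, 'a) polynomial_algebra)" for x y
    by (simp add: mult_single single_diff)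
  have "binary_form (Suc n) ([:- r, 1:] * q) u w =
      (\<Sum>t\<le>Suc n. single 0 (if t = 0 then 0 else coeff q (t - 1)) * u ^ t * w ^ (Suc n - t)) -
      (\<Sum>t\<le>Suc n. single 0 r * single 0 (coeff q t) * u ^ t * w ^ (Suc n - t))"
    unfolding binary_form_def c split by (simp only: left_diff_distrib sum_subtractf)
  also have "(\<Sum>t\<le>Suc n. single 0 (if t = 0 then 0 else coeff q (t - 1)) * u ^ t * w ^ (Suc n - t)) =
      u * binary_form n q u w"
    by (subst sum.atMost_Suc_shift) (simp add: binary_form_def sum_distrib_left ac_simps)
  also have "(\<Sum>t\<le>Suc n. single 0 r * single 0 (coeff q t) * u ^ t * w ^ (Suc n - t)) =
      (\<Sum>t\<le>n. single 0 r * single 0 (coeff q t) * u ^ t * w ^ (Suc n - t))"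
    using assms by (simp add: coeff_eq_0)
  also have "\<dots> = single 0 r * w * binary_form n q u w"
    unfolding binary_form_def sum_distrib_left
    by (rule sum.cong) (auto simp: Suc_diff_le ac_simps)
  finally show ?thesis by (simp add: left_diff_distrib)
qed

lemma binary_form_power:
  "binary_form n (smult c ([:- r, 1:] ^ n)) u w = single 0 c * (u - single 0 r * w) ^ n"
proof (induction n)
  case (Suc n)
  have *: "smult c ([:- r, 1:] ^ Suc n) = [:- r, 1:] * smult c ([:- r, 1:] ^ n)"
    by (simp only: power_Suc mult_smult_right)
  have "degree (smult c ([:- r, 1:] ^ n)) \<le> n"
    by (rule order.trans[OF degree_smult_le]) (rule order.trans[OF degree_power_le], simp)
  then show ?case
    unfolding * by (subst binary_form_mult) (simp_all only: Suc.IH power_Suc ac_simps)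
qed (simp add: binary_form_def)

context
  fixes i j :: 2 and Q :: "(2, 'k::field) polynomial_algebra"
  assumes ij: "i \<noteq> j"
begin

text \<open>With a and b the degrees in x_i and x_j, the weights are such that x_i^a and x_j^b both
  have weight ab. A top monomial on the x_i axis has weight at most ab, and a monomial of x_j-degree
  b has weight at least ab. So equality holds throughout, and both pure powers lie on the
  edge.\<close>

lemma newton_edge_endpoint:
  fixes v :: "2 \<Rightarrow> real"
  defines "v \<equiv> (\<lambda>k. if k = i then real (degv j Q) else real (degv i Q))"
  assumes pos: "degv i Q \<ge> 1" "degv j Q \<ge> 1"
    and W: "\<And>m. m \<in> keys Q \<Longrightarrow> lin_weight v m \<le> W"
    and pure: "m \<in> keys Q" "lin_weight v m = W" "lookup m j = 0"
  shows "W = real (degv i Q) * real (degv j Q)" "lookup m i = degv i Q"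
    "\<exists>m\<in>keys Q. lin_weight v m = W \<and> lookup m i = 0"
proof -
  define a b where "a = degv i Q" and "b = degv j Q"
  have w: "lin_weight v m = real b * real (lookup m i) + real a * real (lookup m j)" for m
    using ij by (simp add: lin_weight_two[OF ij] v_def a_def b_def)
  obtain m1 where m1: "m1 \<in> keys Q" "lookup m1 j = b"
    using degv_attained[of j Q] pos by (auto simp: b_def)
  have W_eq: "W = real b * real (lookup m i)" using pure(2,3) w[of m] by simp
  have "real (lookup m i) \<le> real a" using lookup_le_degv[OF pure(1), of i] by (simp add: a_def)
  then have Wle: "W \<le> real b * real a" unfolding W_eq by (intro mult_left_mono) auto
  have ge: "real b * real (lookup m1 i) + real a * real b \<le> W" using W[OF m1(1)] w[of m1] m1(2) by simp
  then have "real b * real (lookup m1 i) \<le> 0" using Wle by (simp add: mult.commute)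
  moreover have b: "real b > 0" using pos by (simp add: b_def)
  ultimately have "lookup m1 i = 0" by (simp add: mult_le_0_iff)
  then have Wab: "W = real b * real a" using ge Wle by (simp add: mult.commute)
  then show "W = real (degv i Q) * real (degv j Q)" by (simp add: a_def b_def)
  show "lookup m i = degv i Q" using W_eq Wab b by (simp add: a_def)
  show "\<exists>m\<in>keys Q. lin_weight v m = W \<and> lookup m i = 0"
    using m1 \<open>lookup m1 i = 0\<close> Wab w[of m1] by (intro bexI[of _ m1]) simp_all
qed

end

text \<open>If x_k divides the initial form, it is invariant by \<open>invariant_factor\<close>. A
  nontrivial family cannot fix both generators, so the edge meets an axis, and
  \<open>newton_edge_endpoint\<close> in one of the two orders supplies both pure powers.\<close>

lemma newton_edge_endpoints:
  fixes Q :: "(2, 'k::field) polynomial_algebra"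
  assumes ij: "i \<noteq> (j::2)" and f: "nontrivial_family f"
  defines "v \<equiv> (\<lambda>k. if k = i then real (degv j Q) else real (degv i Q))"
  assumes pos: "degv i Q \<ge> 1" "degv j Q \<ge> 1"
    and W: "\<And>m. m \<in> keys Q \<Longrightarrow> lin_weight v m \<le> W"
    and h: "component (lin_weight v) W Q \<noteq> 0"
      "poly_subst poly_const f (component (lin_weight v) W Q) = [:component (lin_weight v) W Q:]"
  shows "W = real (degv i Q) * real (degv j Q)"
    "\<exists>m\<in>keys Q. lin_weight v m = W \<and> lookup m i = degv i Q \<and> lookup m j = 0"
    "\<exists>m\<in>keys Q. lin_weight v m = W \<and> lookup m j = degv j Q \<and> lookup m i = 0"
proof -
  let ?h = "component (lin_weight v) W Q"
  have v': "v = (\<lambda>k. if k = j then real (degv i Q) else real (degv j Q))"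
  proof
    fix k show "v k = (if k = j then real (degv i Q) else real (degv j Q))"
      using two_cases[OF ij, of k] ij by (auto simp: v_def)
  qed
  note end_i = newton_edge_endpoint[OF ij pos W[unfolded v_def], folded v_def]
  note end_j = newton_edge_endpoint[OF ij[symmetric] pos(2,1) W[unfolded v'], folded v']
  have factor: "poly_subst poly_const f (poly_gen k) = [:poly_gen k:]"
    if "\<nexists>m. m \<in> keys Q \<and> lin_weight v m = W \<and> lookup m k = 0" for k
  proof -
    have "\<exists>r. ?h = poly_gen k * r"
      by (rule poly_gen_factor) (use that in \<open>auto simp: keys_component\<close>)
    then obtain r where "?h = poly_gen k * r" ..
    then show ?thesis using invariant_factor[OF f] h by metis
  qed
  have "\<exists>k. \<exists>m\<in>keys Q. lin_weight v m = W \<and> lookup m k = 0"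
    using factor invariant_gens[OF f] by blast
  then obtain k where k: "\<exists>m\<in>keys Q. lin_weight v m = W \<and> lookup m k = 0" by blast
  then have "(\<exists>m\<in>keys Q. lin_weight v m = W \<and> lookup m i = 0) \<and> (\<exists>m\<in>keys Q. lin_weight v m = W \<and> lookup m j = 0)"
    using two_cases[OF ij, of k] end_i(3) end_j(3) by metis
  then show "W = real (degv i Q) * real (degv j Q)"
    "\<exists>m\<in>keys Q. lin_weight v m = W \<and> lookup m i = degv i Q \<and> lookup m j = 0"
    "\<exists>m\<in>keys Q. lin_weight v m = W \<and> lookup m j = degv j Q \<and> lookup m i = 0"
    using end_i(1,2) end_j(2) by metis+
qed

text \<open>Every root r of q gives an invariant factor x_i^a - r x_j^b. Two distinct roots would
  make x_j^b and then both generators invariant, so q is a scalar multiple of (X - r)^n. A single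
  binomial is excluded by \<open>invariant_binomial\<close> unless an exponent is 1.\<close>

lemma invariant_binomial_form:
  fixes q :: "'k::alg_closed_field poly"
  assumes ij: "i \<noteq> (j::2)" and f: "nontrivial_family f" and ab: "a \<ge> 1" "b \<ge> 1" "coprime a b"
    and q: "degree q = n" "n \<ge> 1" "coeff q 0 \<noteq> 0"
    and h: "h = binary_form n q (poly_gen i ^ a) (poly_gen j ^ b)" "h \<noteq> 0" "poly_subst poly_const f h = [:h:]"
  shows "a = 1 \<or> b = 1"
    and "\<exists>c r. c \<noteq> 0 \<and> r \<noteq> 0 \<and> h = single 0 c * (poly_gen i ^ a - single 0 r * poly_gen j ^ b) ^ n"
proof -
  note hom = ring_homoD[OF ring_homo_poly_subst[OF ring_homo_poly_const]]
    poly_subst_const[OF ring_homo_poly_const] poly_subst_gen[OF ring_homo_poly_const]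
  have f0: "coeff (f k) 0 = poly_gen k" for k using f by (simp add: nontrivial_family_def)
  then have f_nz: "f k \<noteq> 0" for k by (metis coeff_0 poly_gen_nonzero)
  have trivial: False if "degree (f i) = 0" "degree (f j) = 0"
    using f two_cases[OF ij] that constant_if_degree_0[OF _ f0] unfolding nontrivial_family_def by metis
  have root: "r \<noteq> 0 \<and> f i ^ a - poly_const r * f j ^ b = [:poly_gen i ^ a - single 0 r * poly_gen j ^ b:]"
    if "poly q r = 0" for r
  proof
    show "r \<noteq> 0" using that q(3) by (auto simp: poly_0_coeff_0)
    have "[:- r, 1:] dvd q" using that by (simp only: poly_eq_0_iff_dvd)
    then obtain q' where q': "q = [:- r, 1:] * q'" by (rule dvdE)
    then have "q' \<noteq> 0" using q by auto
    then have "degree q = Suc (degree q')" unfolding q' by (subst degree_mult_eq) auto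
    then have "h = (poly_gen i ^ a - single 0 r * poly_gen j ^ b) * binary_form (degree q') q' (poly_gen i ^ a) (poly_gen j ^ b)"
      using q(1) binary_form_mult[of q' "degree q'" r] unfolding h(1) q' by simp
    then have "poly_subst poly_const f (poly_gen i ^ a - single 0 r * poly_gen j ^ b) =
        [:poly_gen i ^ a - single 0 r * poly_gen j ^ b:]"
      using invariant_factor[OF f] h(2,3) by metis
    then show "f i ^ a - poly_const r * f j ^ b = [:poly_gen i ^ a - single 0 r * poly_gen j ^ b:]"
      by (simp add: hom)
  qed
  have unique: "r = s" if "poly q r = 0" "poly q s = 0" for r s
  proof (rule ccontr)
    assume "r \<noteq> s"
    let ?x = "poly_gen i ^ a :: (2, 'k) polynomial_algebra" and ?y = "poly_gen j ^ b :: (2, 'k) polynomial_algebra"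
    \<comment> \<open>Subtracting the two invariant binomials isolates the power of f_j, so f_j is
      constant in s; either binomial then bounds the degree of f_i.\<close>
    have "poly_const (s - r) * f j ^ b = (f i ^ a - poly_const r * f j ^ b) - (f i ^ a - poly_const s * f j ^ b)"
      by (simp only: ring_homoD(5)[OF ring_homo_poly_const] left_diff_distrib) simp
    then have "poly_const (s - r) * f j ^ b = [:(?x - single 0 r * ?y) - (?x - single 0 s * ?y):]"
      by (simp only: root[OF that(1), THEN conjunct2] root[OF that(2), THEN conjunct2] diff_pCons diff_0_right)
    then have "degree (poly_const (s - r) * f j ^ b) = 0" by simp
    then have "degree (f j) = 0"
      using \<open>r \<noteq> s\<close> f_nz[of j] ab by (simp add: single_eq_0_iff degree_power_eq)
    moreover have "f i ^ a = [:?x - single 0 r * ?y:] + poly_const r * f j ^ b"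
      using root[OF that(1)] by (metis diff_add_cancel)
    then have "degree (f i ^ a) \<le> max 0 (degree (poly_const r * f j ^ b))"
      by (metis degree_add_le_max degree_pCons_0)
    then have "degree (f i ^ a) \<le> degree (f j ^ b)"
      using degree_smult_le[of "single 0 r" "f j ^ b"] by simp
    then have "a * degree (f i) \<le> b * degree (f j)" using f_nz by (simp add: degree_power_eq)
    ultimately show False using trivial ab by simp
  qed
  have q_nz: "q \<noteq> 0" using q by auto
  obtain R where R: "size R = degree q" "q = smult (lead_coeff q) (\<Prod>x\<in>#R. [:- x, 1:])"
    using alg_closed_imp_factorization[OF q_nz] by blast
  have "R \<noteq> {#}" using R(1) q by auto
  then obtain r where r: "r \<in># R" by blast
  have roots: "poly q s = 0" if "s \<in># R" for s
  proof -
    obtain R' where "R = add_mset s R'" using multi_member_split[OF \<open>s \<in># R\<close>] by blast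
    then have "[:- s, 1:] dvd (\<Prod>x\<in>#R. [:- x, 1:])"
      by (simp only: image_mset_add_mset prod_mset.add_mset dvd_triv_left)
    then have "[:- s, 1:] dvd q" by (subst R(2)) (rule dvd_smult)
    then show ?thesis by (simp only: poly_eq_0_iff_dvd)
  qed
  have "set_mset R \<subseteq> {r}" using roots unique r by blast
  then have "R = replicate_mset n r" using R(1) q(1) set_mset_subset_singletonD by metis
  then have "q = smult (lead_coeff q) ([:- r, 1:] ^ n)" using R(2) by simp
  then have "h = single 0 (lead_coeff q) * (poly_gen i ^ a - single 0 r * poly_gen j ^ b) ^ n"
    unfolding h(1) by (metis binary_form_power)
  moreover have "lead_coeff q \<noteq> 0" "r \<noteq> 0" using q_nz root[OF roots[OF r]] by auto
  ultimately show "\<exists>c r. c \<noteq> 0 \<and> r \<noteq> 0 \<and> h = single 0 c * (poly_gen i ^ a - single 0 r * poly_gen j ^ b) ^ n"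
    by blast
  show "a = 1 \<or> b = 1"
  proof (rule ccontr)
    assume "\<not> (a = 1 \<or> b = 1)"
    then have "a \<ge> 2" "b \<ge> 2" using ab by auto
    moreover have "coprime b a" using ab by (simp add: coprime_commute)
    ultimately have "f i = [:poly_gen i:] \<and> f j = [:poly_gen j:]"
      using invariant_binomial[OF ij f0 f0 root[OF roots[OF r], THEN conjunct2]] \<open>r \<noteq> 0\<close> by blast
    then show False using trivial by simp
  qed
qed

text \<open>The lattice points between x_i^a and x_j^b are spaced by (a/d, b/d) with d = gcd(a, b),
  so the initial form is a binary form in x_i^(a/d) and x_j^(b/d). By
  \<open>invariant_binomial_form\<close> one of these exponents is 1, that is, one degree divides
  the other; this decides which generator becomes x_k.\<close>

lemma newton_edge:
  fixes Q :: "(2, 'k::alg_closed_field) polynomial_algebra"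
  assumes f: "nontrivial_family f" and Q: "poly_subst poly_const f Q = [:Q:]"
    and ij: "i \<noteq> (j::2)" and pos: "degv i Q \<ge> 1" "degv j Q \<ge> 1"
  obtains k l n c r where "k \<noteq> l" "n \<ge> 1" "c \<noteq> 0" "degv l Q = n * degv k Q"
    "\<And>m. m \<in> keys Q \<Longrightarrow> n * lookup m k + lookup m l \<le> degv l Q"
    "component (lin_weight (\<lambda>s. if s = k then real n else 1)) (real (degv l Q)) Q =
       single 0 c * (poly_gen k - single 0 r * poly_gen l ^ n) ^ degv k Q"
proof -
  define a b where "a = degv i Q" and "b = degv j Q"
  define v where "v = (\<lambda>k. if k = i then real b else real a)"
  have w: "lin_weight v m = real (b * lookup m i + a * lookup m j)" for m
    using ij by (simp add: lin_weight_two[OF ij] v_def)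
  define W where "W = Max (lin_weight v ` keys Q)"
  have "keys Q \<noteq> {}" using pos by (auto simp: degv_def)
  have W: "lin_weight v m \<le> W" if "m \<in> keys Q" for m
    using that by (simp add: W_def)
  have "W \<in> lin_weight v ` keys Q" unfolding W_def using \<open>keys Q \<noteq> {}\<close> by (intro Max_in) auto
  define h where "h = component (lin_weight v) W Q"
  have keys_h: "keys h = {m \<in> keys Q. lin_weight v m = W}" by (simp add: h_def keys_component)
  with \<open>W \<in> lin_weight v ` keys Q\<close> have "keys h \<noteq> {}" by auto
  then have "h \<noteq> 0" by auto
  obtain g where g: "nontrivial_family g" "poly_subst poly_const g h = [:h:]"
    using initial_form_invariant[OF f Q W] unfolding h_def by blast
  note ends = newton_edge_endpoints[OF ij g(1) pos, folded a_def b_def, folded v_def, OF W,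
      unfolded h_def[symmetric], OF _ \<open>h \<noteq> 0\<close> g(2), simplified]
  have Wab: "W = real (a * b)" using ends(1) by simp
  define d where "d = gcd a b"
  define a' b' where "a' = a div d" and "b' = b div d"
  have ab: "a = d * a'" "b = d * b'" by (simp_all add: a'_def b'_def d_def)
  have cop: "coprime a' b'"
    unfolding a'_def b'_def d_def using pos by (intro div_gcd_coprime) (auto simp: a_def)
  have ge: "d \<ge> 1" "a' \<ge> 1" "b' \<ge> 1" using pos ab by (auto simp: a_def[symmetric] b_def[symmetric] Suc_le_eq)
  \<comment> \<open>The lattice points of the edge, from x_j^b at t = 0 to x_i^a at t = d.\<close>
  define E where "E t = single i (a' * t) + single j (b' * (d - t))" for t
  have E: "lookup (E t) i = a' * t" "lookup (E t) j = b' * (d - t)" for t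
    using ij by (simp_all add: E_def lookup_add lookup_single)
  have "inj_on E {..d}"
  proof (rule inj_onI)
    fix s t assume "E s = E t"
    then have "a' * s = a' * t" using E(1) by metis
    then show "s = t" using ge by simp
  qed
  have sub: "keys h \<subseteq> E ` {..d}"
  proof
    fix m assume "m \<in> keys h"
    then have "real (b * lookup m i + a * lookup m j) = real (a * b)" using keys_h w Wab by simp
    then have "b * lookup m i + a * lookup m j = a * b" by (simp only: of_nat_eq_iff)
    then have "d * (b' * lookup m i + a' * lookup m j) = d * (a' * (b' * d))"
      by (simp add: ab algebra_simps)
    then have eq: "b' * lookup m i + a' * lookup m j = a' * (b' * d)" using ge by simp
    then have "a' dvd b' * lookup m i" by (metis dvd_triv_left dvd_add_left_iff)
    then have "a' dvd lookup m i" using cop by (simp add: coprime_dvd_mult_right_iff)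
    then obtain t where t: "lookup m i = a' * t" by (rule dvdE)
    then have "a' * (b' * t + lookup m j) = a' * (b' * d)" using eq by (simp add: algebra_simps)
    then have bt: "b' * t + lookup m j = b' * d" using ge by simp
    then have "b' * t \<le> b' * d" by linarith
    then have "t \<le> d" using ge by simp
    moreover have "lookup m j = b' * (d - t)" using bt by (simp add: diff_mult_distrib2)
    then have "m = E t" using exponent_two[OF ij, of m] t by (simp add: E_def)
    ultimately show "m \<in> E ` {..d}" by auto
  qed
  define q where "q = (\<Sum>t\<le>d. monom (lookup h (E t)) t)"
  have coeff_q: "coeff q t = (if t \<le> d then lookup h (E t) else 0)" for t
    by (simp add: q_def coeff_sum)
  have "E d = m" if "lookup m i = a" "lookup m j = 0" for m
    using exponent_two[OF ij, of m] that by (simp add: E_def ab mult.commute)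
  then have "E d \<in> keys h" using ends(2) keys_h by auto
  then have "coeff q d \<noteq> 0" by (simp add: coeff_q in_keys_iff)
  have "E 0 = m" if "lookup m j = b" "lookup m i = 0" for m
    using exponent_two[OF ij, of m] that by (simp add: E_def ab mult.commute)
  then have "E 0 \<in> keys h" using ends(3) keys_h by auto
  then have "coeff q 0 \<noteq> 0" by (simp add: coeff_q in_keys_iff)
  have "degree q \<le> d" by (rule degree_le) (simp add: coeff_q)
  moreover have "d \<le> degree q" using \<open>coeff q d \<noteq> 0\<close> by (rule le_degree)
  ultimately have "degree q = d" by simp
  have "h = (\<Sum>m\<in>keys h. single m (lookup h m))" by (simp add: poly_mapping_sum_single)
  also have "\<dots> = (\<Sum>m\<in>E ` {..d}. single m (lookup h m))"
    using sub by (intro sum.mono_neutral_left) (auto simp: in_keys_iff)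
  also have "\<dots> = (\<Sum>t\<le>d. single (E t) (lookup h (E t)))"
    using \<open>inj_on E {..d}\<close> by (simp add: sum.reindex)
  also have "\<dots> = binary_form d q (poly_gen i ^ a') (poly_gen j ^ b')"
    unfolding binary_form_def
    by (intro sum.cong refl) (simp add: E_def single_two coeff_q power_mult)
  finally have h: "h = binary_form d q (poly_gen i ^ a') (poly_gen j ^ b')" .
  note form = invariant_binomial_form[OF ij g(1) ge(2,3) cop \<open>degree q = d\<close> ge(1) \<open>coeff q 0 \<noteq> 0\<close> h \<open>h \<noteq> 0\<close> g(2)]
  from form(2) obtain c r where cr: "c \<noteq> 0" "r \<noteq> 0"
    "h = single 0 c * (poly_gen i ^ a' - single 0 r * poly_gen j ^ b') ^ d" by blast
  have bound: "b * lookup m i + a * lookup m j \<le> a * b" if "m \<in> keys Q" for m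
  proof -
    have "real (b * lookup m i + a * lookup m j) \<le> real (a * b)" using W[OF that] unfolding w Wab .
    then show ?thesis by (simp only: of_nat_le_iff)
  qed
  \<comment> \<open>The conclusion uses the weights (n, 1), which are v divided by d. Scaling does
    not change which monomials are on the edge.\<close>
  have rescale: "component (lin_weight v') (real e) Q = h"
    if "real (s * e) = W" "s \<ge> 1" "\<And>m. lin_weight v m = real s * lin_weight v' m" for v' :: "2 \<Rightarrow> real" and s e :: nat
  proof (rule poly_mapping_eqI)
    fix m
    have "lin_weight v' m = real e \<longleftrightarrow> lin_weight v m = W" using that by (simp flip: that(1))
    then show "lookup (component (lin_weight v') (real e) Q) m = lookup h m"
      by (simp add: h_def lookup_component)
  qed
  from form(1) show ?thesis
  proof
    assume "a' = 1"
    then have da: "d = a" using ab(1) by simp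
    have bb: "b = b' * a" using ab(2) unfolding da by (simp only: mult.commute)
    show ?thesis
    proof (rule that[OF ij ge(3) cr(1)])
      show "degv j Q = b' * degv i Q" using bb by (simp only: a_def b_def)
      show "b' * lookup m i + lookup m j \<le> degv j Q" if "m \<in> keys Q" for m
      proof -
        have "a * (b' * lookup m i + lookup m j) = b * lookup m i + a * lookup m j"
          unfolding bb by (simp add: algebra_simps)
        then have "a * (b' * lookup m i + lookup m j) \<le> a * b" using bound[OF that] by simp
        then show ?thesis using pos by (simp add: a_def[symmetric] b_def[symmetric])
      qed
      have "component (lin_weight (\<lambda>s. if s = i then real b' else 1)) (real b) Q = h"
      proof (rule rescale[of a])
        show "lin_weight v m = real a * lin_weight (\<lambda>s. if s = i then real b' else 1) m" for m
          using ij unfolding w bb by (simp add: lin_weight_two[OF ij] algebra_simps)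
      qed (use Wab pos in \<open>simp_all add: a_def\<close>)
      then show "component (lin_weight (\<lambda>s. if s = i then real b' else 1)) (real (degv j Q)) Q =
          single 0 c * (poly_gen i - single 0 r * poly_gen j ^ b') ^ degv i Q"
        using cr(3) \<open>a' = 1\<close> by (simp add: da a_def b_def)
    qed
  next
    assume "b' = 1"
    then have db: "d = b" using ab(2) by simp
    have aa: "a = a' * b" using ab(1) unfolding db by (simp only: mult.commute)
    \<comment> \<open>Here the binomial is solved for x_j: x_i^a' - r x_j = - r (x_j - x_i^a' / r).
      The d-th power then puts (- r)^d into the leading constant.\<close>
    have "single 0 (- r) * single 0 (inverse r) = (- 1 :: (2, 'k) polynomial_algebra)"
      using cr(2) by (simp add: mult_single single_uminus)
    then have "poly_gen i ^ a' - single 0 r * poly_gen j =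
        single 0 (- r) * (poly_gen j - single 0 (inverse r) * poly_gen i ^ a')"
      by (simp add: right_diff_distrib mult.assoc[symmetric] single_uminus)
    then have h': "h = single 0 (c * (- r) ^ d) * (poly_gen j - single 0 (inverse r) * poly_gen i ^ a') ^ d"
      using cr(3) \<open>b' = 1\<close>
      by (simp add: power_mult_distrib ring_homoD(3,7)[OF ring_homo_const] mult.assoc)
    show ?thesis
    proof (rule that[OF ij[symmetric] ge(2)])
      show "c * (- r) ^ d \<noteq> 0" using cr by simp
      show "degv i Q = a' * degv j Q" using aa by (simp only: a_def b_def)
      show "a' * lookup m j + lookup m i \<le> degv i Q" if "m \<in> keys Q" for m
      proof -
        have "b * (a' * lookup m j + lookup m i) = b * lookup m i + a * lookup m j"
          unfolding aa by (simp add: algebra_simps)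
        then have "b * (a' * lookup m j + lookup m i) \<le> b * a" using bound[OF that] by (simp add: mult.commute)
        then show ?thesis using pos by (simp add: a_def[symmetric] b_def[symmetric])
      qed
      have "component (lin_weight (\<lambda>s. if s = j then real a' else 1)) (real a) Q = h"
      proof (rule rescale[of b])
        show "lin_weight v m = real b * lin_weight (\<lambda>s. if s = j then real a' else 1) m" for m
          using ij unfolding w aa by (simp add: lin_weight_two[OF ij] algebra_simps)
      qed (use Wab pos in \<open>simp_all add: b_def\<close>)
      then show "component (lin_weight (\<lambda>s. if s = j then real a' else 1)) (real (degv i Q)) Q =
          single 0 (c * (- r) ^ d) * (poly_gen j - single 0 (inverse r) * poly_gen i ^ a') ^ degv j Q"
        using h' by (simp add: db a_def b_def)
    qed
  qed
qed

lemma poly_subst_pCons: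
  "poly_subst poly_const (\<lambda>s. [:p s:]) z = [:psubst p z:]"
  by (rule poly_hom_eqI[of _ "\<lambda>z. [:psubst p z:]"])
    (simp_all add: ring_homo_poly_const ring_homo_poly_subst poly_subst_const poly_subst_gen
      ring_homo_const ring_homo_comp[OF ring_homo_pCons])

text \<open>The substitution is homogeneous for the weights n of x_k and 1 of x_l, so the weight
  bound N = degv l Q survives and the initial form turns into c x_k^d with d = degv k Q. The bound
  keeps the x_k-degree from growing. The only monomial within it of x_l-degree N is x_l^N, which is
  no longer present.\<close>

lemma elementary_descent:
  fixes Q :: "(2, 'k::field) polynomial_algebra"
  assumes kl: "k \<noteq> (l::2)" and n: "n \<ge> 1" and pos: "degv k Q \<ge> 1" and deg: "degv l Q = n * degv k Q"
    and bound: "\<And>m. m \<in> keys Q \<Longrightarrow> n * lookup m k + lookup m l \<le> degv l Q"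
    and form: "component (lin_weight (\<lambda>s. if s = k then real n else 1)) (real (degv l Q)) Q =
       single 0 c * (poly_gen k - single 0 r * poly_gen l ^ n) ^ degv k Q"
  defines "p \<equiv> (\<lambda>s. if s = k then poly_gen k + single 0 r * poly_gen l ^ n else poly_gen s)"
  shows "degv k (psubst p Q) \<le> degv k Q" "degv l (psubst p Q) < degv l Q"
proof -
  let ?v = "\<lambda>s. if s = k then real n else 1"
  define N where "N = degv l Q"
  \<comment> \<open>No parameter s occurs here; the substitution is treated as a family constant in
    s, whose weight is then immaterial.\<close>
  interpret weight "lin_weight ?v" 0 by unfold_locales (rule lin_weight_add)
  have w: "lin_weight ?v m = real (n * lookup m k + lookup m l)" for m
    using kl by (simp add: lin_weight_two[OF kl])
  have monomial: "single 0 r * poly_gen l ^ n = single (single l n) r" by (simp add: single_single[symmetric] mult_single)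
  have keys_p: "lin_weight ?v m = ?v s" if "m \<in> keys (p s)" for m s
  proof -
    have "m \<in> keys (poly_gen k + single (single l n) r :: (2, 'k) polynomial_algebra) \<Longrightarrow> m = single k 1 \<or> m = single l n"
      using Poly_Mapping.keys_add[of "poly_gen k" "single (single l n) r :: (2, 'k) polynomial_algebra"]
      by (auto simp: poly_gen_def split: if_splits)
    then show ?thesis
      using that kl two_cases[OF kl, of s] unfolding p_def monomial
      by (auto simp: lin_weight_single poly_gen_def split: if_splits)
  qed
  have coeff: "coeff [:z:] t = (if t = 0 then z else 0)" for z :: "(2, 'k) polynomial_algebra" and t
    by (cases t) simp_all
  have le: "weight_le (?v s) [:p s:]" for s
    using keys_p by (auto simp: weight_le_def coeff split: if_splits)
  have top: "top_part (?v s) [:p s:] = [:p s:]" for s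
  proof (rule poly_eqI)
    have "component (lin_weight ?v) (?v s) (p s) = p s"
    proof (rule poly_mapping_eqI)
      fix m show "lookup (component (lin_weight ?v) (?v s) (p s)) m = lookup (p s) m"
        using keys_p[of m s] unfolding lookup_component by (metis in_keys_iff)
    qed
    then show "coeff (top_part (?v s) [:p s:]) t = coeff [:p s:] t" for t
      by (simp add: coeff_top_part coeff)
  qed
  have Qw: "lin_weight ?v m \<le> real N" if "m \<in> keys Q" for m
    using bound[OF that] unfolding w N_def of_nat_le_iff .
  have "weight_le (real N) [:psubst p Q:]"
    using weight_le_poly_subst[OF le Qw] by (simp add: poly_subst_pCons)
  then have bound': "n * lookup m k + lookup m l \<le> N" if "m \<in> keys (psubst p Q)" for m
  proof -
    have "lin_weight ?v m \<le> real N"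
      using \<open>weight_le (real N) [:psubst p Q:]\<close> that unfolding weight_le_def by (auto dest: spec[of _ 0])
    then show ?thesis unfolding w of_nat_le_iff .
  qed
  have "top_part (real N) [:psubst p Q:] = [:psubst p (component (lin_weight ?v) (real N) Q):]"
    using top_part_poly_subst[OF le Qw] by (simp add: poly_subst_pCons top)
  then have "component (lin_weight ?v) (real N) (psubst p Q) = psubst p (component (lin_weight ?v) (real N) Q)"
    using coeff_top_part[of "real N" "[:psubst p Q:]" 0] by simp
  also have "\<dots> = single 0 c * poly_gen k ^ degv k Q"
    using kl unfolding form[folded N_def]
    by (simp add: ring_homoD[OF ring_homo_poly_subst[OF ring_homo_const]] psubst_gen
        poly_subst_const[OF ring_homo_const] p_def)
  also have "\<dots> = single (single k (degv k Q)) c" by (simp add: single_single[symmetric] mult_single)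
  finally have comp: "component (lin_weight ?v) (real N) (psubst p Q) = single (single k (degv k Q)) c" .
  have N: "N = n * degv k Q" using deg by (simp add: N_def)
  show "degv k (psubst p Q) \<le> degv k Q"
    unfolding degv_le_iff
  proof
    fix m assume "m \<in> keys (psubst p Q)"
    then have "n * lookup m k \<le> n * degv k Q" using bound'[of m] N by linarith
    then show "lookup m k \<le> degv k Q" using n by simp
  qed
  have "lookup m l < N" if m: "m \<in> keys (psubst p Q)" for m
  proof (rule ccontr)
    assume "\<not> lookup m l < N"
    then have *: "lookup m l = N" "n * lookup m k + lookup m l = N" using bound'[OF m] by auto
    then have "m \<in> keys (component (lin_weight ?v) (real N) (psubst p Q))"
      using m w[of m] by (simp add: keys_component)
    then have "m = single k (degv k Q)" unfolding comp by (auto split: if_splits)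
    then have "lookup m l = 0" using kl by (simp add: lookup_single)
    then show False using * N n pos by simp
  qed
  then have "degv l (psubst p Q) \<le> N - 1" unfolding degv_le_iff by fastforce
  moreover have "N > 0" using N n pos by simp
  ultimately show "degv l (psubst p Q) < degv l Q"
    unfolding N_def[symmetric] by linarith
qed

section \<open>Lifting automorphisms\<close>

definition liftable :: "(('n, 'k::field) polynomial_algebra \<Rightarrow> ('n, 'k) polynomial_algebra) \<Rightarrow> bool" where
  "liftable \<beta> \<longleftrightarrow> (\<exists>B. algebra_automorphism B \<and> (\<forall>f. abelianize (B f) = \<beta> (abelianize f)))"

lemma ring_homo_abelianize: "ring_homo abelianize"
  by (simp add: ring_homo_def abelianize_add abelianize_mult)

lemma abelianize_free_subst:
  fixes p :: "'n::finite \<Rightarrow> ('n, 'k::field) polynomial_algebra"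
  assumes "\<And>s. abelianize (P s) = p s"
  shows "abelianize (free_subst P f) = psubst p (abelianize f)"
  by (rule free_hom_eqI[of "\<lambda>f. abelianize (free_subst P f)" "\<lambda>f. psubst p (abelianize f)"])
    (simp_all add: ring_homo_comp ring_homo_abelianize ring_homo_free_subst ring_homo_poly_subst ring_homo_const
      poly_subst_const psubst_gen abelianize_free_gen assms)

lemma lift_automorphism:
  fixes p q :: "'n::finite \<Rightarrow> ('n, 'k::field) polynomial_algebra"
  assumes P: "\<And>s. abelianize (P s) = p s" and Q: "\<And>s. abelianize (Q s) = q s"
    and PQ: "\<And>s. free_subst P (Q s) = free_gen s" and QP: "\<And>s. free_subst Q (P s) = free_gen s"
  shows "algebra_automorphism (psubst p)" "liftable (psubst p)"
proof -
  note P' = abelianize_free_subst[of P p, OF P] and Q' = abelianize_free_subst[of Q q, OF Q]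
  have "algebra_automorphism (free_subst P)" by (rule free_automorphismI[OF PQ QP])
  then show "liftable (psubst p)"
    unfolding liftable_def using P' by blast
  show "algebra_automorphism (psubst p)"
  proof (rule poly_automorphismI)
    show "psubst p (q s) = poly_gen s" "psubst q (p s) = poly_gen s" for s
      using P'[of "Q s"] Q'[of "P s"] by (simp_all add: P Q PQ QP abelianize_free_gen)
  qed
qed

text \<open>Reduction steps compose \<theta> on the left of \<beta>; a lift of \<theta> can be
  inverted and removed from a lift of the composite.\<close>

lemma liftable_cancel:
  assumes \<theta>: "algebra_automorphism \<theta>" "liftable \<theta>" and "liftable (\<lambda>z. \<theta> (\<beta> z))"
  shows "liftable \<beta>"
proof -
  obtain T C where T: "algebra_automorphism T" "\<And>f. abelianize (T f) = \<theta> (abelianize f)"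
    and C: "algebra_automorphism C" "\<And>f. abelianize (C f) = \<theta> (\<beta> (abelianize f))"
    using assms unfolding liftable_def by blast
  have "\<theta> (abelianize (inv T (C f))) = \<theta> (\<beta> (abelianize f))" for f
    by (metis T(2) C(2) algebra_automorphismD(2)[OF T(1)])
  then have "abelianize (inv T (C f)) = \<beta> (abelianize f)" for f
    by (metis algebra_automorphismD(3)[OF \<theta>(1)])
  then show ?thesis
    unfolding liftable_def
    using algebra_automorphism_comp[OF algebra_automorphism_inv[OF T(1)] C(1)] by blast
qed

subsection \<open>Univariate polynomials evaluated in algebras\<close>

text \<open>A polynomial in one element makes sense in a noncommutative algebra as well, so the same
  formula defines an elementary automorphism of the polynomial algebra and its lift.\<close>

definition aeval :: "'k::field poly \<Rightarrow> ('m::monoid_add \<Rightarrow>\<^sub>0 'k) \<Rightarrow> ('m \<Rightarrow>\<^sub>0 'k)" where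
  "aeval t z = fold_coeffs (\<lambda>a b. single 0 a + z * b) t 0"

lemma aeval_0 [simp]: "aeval 0 z = 0"
  by (simp add: aeval_def)

lemma aeval_pCons [simp]: "aeval (pCons a t) z = single 0 a + z * aeval t z"
  by (cases "a = 0 \<and> t = 0") (auto simp: aeval_def)

lemma aeval_add: "aeval (s + t) z = aeval s z + aeval t z"
  by (induction s t rule: poly_induct2) (simp_all add: single_add distrib_left add_ac)

lemma aeval_monom: "aeval (monom c n) z = single 0 c * z ^ n"
proof (induction n)
  case (Suc n)
  have "z * (single 0 c * z ^ n) = single 0 c * (z * z ^ n)"
    by (metis mult.assoc const_commutes)
  then show ?case using Suc by (simp add: monom_Suc)
qed (simp add: monom_0)

lemma algebra_hom_aeval:
  assumes "algebra_hom alg_scale alg_scale \<phi>"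
  shows "\<phi> (aeval t z) = aeval t (\<phi> z)"
  by (induction t)
    (simp_all add: algebra_hom_const[OF assms] ring_homoD[OF algebra_hom_ring_homo[OF assms]])

lemma psubst_aeval:
  fixes z :: "(2, 'k::field) polynomial_algebra"
  assumes "i \<noteq> (j::2)"
  shows "\<exists>t. psubst (\<lambda>s. if s = i then 0 else poly_gen s) z = aeval t (poly_gen j :: (2, 'k) polynomial_algebra)"
proof (induction z rule: poly_mapping_additive_induct)
  case (single m c)
  have "psubst (\<lambda>s. if s = i then 0 else poly_gen s) (single m c) =
      single 0 c * (0 ^ lookup m i * (poly_gen j :: (2, 'k) polynomial_algebra) ^ lookup m j)"
    using assms by (simp add: poly_subst_single[OF ring_homo_const] UNIV_two[OF assms])
  also have "\<dots> = aeval (monom (c * 0 ^ lookup m i) (lookup m j)) (poly_gen j)"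
    by (cases "lookup m i = 0") (simp_all add: aeval_monom power_0_left)
  finally show ?case ..
next
  case (add p q)
  then obtain s t where "psubst (\<lambda>s. if s = i then 0 else poly_gen s) p = aeval s (poly_gen j :: (2, 'k) polynomial_algebra)"
    "psubst (\<lambda>s. if s = i then 0 else poly_gen s) q = aeval t (poly_gen j :: (2, 'k) polynomial_algebra)"
    by blast
  then show ?case
    by (intro exI[of _ "s + t"]) (simp add: aeval_add ring_homoD(1)[OF ring_homo_poly_subst[OF ring_homo_const]])
qed

lemma univariate_if_degv_0:
  fixes z :: "(2, 'k::field) polynomial_algebra"
  assumes ij: "i \<noteq> (j::2)" and "degv i z = 0"
  shows "\<exists>t. z = aeval t (poly_gen j)"
proof -
  have "lookup m i = 0" if "m \<in> keys z" for m using lookup_le_degv[OF that, of i] assms by simp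
  then have "single 0 (lookup z m) * (\<Prod>s\<in>UNIV. (if s = i then 0 else poly_gen s) ^ lookup m s) = single m (lookup z m)"
    if "m \<in> keys z" for m
    using that ij exponent_two[OF ij, of m] single_two[of i 0 j "lookup m j" "lookup z m"]
    by (simp add: UNIV_two[OF ij])
  then have "psubst (\<lambda>s. if s = i then 0 else poly_gen s) z = (\<Sum>m\<in>keys z. single m (lookup z m))"
    unfolding poly_subst_def by (intro sum.cong) auto
  then show ?thesis using psubst_aeval[OF ij, of z] by (simp add: poly_mapping_sum_single)
qed

text \<open>The added term involves x_l only, and x_l is fixed. So x_k -> (x_k - t(x_l)) / c is an
  inverse in the free algebra too, whatever the order of multiplication.\<close>

lemma elementary_automorphism:
  fixes t :: "'k::field poly"
  assumes kl: "k \<noteq> (l::2)" and c: "c \<noteq> 0"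
  defines "p \<equiv> (\<lambda>s. if s = k then single 0 c * poly_gen k + aeval t (poly_gen l) else poly_gen s)"
  shows "algebra_automorphism (psubst p)" "liftable (psubst p)"
proof -
  define P Q where
    "P s = (if s = k then single 0 c * free_gen k + aeval t (free_gen l) else free_gen s)" and
    "Q s = (if s = k then single 0 (inverse c) * (free_gen k - aeval t (free_gen l)) else free_gen s)" for s
  have cc: "single 0 c * (single 0 (inverse c) * f) = f" "single 0 (inverse c) * (single 0 c * f) = f"
    for f :: "(2, 'k) free_algebra"
    using c by (simp_all add: mult.assoc[symmetric] mult_single)
  have hom: "algebra_hom alg_scale alg_scale abelianize" by (rule abelianize_hom)
  have "abelianize (P s) = p s" for s
    by (simp add: P_def p_def abelianize_add abelianize_mult abelianize_free_gen algebra_hom_aeval[OF hom])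
  moreover have "free_subst P (Q s) = free_gen s" for s
    using kl
    by (simp add: Q_def ring_homoD[OF ring_homo_free_subst] algebra_hom_aeval[OF algebra_hom_free_subst])
      (simp add: P_def cc)
  moreover have "free_subst Q (P s) = free_gen s" for s
    using kl
    by (simp add: P_def ring_homoD[OF ring_homo_free_subst] algebra_hom_aeval[OF algebra_hom_free_subst])
      (simp add: Q_def cc)
  ultimately show "algebra_automorphism (psubst p)" "liftable (psubst p)"
    using lift_automorphism[of P p Q "\<lambda>s. abelianize (Q s)"] by blast+
qed

lemma swap_automorphism:
  assumes kl: "k \<noteq> (l::2)"
  defines "p \<equiv> (\<lambda>s. if s = k then poly_gen l else poly_gen k :: (2, 'k::field) polynomial_algebra)"
  shows "algebra_automorphism (psubst p)" "liftable (psubst p)"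
proof -
  define P where "P s = (if s = k then free_gen l else free_gen k :: (2, 'k) free_algebra)" for s
  have "abelianize (P s) = p s" for s by (simp add: P_def p_def abelianize_free_gen)
  moreover have "free_subst P (P s) = free_gen s" for s
    using two_cases[OF kl, of s] kl by (auto simp: P_def)
  ultimately show "algebra_automorphism (psubst p)" "liftable (psubst p)"
    using lift_automorphism[of P p P p] by blast+
qed

subsection \<open>Automorphisms fixing a generator\<close>

lemma degree_1E:
  assumes "degree p = 1"
  obtains a b where "p = [:a, b:]" "b \<noteq> 0"
proof
  show "p = [:coeff p 0, coeff p 1:]"
    using assms by (intro poly_eqI) (auto simp: coeff_pCons coeff_eq_0 split: nat.split)
  show "coeff p 1 \<noteq> 0" using assms by (metis leading_coeff_0_iff degree_0 zero_neq_one)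
qed

lemma ring_homo_pcompose: "ring_homo (\<lambda>p. pcompose p q)"
  by (simp add: ring_homo_def pcompose_add pcompose_mult pcompose_1)

lemma ring_homo_poly_eval: "ring_homo (\<lambda>p. poly p (a :: 'a::comm_ring_1))"
  by (simp add: ring_homo_def)

text \<open>Homogenization: the new variable records the total degree.\<close>

definition homogenize :: "(2, 'k::field) polynomial_algebra \<Rightarrow> (2, 'k) polynomial_algebra poly" where
  "homogenize = poly_subst poly_const (\<lambda>s. monom (poly_gen s) 1)"

lemma ring_homo_homogenize: "ring_homo homogenize"
  unfolding homogenize_def by (rule ring_homo_poly_subst[OF ring_homo_poly_const])

lemma homogenize_const: "homogenize (single 0 c) = poly_const c"
  and homogenize_gen: "homogenize (poly_gen s) = monom (poly_gen s) 1"
  unfolding homogenize_def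
  by (simp_all only: poly_subst_const[OF ring_homo_poly_const] poly_subst_gen[OF ring_homo_poly_const])

text \<open>Setting the homogenizing variable to 1 returns z, setting it to 0 returns the value of z
  at the origin, a scalar. In degree 0 the two agree.\<close>

lemma homogenize_degree_0:
  fixes z :: "(2, 'k::field) polynomial_algebra"
  assumes "degree (homogenize z) = 0"
  shows "\<exists>c. z = single 0 c"
proof -
  have "poly (homogenize z) 1 = z"
    by (rule poly_hom_eqI[of "\<lambda>z. poly (homogenize z) 1" "\<lambda>z. z"])
      (simp_all add: ring_homo_comp[OF ring_homo_poly_eval ring_homo_homogenize] ring_homo_def[of "\<lambda>z. z"]
        homogenize_const homogenize_gen poly_monom)
  moreover have "homogenize z = [:coeff (homogenize z) 0:]"
    using assms by (intro constant_if_degree_0) simp_all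
  from arg_cong[OF this, of "\<lambda>p. poly p 1"] have "poly (homogenize z) 1 = coeff (homogenize z) 0" by simp
  ultimately have "z = coeff (homogenize z) 0" by simp
  also have "\<dots> = psubst (\<lambda>s. 0) z"
    unfolding homogenize_def coeff_0_poly_subst by simp
  also have "\<exists>c. psubst (\<lambda>s. 0) z = (single 0 c :: (2, 'k) polynomial_algebra)"
  proof (induction z rule: poly_mapping_additive_induct)
    case (single m c)
    have "\<exists>d. (\<Prod>s\<in>UNIV. (0 :: (2, 'k) polynomial_algebra) ^ lookup m s) = single 0 d"
    proof (cases "m = 0")
      case True
      then show ?thesis by (intro exI[of _ 1]) simp
    next
      case False
      then obtain s where "lookup m s \<noteq> 0" by (metis poly_mapping_eqI lookup_zero)
      then have "(\<Prod>s\<in>UNIV. (0 :: (2, 'k) polynomial_algebra) ^ lookup m s) = 0"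
        by (intro prod_zero) auto
      then show ?thesis by (intro exI[of _ 0]) simp
    qed
    then obtain d where "(\<Prod>s\<in>UNIV. (0 :: (2, 'k) polynomial_algebra) ^ lookup m s) = single 0 d" ..
    then show ?case by (auto simp: poly_subst_single[OF ring_homo_const] mult_single)
  next
    case (add p q)
    then obtain a b where "psubst (\<lambda>s. 0) p = (single 0 a :: (2, 'k) polynomial_algebra)"
      "psubst (\<lambda>s. 0) q = (single 0 b :: (2, 'k) polynomial_algebra)" by blast
    then show ?case
      by (intro exI[of _ "a + b"])
        (simp add: single_add ring_homoD(1)[OF ring_homo_poly_subst[OF ring_homo_const]])
  qed
  finally show ?thesis by blast
qed

lemma degree_homogenize_gen: "degree (homogenize (poly_gen s)) = 1"
  by (simp add: homogenize_gen degree_monom_eq poly_gen_nonzero)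

lemma homogenize_aeval: "homogenize (aeval t z) = pcompose (map_poly (single 0) t) (homogenize z)"
  by (induction t)
    (simp_all add: ring_homoD[OF ring_homo_homogenize] homogenize_const map_poly_pCons pcompose_pCons)

lemma unit_is_const:
  assumes "u * w = (1 :: (2, 'k::field) polynomial_algebra)"
  shows "\<exists>c. c \<noteq> 0 \<and> u = single 0 c"
proof -
  have "homogenize u * homogenize w = 1"
    using assms by (metis ring_homoD(2,3)[OF ring_homo_homogenize])
  then have "degree (homogenize u * homogenize w) = 0" "homogenize u \<noteq> 0" "homogenize w \<noteq> 0" by auto
  then have "degree (homogenize u) = 0" by (simp add: degree_mult_eq)
  then obtain c where "u = single 0 c" using homogenize_degree_0 by blast
  moreover have "c \<noteq> 0" using assms \<open>u = single 0 c\<close> by auto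
  ultimately show ?thesis by blast
qed

text \<open>Applying the inverse gives x_j = q(\<beta>^(-1) x_s). Homogenization turns this into a
  composition, where degrees multiply, and the total degree of x_j is 1.\<close>

lemma univariate_coordinate_linear:
  fixes \<beta> :: "(2, 'k::field) polynomial_algebra \<Rightarrow> (2, 'k) polynomial_algebra"
  assumes \<beta>: "algebra_automorphism \<beta>" and eq: "\<beta> (poly_gen j) = aeval q (poly_gen s)"
  shows "degree q = 1"
proof -
  have hom: "algebra_hom alg_scale alg_scale (inv \<beta>)"
    using algebra_automorphismD(1)[OF algebra_automorphism_inv[OF \<beta>]] .
  have "poly_gen j = aeval q (inv \<beta> (poly_gen s))"
    using arg_cong[OF eq, of "inv \<beta>"] by (simp add: algebra_automorphismD(3)[OF \<beta>] algebra_hom_aeval[OF hom])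
  from arg_cong[OF this, of "\<lambda>z. degree (homogenize z)"]
  have "degree (homogenize (poly_gen j :: (2, 'k) polynomial_algebra)) =
      degree (map_poly (single 0 :: 'k \<Rightarrow> (2, 'k) polynomial_algebra) q) * degree (homogenize (inv \<beta> (poly_gen s)))"
    by (simp only: homogenize_aeval degree_pcompose)
  moreover have "degree (map_poly (single 0 :: 'k \<Rightarrow> (2, 'k) polynomial_algebra) q) = degree q"
    by (cases "q = 0") (simp_all add: map_poly_degree_eq single_eq_0_iff)
  ultimately show ?thesis by (simp add: degree_homogenize_gen)
qed

text \<open>\<open>K\<close> writes an element as a polynomial in x_i over the polynomials in x_j.
  In these terms \<gamma> is composition with the polynomial of \<gamma> x_i. Its invertibility
  forces degree 1 with a unit, hence scalar, leading coefficient, so \<gamma> is elementary.\<close>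

lemma liftable_if_gen_fixed:
  fixes \<gamma> :: "(2, 'k::field) polynomial_algebra \<Rightarrow> (2, 'k) polynomial_algebra"
  assumes \<gamma>: "algebra_automorphism \<gamma>" and fixed: "\<gamma> (poly_gen j) = poly_gen j"
  shows "liftable \<gamma>"
proof -
  obtain i :: 2 where ij: "i \<noteq> j" by (metis zero_neq_one)
  note hom = algebra_automorphismD(1)[OF \<gamma>]
  define K where "K = poly_subst poly_const (\<lambda>s. if s = i then [:0, 1:] else [:poly_gen s:] :: (2, 'k) polynomial_algebra poly)"
  have K_hom: "ring_homo K" unfolding K_def by (rule ring_homo_poly_subst[OF ring_homo_poly_const])
  have K_const: "K (single 0 c) = poly_const c" and K_gen: "K (poly_gen s) = (if s = i then [:0, 1:] else [:poly_gen s:])" for c s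
    unfolding K_def by (simp_all only: poly_subst_const[OF ring_homo_poly_const] poly_subst_gen[OF ring_homo_poly_const])
  define P X where "P = \<gamma> (poly_gen i)" and "X = inv \<gamma> (poly_gen i)"
  have comp: "K (\<gamma> z) = pcompose (K z) (K P)" for z
  proof (rule poly_hom_eqI[of "\<lambda>z. K (\<gamma> z)" "\<lambda>z. pcompose (K z) (K P)"])
    show "ring_homo (\<lambda>z. K (\<gamma> z))" by (rule ring_homo_comp[OF K_hom algebra_hom_ring_homo[OF hom]])
    show "ring_homo (\<lambda>z. pcompose (K z) (K P))" by (rule ring_homo_comp[OF ring_homo_pcompose K_hom])
    show "K (\<gamma> (single 0 c)) = pcompose (K (single 0 c)) (K P)" for c
      by (simp add: algebra_hom_const[OF hom] K_const)
    show "K (\<gamma> (poly_gen s)) = pcompose (K (poly_gen s)) (K P)" for s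
      using two_cases[OF ij, of s] ij fixed by (auto simp: K_gen P_def pcompose_pCons)
  qed
  have X: "pcompose (K X) (K P) = [:0, 1:]"
    using comp[of X] by (simp add: X_def algebra_automorphismD(2)[OF \<gamma>] K_gen)
  from arg_cong[OF this, of degree] have "degree (K X) * degree (K P) = 1" by (simp add: degree_pcompose)
  then have "degree (K X) = 1" "degree (K P) = 1" by simp_all
  then obtain x0 x1 p0 p1 where x: "K X = [:x0, x1:]" and p: "K P = [:p0, p1:]"
    using degree_1E by metis
  have "x1 * p1 = 1" using arg_cong[OF X, of "\<lambda>p. coeff p 1"] unfolding x p by (simp add: pcompose_pCons)
  then obtain c where c: "c \<noteq> 0" "p1 = single 0 c" using unit_is_const[of p1 x1] by (auto simp: mult.commute)
  have "p0 = coeff (K P) 0" using p by simp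
  also have "\<dots> = psubst (\<lambda>s. if s = i then 0 else poly_gen s) P"
  proof -
    have "(\<lambda>s. coeff (if s = i then [:0, 1:] else [:poly_gen s:] :: (2, 'k) polynomial_algebra poly) 0) =
        (\<lambda>s. if s = i then 0 else poly_gen s)" by auto
    then show ?thesis unfolding K_def coeff_0_poly_subst by simp
  qed
  finally have p0: "p0 = psubst (\<lambda>s. if s = i then 0 else poly_gen s) P" .
  obtain t where t: "p0 = aeval t (poly_gen j)" using psubst_aeval[OF ij, of P] unfolding p0 by blast
  have "poly (K z) (poly_gen i) = z" for z
    by (rule poly_hom_eqI[of "\<lambda>z. poly (K z) (poly_gen i)" "\<lambda>z. z"])
      (auto simp: ring_homo_comp[OF ring_homo_poly_eval K_hom] ring_homo_def[of "\<lambda>z. z"] K_const K_gen)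
  from this[of P] have "P = p0 + poly_gen i * p1" by (simp add: p)
  then have P: "P = single 0 c * poly_gen i + aeval t (poly_gen j)" by (simp add: c t algebra_simps)
  have "\<gamma> = psubst (\<lambda>s. if s = i then single 0 c * poly_gen i + aeval t (poly_gen j) else poly_gen s)"
  proof
    fix z
    have "(\<lambda>s. \<gamma> (poly_gen s)) = (\<lambda>s. if s = i then single 0 c * poly_gen i + aeval t (poly_gen j) else poly_gen s)"
    proof
      fix s show "\<gamma> (poly_gen s) = (if s = i then single 0 c * poly_gen i + aeval t (poly_gen j) else poly_gen s)"
        using two_cases[OF ij, of s] fixed P by (auto simp: P_def)
    qed
    then show "\<gamma> z = psubst (\<lambda>s. if s = i then single 0 c * poly_gen i + aeval t (poly_gen j) else poly_gen s) z"
      using algebra_hom_eq_psubst[OF hom, of z] by simp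
  qed
  then show ?thesis using elementary_automorphism(2)[OF ij c(1)] by simp
qed

lemma liftable_if_univariate:
  fixes \<beta> :: "(2, 'k::field) polynomial_algebra \<Rightarrow> (2, 'k) polynomial_algebra"
  assumes \<beta>: "algebra_automorphism \<beta>" and eq: "\<beta> (poly_gen j) = aeval q (poly_gen j)"
  shows "liftable \<beta>"
proof -
  obtain i :: 2 where ij: "j \<noteq> i" by (metis zero_neq_one)
  obtain c0 c where q: "q = [:c0, c:]" "c \<noteq> 0"
    using univariate_coordinate_linear[OF \<beta> eq] degree_1E by metis
  \<comment> \<open>This is x_j -> (x_j - c0) / c, which undoes q. The constant is written as a
    constant polynomial in the other generator to fit the shape of
    \<open>elementary_automorphism\<close>.\<close>
  define \<theta> where "\<theta> = psubst (\<lambda>s. if s = j then single 0 (inverse c) * poly_gen j + aeval [:- (c0 / c):] (poly_gen i)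
    else poly_gen s :: (2, 'k) polynomial_algebra)"
  have \<theta>: "algebra_automorphism \<theta>" "liftable \<theta>"
    unfolding \<theta>_def using elementary_automorphism[OF ij, of "inverse c"] q(2) by simp_all
  have "\<theta> (\<beta> (poly_gen j)) = poly_gen j"
  proof -
    have "\<theta> (\<beta> (poly_gen j)) = aeval q (\<theta> (poly_gen j))"
      unfolding eq by (rule algebra_hom_aeval[OF algebra_automorphismD(1)[OF \<theta>(1)]])
    also have "\<theta> (poly_gen j) = single 0 (inverse c) * poly_gen j + single 0 (- (c0 / c))"
      unfolding \<theta>_def by (simp add: psubst_gen)
    also have "aeval q \<dots> = single 0 c0 + (single 0 (inverse c) * poly_gen j + single 0 (- (c0 / c))) * single 0 c"
      by (simp add: q)
    also have "\<dots> = single 0 c0 + (single 0 (inverse c * c) * poly_gen j + single 0 (- (c0 / c) * c))"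
      by (simp only: distrib_right distrib_left ring_homoD(3)[OF ring_homo_const] ac_simps)
    also have "\<dots> = poly_gen j"
      using q(2) by (simp add: ring_homoD(6)[OF ring_homo_const])
    finally show ?thesis .
  qed
  then have "liftable (\<lambda>z. \<theta> (\<beta> z))"
    by (intro liftable_if_gen_fixed[of _ j] algebra_automorphism_comp[OF \<theta>(1) \<beta>])
  then show ?thesis by (rule liftable_cancel[OF \<theta>])
qed

text \<open>A form of the Jung-van der Kulk theorem. The induction runs on the sum of the two
  partial degrees of a single coordinate, \<beta> x_j. As soon as that coordinate is univariate, the
  other one is already controlled by \<open>liftable_if_gen_fixed\<close>.\<close>

theorem automorphism_liftable:
  fixes \<beta> :: "(2, 'k::alg_closed_field) polynomial_algebra \<Rightarrow> (2, 'k) polynomial_algebra"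
  assumes "algebra_automorphism \<beta>"
  shows "liftable \<beta>"
proof -
  obtain i j :: 2 where ij: "i \<noteq> j" by (metis zero_neq_one)
  show ?thesis
    using assms
  proof (induction "degv i (\<beta> (poly_gen j)) + degv j (\<beta> (poly_gen j))" arbitrary: \<beta> rule: less_induct)
    case less
    let ?Q = "\<beta> (poly_gen j)"
    consider "degv i ?Q = 0" | "degv j ?Q = 0" | "degv i ?Q \<ge> 1" "degv j ?Q \<ge> 1" by linarith
    then show ?case
    proof cases
      case 1
      then show ?thesis using univariate_if_degv_0[OF ij] liftable_if_univariate[OF less.prems] by blast
    next
      case 2
      then obtain q where q: "?Q = aeval q (poly_gen i)" using univariate_if_degv_0[OF ij[symmetric]] by blast
      define \<theta> where "\<theta> = psubst (\<lambda>s. if s = i then poly_gen j else poly_gen i :: (2, 'k) polynomial_algebra)"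
      note \<theta> = swap_automorphism[OF ij, where 'k = 'k, folded \<theta>_def]
      have "\<theta> ?Q = aeval q (poly_gen j)"
        unfolding q algebra_hom_aeval[OF algebra_automorphismD(1)[OF \<theta>(1)]] by (simp add: \<theta>_def psubst_gen)
      then have "liftable (\<lambda>z. \<theta> (\<beta> z))"
        by (intro liftable_if_univariate[of _ j] algebra_automorphism_comp[OF \<theta>(1) less.prems])
      then show ?thesis by (rule liftable_cancel[OF \<theta>])
    next
      case 3
      obtain f where f: "nontrivial_family f" "poly_subst poly_const f ?Q = [:?Q:]"
        using coordinate_fixing_family[OF less.prems] by blast
      obtain k l n c r where kl: "k \<noteq> l" and edge: "n \<ge> 1" "degv l ?Q = n * degv k ?Q"
        "\<And>m. m \<in> keys ?Q \<Longrightarrow> n * lookup m k + lookup m l \<le> degv l ?Q"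
        "component (lin_weight (\<lambda>s. if s = k then real n else 1)) (real (degv l ?Q)) ?Q =
          single 0 c * (poly_gen k - single 0 r * poly_gen l ^ n) ^ degv k ?Q"
        using newton_edge[OF f ij 3] by metis
      define p where "p = (\<lambda>s. if s = k then poly_gen k + single 0 r * poly_gen l ^ n else poly_gen s :: (2, 'k) polynomial_algebra)"
      have p: "p = (\<lambda>s. if s = k then single 0 1 * poly_gen k + aeval (monom r n) (poly_gen l) else poly_gen s)"
        by (auto simp: p_def aeval_monom single_one)
      have \<theta>: "algebra_automorphism (psubst p)" "liftable (psubst p)"
        unfolding p using elementary_automorphism[OF kl, of 1] by simp_all
      \<comment> \<open>The edge returns its generators k and l in unknown order, whereas the
        induction measure is stated for i and j.\<close>
      have sum: "degv i z + degv j z = degv k z + degv l z" for z :: "(2, 'k) polynomial_algebra"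
        using two_cases[OF ij, of k] two_cases[OF ij, of l] kl by auto
      have "degv k ?Q \<ge> 1" using 3 two_cases[OF ij, of k] by auto
      note descent = elementary_descent[OF kl edge(1) this edge(2-4), folded p_def]
      have "liftable (\<lambda>z. psubst p (\<beta> z))"
        by (rule less.hyps) (use descent sum algebra_automorphism_comp[OF \<theta>(1) less.prems] in auto)
      then show ?thesis by (rule liftable_cancel[OF \<theta>])
    qed
  qed
qed

section \<open>Torus actions\<close>

lemma evaluate_at_add: "evaluate_at t (f + g) = evaluate_at t f + evaluate_at t g"
  unfolding evaluate_at_def
  by (rule setsum_keys_plus_distrib) (simp_all add: vector_space.vector_space_assms(1)[OF vector_space_scale])

lemma evaluate_at_single: "evaluate_at t (single \<alpha> f) = alg_scale (character \<alpha> t) f"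
  by (cases "f = 0") (simp_all add: evaluate_at_def)

lemma character_add: "t \<in> torus \<Longrightarrow> character (\<alpha> + \<beta>) t = character \<alpha> t * character \<beta> t"
  by (simp add: character_def torus_def power_int_add prod.distrib)

lemma evaluate_at_const: "evaluate_at t (single 0 f) = f"
  by (simp add: evaluate_at_single character_def vector_space.vector_space_assms(4)[OF vector_space_scale])

lemma ring_homo_evaluate_at:
  fixes t :: "'k::field ^ 'r::finite"
  assumes "t \<in> torus"
  shows "ring_homo (evaluate_at t :: ('r, 'm::monoid_add \<Rightarrow>\<^sub>0 'k) laurent \<Rightarrow> _)"
proof (rule ring_homoI)
  show "evaluate_at t (1 :: ('r, 'm \<Rightarrow>\<^sub>0 'k) laurent) = 1"
    using evaluate_at_const[of t "1 :: 'm \<Rightarrow>\<^sub>0 'k"] by (simp add: single_one)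
  show "evaluate_at t (f * g) = evaluate_at t f * evaluate_at t g" for f g :: "('r, 'm \<Rightarrow>\<^sub>0 'k) laurent"
  proof (rule additive_mult, rule evaluate_at_add)
    fix \<alpha> \<beta> :: "int ^ 'r" and a b :: "'m \<Rightarrow>\<^sub>0 'k"
    let ?c = "\<lambda>\<alpha>. single 0 (character \<alpha> t) :: 'm \<Rightarrow>\<^sub>0 'k"
    have "?c (\<alpha> + \<beta>) * (a * b) = ?c \<alpha> * (?c \<beta> * a) * b"
      by (simp only: character_add[OF assms] const_mult mult.assoc)
    also have "?c \<beta> * a = a * ?c \<beta>" by (rule const_commutes)
    finally show "evaluate_at t (single \<alpha> a * single \<beta> b) = evaluate_at t (single \<alpha> a) * evaluate_at t (single \<beta> b)"
      by (simp add: mult_single evaluate_at_single scale_eq_mult mult.assoc)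
  qed
qed (rule evaluate_at_add)

lemma algebra_hom_specialization:
  assumes "regular_action \<sigma>" "t \<in> torus"
  shows "algebra_hom alg_scale alg_scale (specialization \<sigma> t)"
proof -
  have \<sigma>: "algebra_hom alg_scale laurent_scale \<sigma>" using assms(1) by (simp add: regular_action_def)
  have "\<sigma> (single 0 c) = single 0 (single 0 c)" for c
  proof -
    have "\<sigma> (single 0 c) = laurent_scale c 1"
      using algebra_homD(2)[OF \<sigma>, of c 1] algebra_homD(3)[OF \<sigma>] by (simp add: scale_eq_mult)
    also have "\<dots> = single 0 (single 0 c)"
      by (rule poly_mapping_eqI)
        (simp add: lookup_laurent_scale lookup_one lookup_single when_def scale_eq_mult)
    finally show ?thesis .
  qed
  moreover have "ring_homo \<sigma>" using algebra_homD[OF \<sigma>] by (simp add: ring_homo_def)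
  ultimately show ?thesis
    using ring_homo_comp[OF ring_homo_evaluate_at[OF assms(2)], of \<sigma>]
    by (simp add: algebra_hom_iff specialization_def o_def evaluate_at_const)
qed

section \<open>Inverses in the torus and invertibility of the specializations\<close>

definition torus_inverse :: "'k::field ^ 'r \<Rightarrow> 'k ^ 'r" where
  "torus_inverse t = (\<chi> i. inverse (t $ i))"

lemma torus_inverse:
  assumes "t \<in> torus"
  shows "torus_inverse t \<in> torus" "torus_inverse t * t = 1" "t * torus_inverse t = 1"
  using assms by (auto simp: torus_def torus_inverse_def vec_eq_iff)

lemma specialization_inverse:
  assumes "regular_action \<sigma>" "t \<in> torus"
  shows "specialization \<sigma> t (specialization \<sigma> (torus_inverse t) z) = z"
    "specialization \<sigma> (torus_inverse t) (specialization \<sigma> t z) = z"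
  using assms torus_inverse[OF assms(2)] unfolding regular_action_def by (metis comp_apply id_apply)+

lemma algebra_automorphism_specialization:
  assumes "regular_action \<sigma>" "t \<in> torus"
  shows "algebra_automorphism (specialization \<sigma> t)"
  unfolding algebra_automorphism_def
  using algebra_hom_specialization[OF assms] specialization_inverse[OF assms]
  by (auto intro!: o_bij[of "specialization \<sigma> (torus_inverse t)"])

subsection \<open>Linear combinations of generators\<close>

lemma span_gensE:
  fixes gen :: "'n::finite \<Rightarrow> ('m::monoid_add \<Rightarrow>\<^sub>0 'k::field)"
  assumes "f \<in> module.span alg_scale (range gen)"
  obtains c where "f = (\<Sum>k\<in>UNIV. single 0 (c k) * gen k)"
proof -
  interpret vector_space "alg_scale :: 'k \<Rightarrow> ('m \<Rightarrow>\<^sub>0 'k) \<Rightarrow> _" by (rule vector_space_scale)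
  have "f \<in> {f. \<exists>c. f = (\<Sum>k\<in>UNIV. single 0 (c k) * gen k)}" (is "f \<in> ?S")
  proof (rule subsetD[OF span_minimal assms])
    show "subspace ?S"
    proof (rule subspaceI)
      show "0 \<in> ?S"
        by (auto intro!: exI[of _ "\<lambda>_. 0"])
    next
      fix f g assume "f \<in> ?S" "g \<in> ?S"
      then obtain c d where "f = (\<Sum>k\<in>UNIV. single 0 (c k) * gen k)" "g = (\<Sum>k\<in>UNIV. single 0 (d k) * gen k)"
        by auto
      then show "f + g \<in> ?S"
        by (auto intro!: exI[of _ "\<lambda>k. c k + d k"] simp: single_add distrib_right sum.distrib)
    next
      fix a f assume "f \<in> ?S"
      then obtain c where "f = (\<Sum>k\<in>UNIV. single 0 (c k) * gen k)" by auto
      then show "alg_scale a f \<in> ?S"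
        by (auto intro!: exI[of _ "\<lambda>k. a * c k"] sum.cong
            simp: scale_eq_mult sum_distrib_left ring_homoD(3)[OF ring_homo_const] mult.assoc)
    qed
    have "gen i = (\<Sum>k\<in>UNIV. single 0 (if k = i then 1 else 0) * gen k)" for i
    proof -
      have "gen i = (\<Sum>k\<in>UNIV. if k = i then gen i else 0)" by simp
      also have "\<dots> = (\<Sum>k\<in>UNIV. single 0 (if k = i then 1 else 0) * gen k)"
        by (rule sum.cong) (auto simp: single_one)
      finally show ?thesis .
    qed
    then have "gen i \<in> ?S" for i
      by (intro CollectI exI[of _ "\<lambda>k. if k = i then 1 else 0"])
    then show "range gen \<subseteq> ?S" by (rule image_subsetI)
  qed
  then show ?thesis using that by blast
qed

lemma span_gensI:
  fixes gen :: "'n::finite \<Rightarrow> ('m::monoid_add \<Rightarrow>\<^sub>0 'k::field)"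
  assumes "\<And>k. f k \<in> module.span alg_scale (range gen)"
  shows "(\<Sum>k\<in>A. single 0 (c k) * f k) \<in> module.span alg_scale (range gen)"
proof -
  interpret vector_space "alg_scale :: 'k \<Rightarrow> ('m \<Rightarrow>\<^sub>0 'k) \<Rightarrow> _" by (rule vector_space_scale)
  show ?thesis
    unfolding scale_eq_mult[symmetric] by (intro span_sum span_scale assms)
qed

lemma gen_in_span: "gen k \<in> module.span alg_scale (range gen :: ('m::monoid_add \<Rightarrow>\<^sub>0 'k::field) set)"
proof -
  interpret vector_space "alg_scale :: 'k \<Rightarrow> ('m \<Rightarrow>\<^sub>0 'k) \<Rightarrow> _" by (rule vector_space_scale)
  show ?thesis by (rule span_base) simp
qed

lemma lookup_linear_form:
  "lookup (\<Sum>k\<in>UNIV. single 0 (c k) * poly_gen k :: ('n::finite, 'k::field) polynomial_algebra) (single l 1) = c l"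
proof -
  have "lookup (single 0 (c k) * poly_gen k :: ('n, 'k) polynomial_algebra) (single l 1) = (if k = l then c l else 0)" for k
  proof -
    have "single k (1::nat) = single l 1 \<longleftrightarrow> k = l"
      by (metis lookup_single_eq lookup_single_not_eq one_neq_zero)
    then show ?thesis by (auto simp: poly_gen_def mult_single lookup_single when_def)
  qed
  then show ?thesis by (simp add: lookup_sum)
qed

text \<open>Abelianization is injective on linear forms, since it preserves the coefficients of the
  generators.\<close>

lemma linear_form_eq_gen:
  fixes f :: "('n::finite, 'k::field) free_algebra"
  assumes f: "f \<in> module.span alg_scale (range free_gen)" and ab: "abelianize f = poly_gen i"
  shows "f = free_gen i"
proof -
  obtain c where c: "f = (\<Sum>k\<in>UNIV. single 0 (c k) * free_gen k)" using span_gensE[OF f] .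
  have "(\<Sum>k\<in>UNIV. single 0 (c k) * poly_gen k) = (poly_gen i :: ('n, 'k) polynomial_algebra)"
    using ab unfolding c
    by (simp add: ring_homoD[OF ring_homo_abelianize] abelianize_free_gen)
  also have "\<dots> = (\<Sum>k\<in>UNIV. if k = i then poly_gen i else 0)" by simp
  also have "\<dots> = (\<Sum>k\<in>UNIV. single 0 (if k = i then 1 else 0) * poly_gen k)"
    by (rule sum.cong) (auto simp: single_one)
  finally have eq: "(\<Sum>k\<in>UNIV. single 0 (c k) * poly_gen k) =
      (\<Sum>k\<in>UNIV. single 0 (if k = i then 1 else 0 :: 'k) * poly_gen k)" .
  have "c l = (if l = i then 1 else 0)" for l
    using arg_cong[OF eq, of "\<lambda>z. lookup z (single l 1)"] unfolding lookup_linear_form .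
  then have "f = (\<Sum>k\<in>UNIV. single 0 (if k = i then 1 else 0) * free_gen k)" unfolding c by simp
  also have "\<dots> = (\<Sum>k\<in>UNIV. if k = i then free_gen i else 0)"
    by (rule sum.cong) (auto simp: single_one)
  finally show ?thesis by simp
qed

text \<open>An automorphism is determined by its abelianization.\<close>

lemma linear_if_abelianization_linear:
  fixes \<phi> :: "(2, 'k::field) free_algebra \<Rightarrow> (2, 'k) free_algebra"
  assumes \<phi>: "algebra_automorphism \<phi>"
    and L: "algebra_hom alg_scale alg_scale L" "\<And>f. abelianize (\<phi> f) = L (abelianize f)"
    and L': "algebra_hom alg_scale alg_scale L'" "\<And>z. L (L' z) = z" "\<And>z. L' (L z) = z"
    and lin: "\<And>i. L (poly_gen i) \<in> module.span alg_scale (range poly_gen)"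
      "\<And>i. L' (poly_gen i) \<in> module.span alg_scale (range poly_gen)"
  shows "\<phi> (free_gen i) \<in> module.span alg_scale (range free_gen)"
proof -
  have lift: "\<exists>P. \<forall>i. P i \<in> module.span alg_scale (range free_gen) \<and> abelianize (P i) = M (poly_gen i)"
    if M: "\<And>i. M (poly_gen i) \<in> module.span alg_scale (range poly_gen)"
    for M :: "(2, 'k) polynomial_algebra \<Rightarrow> (2, 'k) polynomial_algebra"
  proof -
    have "\<exists>f. f \<in> module.span alg_scale (range free_gen) \<and> abelianize f = M (poly_gen i)" for i
    proof -
      obtain c where c: "M (poly_gen i) = (\<Sum>k\<in>UNIV. single 0 (c k) * poly_gen k)"
        using span_gensE[OF M] .
      show ?thesis
        by (intro exI[of _ "\<Sum>k\<in>UNIV. single 0 (c k) * free_gen k"] conjI span_gensI gen_in_span)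
          (simp add: c ring_homoD[OF ring_homo_abelianize] abelianize_free_gen)
    qed
    then show ?thesis by metis
  qed
  obtain P where P: "\<And>i. P i \<in> module.span alg_scale (range free_gen)" "\<And>i. abelianize (P i) = L (poly_gen i)"
    using lift[of L, OF lin(1)] by blast
  obtain P' where P': "\<And>i. P' i \<in> module.span alg_scale (range free_gen)" "\<And>i. abelianize (P' i) = L' (poly_gen i)"
    using lift[of L', OF lin(2)] by blast
  have ab: "abelianize (free_subst P f) = L (abelianize f)" for f
    unfolding algebra_hom_eq_psubst[OF L(1), of "abelianize f"] by (rule abelianize_free_subst[OF P(2)])
  have ab': "abelianize (free_subst P' f) = L' (abelianize f)" for f
    unfolding algebra_hom_eq_psubst[OF L'(1), of "abelianize f"] by (rule abelianize_free_subst[OF P'(2)])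
  have span: "free_subst R f \<in> module.span alg_scale (range free_gen)"
    if R: "\<And>i. R i \<in> module.span alg_scale (range free_gen)" and f: "f \<in> module.span alg_scale (range free_gen)"
    for R :: "2 \<Rightarrow> (2, 'k) free_algebra" and f
  proof -
    obtain c where c: "f = (\<Sum>k\<in>UNIV. single 0 (c k) * free_gen k)" using span_gensE[OF f] .
    show ?thesis
      unfolding c by (simp add: ring_homoD[OF ring_homo_free_subst] span_gensI[OF R])
  qed
  \<comment> \<open>Both composites are linear forms whose abelianization is x_i, so the linear
    lifts of L and L' are inverse to each other.\<close>
  have "free_subst P (P' i) = free_gen i" "free_subst P' (P i) = free_gen i" for i
    by (rule linear_form_eq_gen[OF span]; simp add: P P' ab ab' L')+
  then have \<Lambda>: "algebra_automorphism (free_subst P)" by (rule free_automorphismI)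
  have "abelianize (inv (free_subst P) (\<phi> f)) = abelianize f" for f
  proof -
    have "L (abelianize (inv (free_subst P) (\<phi> f))) = L (abelianize f)"
      using ab[of "inv (free_subst P) (\<phi> f)"] by (simp add: algebra_automorphismD(2)[OF \<Lambda>] L(2))
    then show ?thesis by (metis L'(3))
  qed
  \<comment> \<open>The quotient of \<phi> by the linear lift of L induces the identity, so it is
    the identity and \<phi> equals that lift.\<close>
  then have "inv (free_subst P) (\<phi> f) = f" for f
    using kernel_automorphism_trivial[OF algebra_automorphism_comp[OF algebra_automorphism_inv[OF \<Lambda>] \<phi>]] by blast
  then have "\<phi> (free_gen i) = free_subst P (free_gen i)" by (metis algebra_automorphismD(2)[OF \<Lambda>])
  then show ?thesis using P(1) by simp
qed

theorem proposition1p2: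
  fixes \<sigma> :: "(2, 'k::alg_closed_field) free_algebra
    \<Rightarrow> ('r::finite, (2, 'k) free_algebra) laurent"
  assumes "regular_action \<sigma>"
    and "effective \<sigma>"
    and "linearizable poly_gen (abelianization \<sigma>)"
  shows "linearizable free_gen \<sigma>"
proof -
  let ?\<sigma>' = "abelianization \<sigma>"
  have \<sigma>: "algebra_hom alg_scale laurent_scale \<sigma>" using assms(1) by (simp add: regular_action_def)
  have reg': "regular_action ?\<sigma>'" by (rule regular_action_abelianization[OF assms(1)])
  obtain \<beta> where \<beta>: "algebra_automorphism \<beta>"
    and lin: "linear_action poly_gen (\<lambda>t. inv \<beta> \<circ> specialization ?\<sigma>' t \<circ> \<beta>)"
    using assms(3) unfolding linearizable_def by blast
  note \<beta>_inv = algebra_automorphismD(2,3)[OF \<beta>]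
  obtain B where B: "algebra_automorphism B" and ab: "\<And>f. abelianize (B f) = \<beta> (abelianize f)"
    using automorphism_liftable[OF \<beta>] unfolding liftable_def by blast
  have ab_inv: "abelianize (inv B f) = inv \<beta> (abelianize f)" for f
    by (metis ab algebra_automorphismD(2)[OF B] \<beta>_inv(2))
  define L where "L t z = inv \<beta> (specialization ?\<sigma>' t (\<beta> z))" for t z
  have hom: "algebra_hom alg_scale alg_scale (L s)" if "s \<in> torus" for s
      unfolding L_def
      by (intro algebra_hom_comp[OF algebra_automorphismD(1)[OF algebra_automorphism_inv[OF \<beta>]]]
          algebra_hom_comp[OF algebra_hom_specialization[OF reg' that] algebra_automorphismD(1)[OF \<beta>]])
  have lin': "L s (poly_gen i) \<in> module.span alg_scale (range poly_gen)" if "s \<in> torus" for s i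
      using lin that by (simp add: linear_action_def L_def)
  have "inv B (specialization \<sigma> t (B (free_gen i))) \<in> module.span alg_scale (range free_gen)"
    if t: "t \<in> torus" for t i
  \<comment> \<open>The inverse of L(t) is linear as well because it is L(t^(-1)), another member of
    the linearized action.\<close>
  proof (rule linear_if_abelianization_linear[where L = "L t" and L' = "L (torus_inverse t)"])
    note t' = torus_inverse(1)[OF t]
    show "algebra_automorphism (\<lambda>f. inv B (specialization \<sigma> t (B f)))"
      by (intro algebra_automorphism_comp[OF algebra_automorphism_inv[OF B]]
          algebra_automorphism_comp[OF algebra_automorphism_specialization[OF assms(1) t] B])
    show "abelianize (inv B (specialization \<sigma> t (B f))) = L t (abelianize f)" for f
      by (simp add: L_def ab_inv specialization_abelianization[OF \<sigma>, symmetric] ab)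
    show "L t (L (torus_inverse t) z) = z" "L (torus_inverse t) (L t z) = z" for z
      by (simp_all add: L_def \<beta>_inv specialization_inverse[OF reg' t])
    show "algebra_hom alg_scale alg_scale (L t)" "algebra_hom alg_scale alg_scale (L (torus_inverse t))"
      using hom t t' by blast+
    show "L t (poly_gen i) \<in> module.span alg_scale (range poly_gen)"
      "L (torus_inverse t) (poly_gen i) \<in> module.span alg_scale (range poly_gen)" for i
      using lin' t t' by blast+
  qed
  then have "linear_action free_gen (\<lambda>t. inv B \<circ> specialization \<sigma> t \<circ> B)"
    by (simp add: linear_action_def)
  then show ?thesis using B unfolding linearizable_def by blast
qed

end
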